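(* Let $d\in\mathbb{N}$ and let $m$ be a real-valued Radon measure on $\mathbb{R}^d$ (not necessarily finite) such that for every $\eta>0$ there exists $\beta_\eta<\infty$ with $$\int|f|^2\,d|m|\le\eta\left(\int|\nabla f|^2\,dx+\beta_\eta\int|f|^2\,dx\right),\qquad f\in C_0^\infty(\mathbb{R}^d).$$ Then the operators $-\Delta+\varepsilon^2\Delta^2+m$ converge to $-\Delta+m$ in the norm resolvent sense in $L^2(\mathbb{R}^d,dx)$ as $\varepsilon\downarrow 0$.
   Context: A real-valued Radon measure $m$ on $\mathbb{R}^d$ is written $m=m^+-m^-$ with positive Radon measures $m^\pm$ such that $m^+(\mathbb{R}^d\setminus B)=0=m^-(B)$ for some Borel set $B$; $|m|=m^++m^-$. $C_0^\infty(\mathbb{R}^d)$ is the space of smooth functions with compact support. Under the stated hypothesis on $m$ there is a unique bounded linear map $J_m:H^1(\mathbb{R}^d)\to L^2(\mathbb{R}^d,|m|)$ with $J_mf=f$ for $f\in C_0^\infty(\mathbb{R}^d)$. Let $A_m$ be the operator on $L^2(\mathbb{R}^d,|m|)$ given by $A_mh(x)=h(x)$ for $x\in B$ and $A_mh(x)=-h(x)$ for $x\notin B$. For $\varepsilon\ge0$ let $$\mathcal{E}_\varepsilon^m(f,f)=\varepsilon^2(\Delta f,\Delta f)+(\nabla f,\nabla f)+(A_mJ_mf,J_mf)_{L^2(|m|)},$$ with domain $H^2(\mathbb{R}^d)$ if $\varepsilon>0$, and $H^1(\mathbb{R}^d)$ if $\varepsilon=0$ (in which case the term $\varepsilon^2(\Delta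 f,\Delta f)$ is absent). This form is lower semibounded and closed in $L^2(\mathbb{R}^d,dx)$, and $-\Delta+\varepsilon^2\Delta^2+m$ (respectively $-\Delta+m$ for $\varepsilon=0$) denotes the associated lower semibounded self-adjoint operator in $L^2(\mathbb{R}^d,dx)$. *)

theory Defs
  imports "HOL-Analysis.Analysis"
begin

text \<open>
  \<open>\<real>\<^sup>d\<close> is an arbitrary type of class \<open>euclidean_space\<close>, with \<open>d = DIM('a)\<close>; all functions are
  complex-valued. Elements of an \<open>L\<^sup>2\<close> space are represented by measurable functions, and equality
  in \<open>L\<^sup>2\<close> is equality almost everywhere. Scalar products are linear in the first argument.
\<close>

definition L2_space :: "'a measure \<Rightarrow> ('a \<Rightarrow> complex) set" where
  "L2_space M = {f. f \<in> borel_measurable M \<and> integrable M (\<lambda>x. (norm (f x))\<^sup>2)}"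

definition L2_inner :: "'a measure \<Rightarrow> ('a \<Rightarrow> complex) \<Rightarrow> ('a \<Rightarrow> complex) \<Rightarrow> complex" where
  "L2_inner M f g = (\<integral>x. f x * cnj (g x) \<partial>M)"

definition L2_norm :: "'a measure \<Rightarrow> ('a \<Rightarrow> complex) \<Rightarrow> real" where
  "L2_norm M f = sqrt (\<integral>x. (norm (f x))\<^sup>2 \<partial>M)"


section \<open>Test functions and Sobolev spaces\<close>

definition partial_deriv :: "'a::euclidean_space \<Rightarrow> ('a \<Rightarrow> complex) \<Rightarrow> 'a \<Rightarrow> complex" where
  "partial_deriv b f = (\<lambda>x. frechet_derivative f (at x) b)"

primrec Ck :: "nat \<Rightarrow> ('a::euclidean_space \<Rightarrow> complex) \<Rightarrow> bool" where
  "Ck 0 f = continuous_on UNIV f"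
| "Ck (Suc k) f = (f differentiable_on UNIV \<and> (\<forall>b\<in>Basis. Ck k (partial_deriv b f)))"

definition C0_infinity :: "('a::euclidean_space \<Rightarrow> complex) set" where
  "C0_infinity = {f. (\<forall>k. Ck k f) \<and> compact (closure {x. f x \<noteq> 0})}"

definition has_weak_partial ::
  "'a::euclidean_space \<Rightarrow> ('a \<Rightarrow> complex) \<Rightarrow> ('a \<Rightarrow> complex) \<Rightarrow> bool" where
  "has_weak_partial b f g \<longleftrightarrow>
     (\<forall>\<phi>\<in>C0_infinity. (\<integral>x. f x * partial_deriv b \<phi> x \<partial>lborel) = - (\<integral>x. g x * \<phi> x \<partial>lborel))"

text \<open>Unique up to a null set for \<open>f \<in> H1\<close>.\<close>
definition weak_partial :: "'a::euclidean_space \<Rightarrow> ('a \<Rightarrow> complex) \<Rightarrow> 'a \<Rightarrow> complex" where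
  "weak_partial b f = (SOME g. g \<in> L2_space lborel \<and> has_weak_partial b f g)"

definition H1 :: "('a::euclidean_space \<Rightarrow> complex) set" where
  "H1 = {f \<in> L2_space lborel. \<forall>b\<in>Basis. \<exists>g\<in>L2_space lborel. has_weak_partial b f g}"

definition H2 :: "('a::euclidean_space \<Rightarrow> complex) set" where
  "H2 = {f \<in> H1. \<forall>b\<in>Basis. weak_partial b f \<in> H1}"

definition H1_norm :: "('a::euclidean_space \<Rightarrow> complex) \<Rightarrow> real" where
  "H1_norm f =
     sqrt ((L2_norm lborel f)\<^sup>2 + (\<Sum>b\<in>Basis. (L2_norm lborel (weak_partial b f))\<^sup>2))"

definition weak_laplacian :: "('a::euclidean_space \<Rightarrow> complex) \<Rightarrow> 'a \<Rightarrow> complex" where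
  "weak_laplacian f = (\<lambda>x. \<Sum>b\<in>Basis. weak_partial b (weak_partial b f) x)"


section \<open>Real-valued Radon measures\<close>

text \<open>On \<open>\<real>\<^sup>d\<close> a Borel measure that is finite on compact sets is automatically regular.\<close>
definition radon_measure :: "'a::euclidean_space measure \<Rightarrow> bool" where
  "radon_measure M \<longleftrightarrow> sets M = sets borel \<and> (\<forall>K. compact K \<longrightarrow> emeasure M K < \<infinity>)"

text \<open>
  The triple \<open>(mp, mm, B)\<close> stands for the real-valued Radon measure \<open>m = mp - mm\<close> together with
  a Borel set \<open>B\<close> that witnesses that \<open>mp = m\<^sup>+\<close> and \<open>mm = m\<^sup>-\<close> are mutually singular. Neither part
  need be finite, so \<open>m\<close> itself need not be defined on unbounded Borel sets.
\<close>
definition real_radon_measure ::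
  "'a::euclidean_space measure \<Rightarrow> 'a measure \<Rightarrow> 'a set \<Rightarrow> bool" where
  "real_radon_measure mp mm B \<longleftrightarrow> radon_measure mp \<and> radon_measure mm \<and>
     B \<in> sets borel \<and> emeasure mp (- B) = 0 \<and> emeasure mm B = 0"

definition abs_measure ::
  "'a::euclidean_space measure \<Rightarrow> 'a measure \<Rightarrow> 'a measure" where
  "abs_measure mp mm = measure_of UNIV (sets borel) (\<lambda>X. emeasure mp X + emeasure mm X)"

lemma space_abs_measure [simp]: "space (abs_measure mp mm) = UNIV"
  by (simp add: abs_measure_def space_measure_of_conv)

lemma sets_abs_measure [simp, measurable_cong]: "sets (abs_measure mp mm) = sets borel"
  unfolding abs_measure_def using sets.sets_measure_of_eq[of borel] by simp

lemma emeasure_abs_measure: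
  assumes "sets mp = sets borel" "sets mm = sets borel" "X \<in> sets borel"
  shows "emeasure (abs_measure mp mm) X = emeasure mp X + emeasure mm X"
proof (rule emeasure_measure_of[OF abs_measure_def])
  show "countably_additive (sets (abs_measure mp mm)) (\<lambda>X. emeasure mp X + emeasure mm X)"
    using assms by (auto simp: countably_additive_def suminf_add[symmetric] suminf_emeasure)
qed (use assms in \<open>auto simp: positive_def\<close>)


section \<open>The form and the associated operator\<close>

definition is_trace_map ::
  "'a::euclidean_space measure \<Rightarrow> (('a \<Rightarrow> complex) \<Rightarrow> ('a \<Rightarrow> complex)) \<Rightarrow> bool" where
  "is_trace_map \<mu> J \<longleftrightarrow>
     (\<forall>f\<in>H1. J f \<in> L2_space \<mu>) \<and>
     (\<forall>f\<in>H1. \<forall>g\<in>H1. AE x in \<mu>. J (\<lambda>y. f y + g y) x = J f x + J g x) \<and>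
     (\<forall>f\<in>H1. \<forall>c. AE x in \<mu>. J (\<lambda>y. c * f y) x = c * J f x) \<and>
     (\<exists>C. \<forall>f\<in>H1. L2_norm \<mu> (J f) \<le> C * H1_norm f) \<and>
     (\<forall>f\<in>C0_infinity. AE x in \<mu>. J f x = f x)"

text \<open>
  The map \<open>J\<^sub>m : H\<^sup>1 \<rightarrow> L\<^sup>2(|m|)\<close>, for \<open>\<mu> = |m|\<close>. It exists under the form bound on \<open>|m|\<close>, and is
  unique up to \<open>\<mu>\<close>-null sets because \<open>C0_infinity\<close> is dense in \<open>H1\<close>. It is not the identity:
  \<open>\<mu>\<close> may charge Lebesgue null sets.
\<close>
definition trace_map ::
  "'a::euclidean_space measure \<Rightarrow> ('a \<Rightarrow> complex) \<Rightarrow> 'a \<Rightarrow> complex" where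
  "trace_map \<mu> = (SOME J. is_trace_map \<mu> J)"

definition sign_op :: "'a set \<Rightarrow> ('a \<Rightarrow> complex) \<Rightarrow> 'a \<Rightarrow> complex" where
  "sign_op B h = (\<lambda>x. if x \<in> B then h x else - h x)"

definition form_domain :: "real \<Rightarrow> ('a::euclidean_space \<Rightarrow> complex) set" where
  "form_domain \<epsilon> = (if \<epsilon> = 0 then H1 else H2)"

text \<open>The sesquilinear form obtained by polarization from \<open>f \<mapsto> \<E>\<^sub>\<epsilon>\<^sup>m(f, f)\<close>.\<close>
definition energy_form ::
  "'a::euclidean_space measure \<Rightarrow> 'a measure \<Rightarrow> 'a set \<Rightarrow> real \<Rightarrow>
     ('a \<Rightarrow> complex) \<Rightarrow> ('a \<Rightarrow> complex) \<Rightarrow> complex" where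
  "energy_form mp mm B \<epsilon> f g =
     (if \<epsilon> = 0 then 0
      else complex_of_real (\<epsilon>\<^sup>2) * L2_inner lborel (weak_laplacian f) (weak_laplacian g)) +
     (\<Sum>b\<in>Basis. L2_inner lborel (weak_partial b f) (weak_partial b g)) +
     (let \<mu> = abs_measure mp mm
      in L2_inner \<mu> (sign_op B (trace_map \<mu> f)) (trace_map \<mu> g))"

text \<open>
  Unbounded operators in \<open>L\<^sup>2(dx)\<close> are given by their graphs. The operator associated with a form
  \<open>E\<close> on a domain \<open>D\<close> sends \<open>f\<close> to the \<open>g \<in> L\<^sup>2(dx)\<close> with \<open>E(f, h) = (g, h)\<close> for all \<open>h \<in> D\<close>.
\<close>
definition form_operator ::
  "('a::euclidean_space \<Rightarrow> complex) set \<Rightarrow>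
     (('a \<Rightarrow> complex) \<Rightarrow> ('a \<Rightarrow> complex) \<Rightarrow> complex) \<Rightarrow>
     (('a \<Rightarrow> complex) \<times> ('a \<Rightarrow> complex)) set" where
  "form_operator D E =
     {(f, g). f \<in> D \<and> g \<in> L2_space lborel \<and> (\<forall>h\<in>D. E f h = L2_inner lborel g h)}"

text \<open>\<open>- \<Delta> + \<epsilon>\<^sup>2 \<Delta>\<^sup>2 + m\<close> for \<open>\<epsilon> > 0\<close>, and \<open>- \<Delta> + m\<close> for \<open>\<epsilon> = 0\<close>.\<close>
definition schroedinger_op ::
  "'a::euclidean_space measure \<Rightarrow> 'a measure \<Rightarrow> 'a set \<Rightarrow> real \<Rightarrow>
     (('a \<Rightarrow> complex) \<times> ('a \<Rightarrow> complex)) set" where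
  "schroedinger_op mp mm B \<epsilon> = form_operator (form_domain \<epsilon>) (energy_form mp mm B \<epsilon>)"


section \<open>Norm resolvent convergence\<close>

text \<open>\<open>R\<close> is an everywhere defined bounded two-sided inverse of \<open>T - z\<close>.\<close>
definition is_resolvent ::
  "(('a::euclidean_space \<Rightarrow> complex) \<times> ('a \<Rightarrow> complex)) set \<Rightarrow> complex \<Rightarrow>
     (('a \<Rightarrow> complex) \<Rightarrow> ('a \<Rightarrow> complex)) \<Rightarrow> bool" where
  "is_resolvent T z R \<longleftrightarrow>
     (\<forall>g\<in>L2_space lborel. R g \<in> L2_space lborel \<and> (R g, \<lambda>x. g x + z * R g x) \<in> T) \<and>
     (\<forall>(f, g)\<in>T. AE x in lborel. R (\<lambda>y. g y - z * f y) x = f x) \<and>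
     (\<exists>C. \<forall>g\<in>L2_space lborel. L2_norm lborel (R g) \<le> C * L2_norm lborel g)"

definition resolvent_set ::
  "(('a::euclidean_space \<Rightarrow> complex) \<times> ('a \<Rightarrow> complex)) set \<Rightarrow> complex set" where
  "resolvent_set T = {z. \<exists>R. is_resolvent T z R}"

definition resolvent ::
  "(('a::euclidean_space \<Rightarrow> complex) \<times> ('a \<Rightarrow> complex)) set \<Rightarrow> complex \<Rightarrow>
     ('a \<Rightarrow> complex) \<Rightarrow> 'a \<Rightarrow> complex" where
  "resolvent T z = (SOME R. is_resolvent T z R)"

text \<open>The operator norm on \<open>L\<^sup>2(dx)\<close>; only meaningful for bounded operators.\<close>
definition L2_opnorm ::
  "(('a::euclidean_space \<Rightarrow> complex) \<Rightarrow> ('a \<Rightarrow> complex)) \<Rightarrow> real" where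
  "L2_opnorm R = (SUP g\<in>{g \<in> L2_space lborel. L2_norm lborel g \<le> 1}. L2_norm lborel (R g))"

text \<open>
  The usual notion for self-adjoint operators: convergence in operator norm of the resolvents at
  every non-real \<open>z\<close>. That such \<open>z\<close> belong to the resolvent sets, which is automatic for
  self-adjoint operators, is demanded explicitly, so that \<open>resolvent\<close> is never applied outside
  its range of validity.
\<close>
definition norm_resolvent_convergence ::
  "('i \<Rightarrow> (('a::euclidean_space \<Rightarrow> complex) \<times> ('a \<Rightarrow> complex)) set) \<Rightarrow>
     (('a \<Rightarrow> complex) \<times> ('a \<Rightarrow> complex)) set \<Rightarrow> 'i filter \<Rightarrow> bool" where
  "norm_resolvent_convergence A T F \<longleftrightarrow>
     (\<forall>z. Im z \<noteq> 0 \<longrightarrow>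
        z \<in> resolvent_set T \<and>
        (\<forall>\<^sub>F i in F. z \<in> resolvent_set (A i)) \<and>
        ((\<lambda>i. L2_opnorm (\<lambda>g x. resolvent (A i) z g x - resolvent T z g x)) \<longlongrightarrow> 0) F)"

end

theory Submission
  imports Defs
begin

text \<open>
  Lax-Milgram on the form domains gives the resolvents, uniformly in \<open>\<epsilon>\<close>: for non-real \<open>z\<close> the values
  \<open>\<E>\<^sub>\<epsilon> f f - z (f, f)\<close> lie in a sector away from \<open>0\<close>. Let \<open>u = R\<^sub>\<epsilon> g\<close> and \<open>v = R\<^sub>0 g\<close>. By a
  Galerkin-type argument \<open>u - v\<close> is controlled by \<open>\<parallel>v - w\<parallel>\<^sub>1 + \<epsilon> \<parallel>\<Delta> w\<parallel>\<close> for every \<open>w \<in> H\<^sup>2\<close>. For the \<open>w\<close>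
  minimising \<open>\<parallel>v - w\<parallel>\<^sub>1\<^sup>2 + \<epsilon>\<^sup>2 \<parallel>\<Delta> w\<parallel>\<^sup>2\<close> that sum of squares equals \<open>Re (v, r)\<^sub>1\<close> with \<open>r = v - w\<close>, which the
  equation for \<open>v\<close> turns into \<open>L\<^sup>2\<close> pairings with \<open>r\<close> and the term \<open>(A J v, J r)\<close>. Here
  \<open>\<parallel>r\<parallel> = O(\<epsilon>)\<close>, while \<open>\<parallel>J r\<parallel>\<^sup>2 \<le> \<eta> (\<parallel>r\<parallel>\<^sub>1\<^sup>2 + \<beta> \<parallel>r\<parallel>\<^sup>2)\<close> with \<open>\<parallel>r\<parallel>\<^sub>1\<close> bounded and \<open>\<eta>\<close> as small as desired.

  Density of test functions in \<open>H\<^sup>1\<close> and \<open>H\<^sup>2\<close> regularity are obtained without mollifiers or Fourier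
  transforms, from the fact that \<open>1 - \<Delta>\<close> maps the test functions onto a dense subspace of \<open>L\<^sup>2\<close>: if
  \<open>f\<close> is orthogonal to that range, its convolution with a test function is a bounded solution of
  \<open>\<Delta> y = y\<close> and vanishes by a maximum principle.
\<close>

section \<open>Semi-inner product spaces of functions\<close>

text \<open>The two forms live on different domains, and since |m| may charge Lebesgue null sets,
  \<open>v\<close> need not lie in H^2. So \<epsilon>^2 \<Delta>^2 cannot be treated as a
  perturbation of the limit equation, and an H^2 substitute \<open>w\<close> has to be compared with
  both solutions. For a single \<open>g\<close>, density of H^2 in H^1 would be enough: fix
  \<open>w\<close> close to \<open>v\<close> and let \<epsilon> tend to 0. Norm convergence needs
  one rate for all \<open>g\<close> in the unit ball, and the corresponding \<open>v\<close> form a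
  set that is bounded in H^1 but for which no compactness is available. Hence \<open>w\<close> is
  produced from \<open>v\<close> by an \<epsilon>-dependent rule, and the error is read off from the
  limit equation itself. That rule gives decay of \<open>r\<close> uniformly in L^2 only, while its
  H^1 norm is a priori merely bounded; the relative form bound zero of |m| is what makes the trace
  of such an \<open>r\<close> small. Since functions are representatives, and derivatives and traces
  are chosen by \<open>SOME\<close>, the Hilbert space arguments run in semi-inner product spaces
  and linearity of these operators is an almost everywhere statement.\<close>

lemma quadratic_discriminant_bound:
  fixes a b c :: real
  assumes "\<And>s. 0 \<le> a - 2 * s * b + s\<^sup>2 * (b * c)" "0 \<le> a" "0 \<le> b" "0 \<le> c"
  shows "b \<le> a * c"
\<comment> \<open>In the applications \<open>b\<close> is |A|^2 for a complex number A, and the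
  quadratic in \<open>s\<close> comes from subtracting s A times a vector of squared norm
  \<open>c\<close>, so \<open>b\<close> sits in both coefficients. For \<open>c > 0\<close> the
  optimal \<open>s\<close> is 1/c; \<open>c = 0\<close> occurs for nonzero vectors because norms are
  only seminorms, and then a large \<open>s\<close> forces \<open>b = 0\<close>.\<close>
proof (cases "c = 0")
  case True
  show ?thesis
  proof (rule ccontr)
    assume "\<not> b \<le> a * c"
    with True have "b > 0" by simp
    with assms(1)[of "(a + 1) / (2 * b)"] True show False by simp
  qed
next
  case False
  with assms have c: "c > 0" by simp
  have "0 \<le> a - 2 * (1 / c) * b + (1 / c)\<^sup>2 * (b * c)" by (rule assms(1))
  also have "\<dots> = a - b / c" using c by (simp add: field_simps power2_eq_square)
  finally show ?thesis using c by (simp add: field_simps)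
qed

lemma Re_cnj_scaled_mult: "Re (cnj (of_real s * z) * z) = s * (cmod z)\<^sup>2"
  by (simp only: cmod_power2) (simp add: algebra_simps power2_eq_square)

text \<open>Vectors are representatives, so a nonzero function may have norm 0 and the product is
  only semidefinite. A carrier set replaces a type because L^2, H^1 and the form domains are subsets
  of function types with the same pointwise operations.\<close>

locale semi_ip =
  fixes V :: "('x \<Rightarrow> complex) set" and ip :: "('x \<Rightarrow> complex) \<Rightarrow> ('x \<Rightarrow> complex) \<Rightarrow> complex"
  assumes zero_mem: "(\<lambda>x. 0) \<in> V"
    and add_mem: "f \<in> V \<Longrightarrow> g \<in> V \<Longrightarrow> (\<lambda>x. f x + g x) \<in> V"
    and scale_mem: "f \<in> V \<Longrightarrow> (\<lambda>x. c * f x) \<in> V"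
    and ip_add: "f \<in> V \<Longrightarrow> g \<in> V \<Longrightarrow> h \<in> V \<Longrightarrow> ip (\<lambda>x. f x + g x) h = ip f h + ip g h"
    and ip_scale: "f \<in> V \<Longrightarrow> h \<in> V \<Longrightarrow> ip (\<lambda>x. c * f x) h = c * ip f h"
    and ip_cnj: "f \<in> V \<Longrightarrow> g \<in> V \<Longrightarrow> ip g f = cnj (ip f g)"
    and ip_nonneg: "f \<in> V \<Longrightarrow> 0 \<le> Re (ip f f)"
begin

definition N :: "('x \<Rightarrow> complex) \<Rightarrow> real" where
  "N f = sqrt (Re (ip f f))"

lemma diff_mem: "f \<in> V \<Longrightarrow> g \<in> V \<Longrightarrow> (\<lambda>x. f x - g x) \<in> V"
  using add_mem[OF _ scale_mem[of g "-1"], of f] by simp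

lemma ip_diff:
  assumes "f \<in> V" "g \<in> V" "h \<in> V"
  shows "ip (\<lambda>x. f x - g x) h = ip f h - ip g h"
  using ip_add[OF assms(1) scale_mem[OF assms(2), of "-1"] assms(3)]
    ip_scale[OF assms(2,3), of "-1"] by simp

lemma ip_add_right: "f \<in> V \<Longrightarrow> g \<in> V \<Longrightarrow> h \<in> V \<Longrightarrow> ip h (\<lambda>x. f x + g x) = ip h f + ip h g"
  by (subst (1 2 3) ip_cnj) (auto simp: add_mem ip_add)

lemma ip_diff_right: "f \<in> V \<Longrightarrow> g \<in> V \<Longrightarrow> h \<in> V \<Longrightarrow> ip h (\<lambda>x. f x - g x) = ip h f - ip h g"
  by (subst (1 2 3) ip_cnj) (auto simp: diff_mem ip_diff)

lemma ip_scale_right: "f \<in> V \<Longrightarrow> h \<in> V \<Longrightarrow> ip h (\<lambda>x. c * f x) = cnj c * ip h f"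
  by (subst (1 2) ip_cnj) (auto simp: scale_mem ip_scale)

lemmas ip_simps = zero_mem add_mem diff_mem scale_mem ip_add ip_diff ip_scale
  ip_add_right ip_diff_right ip_scale_right

lemma N_nonneg: "f \<in> V \<Longrightarrow> 0 \<le> N f"
  by (simp add: N_def ip_nonneg)

lemma N_sq: "f \<in> V \<Longrightarrow> (N f)\<^sup>2 = Re (ip f f)"
  by (simp add: N_def ip_nonneg)

lemma ip_self: "f \<in> V \<Longrightarrow> ip f f = of_real ((N f)\<^sup>2)"
  using ip_cnj[of f f] by (simp add: N_sq complex_eq_iff)

lemma N_diff_sq:
  assumes "f \<in> V" "g \<in> V"
  shows "(N (\<lambda>x. f x - g x))\<^sup>2 = (N f)\<^sup>2 - 2 * Re (ip f g) + (N g)\<^sup>2"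
proof -
  have "Re (ip g f) = Re (ip f g)" using ip_cnj[OF assms] by simp
  then show ?thesis using assms by (simp add: N_sq ip_simps)
qed

lemma N_add_sq:
  assumes "f \<in> V" "g \<in> V"
  shows "(N (\<lambda>x. f x + g x))\<^sup>2 = (N f)\<^sup>2 + 2 * Re (ip f g) + (N g)\<^sup>2"
proof -
  have "Re (ip g f) = Re (ip f g)" using ip_cnj[OF assms] by simp
  then show ?thesis using assms by (simp add: N_sq ip_simps)
qed

lemma N_scale_sq: "f \<in> V \<Longrightarrow> (N (\<lambda>x. c * f x))\<^sup>2 = (cmod c)\<^sup>2 * (N f)\<^sup>2"
  by (simp add: N_sq ip_simps mult.assoc[symmetric] complex_norm_square[symmetric]
      del: of_real_power)

lemma N_scale: "f \<in> V \<Longrightarrow> N (\<lambda>x. c * f x) = cmod c * N f"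
  using N_scale_sq[of f c] by (metis N_nonneg norm_ge_zero mult_nonneg_nonneg
      power2_eq_imp_eq power_mult_distrib scale_mem)

lemma Cauchy_Schwarz:
  assumes f: "f \<in> V" and g: "g \<in> V"
  shows "cmod (ip f g) \<le> N f * N g"
proof -
  let ?A = "ip f g"
  have "(cmod ?A)\<^sup>2 \<le> (N f)\<^sup>2 * (N g)\<^sup>2"
  proof (rule quadratic_discriminant_bound)
    fix s :: real
    let ?t = "of_real s * ?A"
    have "0 \<le> (N (\<lambda>x. f x - ?t * g x))\<^sup>2" by simp
    also have "\<dots> = (N f)\<^sup>2 - 2 * Re (cnj ?t * ?A) + (cmod ?t)\<^sup>2 * (N g)\<^sup>2"
      using f g by (simp add: N_diff_sq scale_mem N_scale_sq ip_scale_right)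
    also have "Re (cnj ?t * ?A) = s * (cmod ?A)\<^sup>2"
      by (rule Re_cnj_scaled_mult)
    also have "(cmod ?t)\<^sup>2 = s\<^sup>2 * (cmod ?A)\<^sup>2"
      by (simp add: norm_mult power_mult_distrib)
    finally show "0 \<le> (N f)\<^sup>2 - 2 * s * (cmod ?A)\<^sup>2 + s\<^sup>2 * ((cmod ?A)\<^sup>2 * (N g)\<^sup>2)"
      by (simp add: algebra_simps)
  qed auto
  then have "(cmod ?A)\<^sup>2 \<le> (N f * N g)\<^sup>2" by (simp add: power_mult_distrib)
  then show ?thesis using f g by (meson N_nonneg mult_nonneg_nonneg power2_le_imp_le)
qed

lemma N_triangle:
  assumes f: "f \<in> V" and g: "g \<in> V"
  shows "N (\<lambda>x. f x + g x) \<le> N f + N g"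
proof -
  have "Re (ip f g) \<le> N f * N g"
    using Cauchy_Schwarz[OF f g] complex_Re_le_cmod order_trans by blast
  then have "(N (\<lambda>x. f x + g x))\<^sup>2 \<le> (N f + N g)\<^sup>2"
    using f g by (simp add: N_add_sq power2_sum)
  then show ?thesis using f g by (meson N_nonneg add_nonneg_nonneg power2_le_imp_le)
qed

lemma N_minus_commute: "f \<in> V \<Longrightarrow> g \<in> V \<Longrightarrow> N (\<lambda>x. f x - g x) = N (\<lambda>x. g x - f x)"
  using N_scale[of "\<lambda>x. f x - g x" "-1"] by (simp add: diff_mem)

lemma N_triangle_diff:
  assumes "f \<in> V" "g \<in> V" "h \<in> V"
  shows "N (\<lambda>x. f x - h x) \<le> N (\<lambda>x. f x - g x) + N (\<lambda>x. g x - h x)"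
  using N_triangle[of "\<lambda>x. f x - g x" "\<lambda>x. g x - h x"] assms by (simp add: diff_mem)

lemma N_abs_diff:
  assumes "f \<in> V" "g \<in> V"
  shows "\<bar>N f - N g\<bar> \<le> N (\<lambda>x. f x - g x)"
  using N_triangle[of "\<lambda>x. f x - g x" g] N_triangle[of "\<lambda>x. g x - f x" f] assms
    N_minus_commute[OF assms] by (simp add: diff_mem)

lemma ip_tendsto:
  assumes "\<And>n. s n \<in> V" "p \<in> V" "h \<in> V" "(\<lambda>n. N (\<lambda>x. s n x - p x)) \<longlonglongrightarrow> 0"
  shows "(\<lambda>n. ip (s n) h) \<longlonglongrightarrow> ip p h"
proof -
  have "(\<lambda>n. ip (s n) h - ip p h) \<longlonglongrightarrow> 0"
  proof (rule Lim_null_comparison)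
    show "(\<lambda>n. N (\<lambda>x. s n x - p x) * N h) \<longlonglongrightarrow> 0"
      using tendsto_mult[OF assms(4) tendsto_const[of "N h"]] by simp
    show "\<forall>\<^sub>F n in sequentially. cmod (ip (s n) h - ip p h) \<le> N (\<lambda>x. s n x - p x) * N h"
      using Cauchy_Schwarz[of "\<lambda>x. s _ x - p x" h] assms(1-3) by (simp add: ip_simps)
  qed
  then show ?thesis by (simp add: LIM_zero_iff)
qed

lemma N_tendsto:
  assumes "\<And>n. s n \<in> V" "p \<in> V" "(\<lambda>n. N (\<lambda>x. s n x - p x)) \<longlonglongrightarrow> 0"
  shows "(\<lambda>n. N (s n)) \<longlonglongrightarrow> N p"
proof -
  have "(\<lambda>n. N (s n) - N p) \<longlonglongrightarrow> 0"
    by (rule Lim_null_comparison[OF _ assms(3)]) (use assms N_abs_diff in auto)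
  then show ?thesis by (simp add: LIM_zero_iff)
qed

lemma N_tendsto_add:
  assumes "\<And>n. s n \<in> V" "p \<in> V" "\<And>n. t n \<in> V" "q \<in> V"
    and "(\<lambda>n. N (\<lambda>x. s n x - p x)) \<longlonglongrightarrow> 0" "(\<lambda>n. N (\<lambda>x. t n x - q x)) \<longlonglongrightarrow> 0"
  shows "(\<lambda>n. N (\<lambda>x. (s n x + t n x) - (p x + q x))) \<longlonglongrightarrow> 0"
proof (rule Lim_null_comparison)
  show "(\<lambda>n. N (\<lambda>x. s n x - p x) + N (\<lambda>x. t n x - q x)) \<longlonglongrightarrow> 0"
    using tendsto_add[OF assms(5,6)] by simp
  have "norm (N (\<lambda>x. (s n x + t n x) - (p x + q x))) \<le> N (\<lambda>x. s n x - p x) + N (\<lambda>x. t n x - q x)" for n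
  proof -
    have eq: "(\<lambda>x. (s n x + t n x) - (p x + q x)) = (\<lambda>x. (s n x - p x) + (t n x - q x))" by auto
    show ?thesis
      unfolding eq
      using N_triangle[OF diff_mem[OF assms(1,2), of n] diff_mem[OF assms(3,4), of n]]
        N_nonneg[OF add_mem[OF diff_mem[OF assms(1,2), of n] diff_mem[OF assms(3,4), of n]]]
      by simp
  qed
  then show "\<forall>\<^sub>F n in sequentially. norm (N (\<lambda>x. (s n x + t n x) - (p x + q x))) \<le> N (\<lambda>x. s n x - p x) + N (\<lambda>x. t n x - q x)"
    by simp
qed

lemma N_tendsto_scale:
  assumes "\<And>n. s n \<in> V" "p \<in> V" "(\<lambda>n. N (\<lambda>x. s n x - p x)) \<longlonglongrightarrow> 0"
  shows "(\<lambda>n. N (\<lambda>x. c * s n x - c * p x)) \<longlonglongrightarrow> 0"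
proof -
  have "N (\<lambda>x. c * s n x - c * p x) = cmod c * N (\<lambda>x. s n x - p x)" for n
    using N_scale[OF diff_mem[OF assms(1,2), of n], of c] by (simp add: right_diff_distrib)
  then show ?thesis using tendsto_mult[OF tendsto_const[of "cmod c"] assms(3)] by simp
qed

lemma N_zero: "N (\<lambda>x. 0) = 0"
  using N_scale[OF zero_mem, of 0] by simp

definition cauchy :: "(nat \<Rightarrow> 'x \<Rightarrow> complex) \<Rightarrow> bool" where
  "cauchy s \<longleftrightarrow> (\<forall>e>0. \<exists>n0. \<forall>m\<ge>n0. \<forall>n\<ge>n0. N (\<lambda>x. s m x - s n x) < e)"

lemma cauchy_convergent:
  assumes "\<And>n. s n \<in> V" "p \<in> V" "(\<lambda>n. N (\<lambda>x. s n x - p x)) \<longlonglongrightarrow> 0"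
  shows "cauchy s"
  unfolding cauchy_def
proof (intro allI impI)
  fix e :: real assume "0 < e"
  with assms(3) have "\<forall>\<^sub>F n in sequentially. N (\<lambda>x. s n x - p x) < e / 2"
    by (intro order_tendstoD) auto
  then obtain n0 where n0: "\<And>n. n \<ge> n0 \<Longrightarrow> N (\<lambda>x. s n x - p x) < e / 2"
    by (auto simp: eventually_sequentially)
  have "N (\<lambda>x. s m x - s n x) < e" if "m \<ge> n0" "n \<ge> n0" for m n
    using N_triangle_diff[OF assms(1)[of m] assms(2) assms(1)[of n]] n0[OF that(1)] n0[OF that(2)]
      N_minus_commute[OF assms(1)[of n] assms(2)] by simp
  then show "\<exists>n0. \<forall>m\<ge>n0. \<forall>n\<ge>n0. N (\<lambda>x. s m x - s n x) < e" by blast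
qed

end

text \<open>Carries the Cauchy property from a strong norm to the derivatives, Laplacians or traces
  of a sequence in a weaker one. Division by \<open>C + 1\<close> instead of \<open>C\<close> admits
  \<open>C = 0\<close>.\<close>

lemma (in semi_ip) cauchy_mono:
  assumes "semi_ip W jp" "cauchy s" "0 \<le> C"
    and "\<And>m n. semi_ip.N jp (\<lambda>x. t m x - t n x) \<le> C * N (\<lambda>x. s m x - s n x)"
  shows "semi_ip.cauchy jp t"
proof -
  interpret W: semi_ip W jp by fact
  show ?thesis unfolding W.cauchy_def
  proof (intro allI impI)
    fix e :: real assume e: "0 < e"
    then have "0 < e / (C + 1)" using assms(3) by simp
    then obtain n0 where n0: "\<And>m n. m \<ge> n0 \<Longrightarrow> n \<ge> n0 \<Longrightarrow> N (\<lambda>x. s m x - s n x) < e / (C + 1)"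
      using assms(2) unfolding cauchy_def by blast
    have "W.N (\<lambda>x. t m x - t n x) < e" if "m \<ge> n0" "n \<ge> n0" for m n
    proof -
      have "C * N (\<lambda>x. s m x - s n x) \<le> C * (e / (C + 1))"
        using n0[OF that] assms(3) by (intro mult_left_mono) auto
      also have "\<dots> < e" using e assms(3) by (simp add: field_simps)
      finally show ?thesis using assms(4)[of m n] by linarith
    qed
    then show "\<exists>n0. \<forall>m\<ge>n0. \<forall>n\<ge>n0. W.N (\<lambda>x. t m x - t n x) < e" by blast
  qed
qed

locale semi_hilbert = semi_ip +
  assumes complete: "(\<And>n. s n \<in> V) \<Longrightarrow> cauchy s \<Longrightarrow> \<exists>p\<in>V. (\<lambda>n. N (\<lambda>x. s n x - p x)) \<longlonglongrightarrow> 0"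
begin

text \<open>
  Minimising \<open>\<parallel>s\<parallel>\<^sup>2 - 2 Re (l s)\<close> over \<open>S\<close>: the parallelogram law makes a minimising sequence Cauchy.
  For \<open>S = V\<close> this is the Riesz representation theorem, for \<open>l s = (u, s)\<close> it is orthogonal
  projection onto the closure of \<open>S\<close>.
\<close>
lemma riesz_on_subspace:
  assumes S: "S \<subseteq> V" "(\<lambda>x. 0) \<in> S" "\<And>f g. f \<in> S \<Longrightarrow> g \<in> S \<Longrightarrow> (\<lambda>x. f x + g x) \<in> S"
      "\<And>f c. f \<in> S \<Longrightarrow> (\<lambda>x. c * f x) \<in> S"
    and l_add: "\<And>f g. f \<in> S \<Longrightarrow> g \<in> S \<Longrightarrow> l (\<lambda>x. f x + g x) = l f + l g"
    and l_scale: "\<And>f c. f \<in> S \<Longrightarrow> l (\<lambda>x. c * f x) = cnj c * l f"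
    and l_bound: "\<And>f. f \<in> S \<Longrightarrow> cmod (l f) \<le> C * N f"
  shows "\<exists>s p. (\<forall>n. s n \<in> S) \<and> p \<in> V \<and> (\<lambda>n. N (\<lambda>x. s n x - p x)) \<longlonglongrightarrow> 0 \<and>
           (\<forall>h\<in>S. ip p h = l h)"
proof -
  define Q where "Q f = (N f)\<^sup>2 - 2 * Re (l f)" for f
  define m where "m = Inf (Q ` S)"
  have Q_bound: "- C\<^sup>2 \<le> Q f" if "f \<in> S" for f
  proof -
    have "Re (l f) \<le> C * N f" using l_bound[OF that] complex_Re_le_cmod order_trans by blast
    moreover have "0 \<le> (N f - C)\<^sup>2" by simp
    ultimately show ?thesis unfolding Q_def by (simp add: power2_diff algebra_simps)
  qed
  have bdd: "bdd_below (Q ` S)" using Q_bound by (auto intro!: bdd_belowI)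
  have m_le: "m \<le> Q f" if "f \<in> S" for f
    unfolding m_def using bdd that by (auto intro: cInf_lower)
  have "\<exists>f\<in>S. Q f < m + 1 / real (Suc n)" for n
  proof -
    have "Inf (Q ` S) < m + 1 / real (Suc n)" by (simp add: m_def)
    then show ?thesis using bdd S(2) by (subst (asm) cInf_less_iff) auto
  qed
  then obtain s where s: "\<And>n. s n \<in> S" "\<And>n. Q (s n) < m + 1 / real (Suc n)" by metis
  have sV: "\<And>n. s n \<in> V" using s(1) S(1) by auto
  have par: "(N (\<lambda>x. f x - g x))\<^sup>2 \<le> 2 * Q f + 2 * Q g - 4 * m" if "f \<in> S" "g \<in> S" for f g
  proof -
    have V: "f \<in> V" "g \<in> V" using that S(1) by auto
    let ?h = "\<lambda>x. (1/2) * (f x + g x)"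
    have h: "?h \<in> S" using that S(3,4) by blast
    have eq1: "(N ?h)\<^sup>2 = ((N f)\<^sup>2 + 2 * Re (ip f g) + (N g)\<^sup>2) / 4"
      using N_scale_sq[OF add_mem[OF V], of "1/2"] N_add_sq[OF V] by (simp add: power_divide)
    have eq2: "Re (l ?h) = (Re (l f) + Re (l g)) / 2"
    proof -
      have "l ?h = cnj (1/2) * (l f + l g)"
        unfolding l_scale[OF S(3)[OF that]] l_add[OF that] ..
      then have "Re (l ?h) = Re (cnj (1/2) * (l f + l g))" by (rule arg_cong)
      then show ?thesis by simp
    qed
    have "m \<le> ((N f)\<^sup>2 + 2 * Re (ip f g) + (N g)\<^sup>2) / 4 - 2 * ((Re (l f) + Re (l g)) / 2)"
      using m_le[OF h] unfolding Q_def eq1 eq2 .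
    moreover have "a - 2 * c + b \<le> 2 * (a - 2 * x) + 2 * (b - 2 * y) - 4 * k"
      if "k \<le> (a + 2 * c + b) / 4 - 2 * ((x + y) / 2)" for a b c k x y :: real
      using that by (simp add: field_simps)
    ultimately show ?thesis unfolding Q_def N_diff_sq[OF V] by blast
  qed
  have "cauchy s" unfolding cauchy_def
  proof (intro allI impI)
    fix e :: real assume e: "0 < e"
    then obtain n0 where n0: "1 / real (Suc n0) < e\<^sup>2 / 4"
      by (meson divide_pos_pos nat_approx_posE zero_less_numeral zero_less_power)
    have "N (\<lambda>x. s i x - s j x) < e" if "i \<ge> n0" "j \<ge> n0" for i j
    proof -
      have "1 / real (Suc i) \<le> 1 / real (Suc n0)" "1 / real (Suc j) \<le> 1 / real (Suc n0)"
        using that by (auto simp: frac_le)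
      then have "(N (\<lambda>x. s i x - s j x))\<^sup>2 < e\<^sup>2"
        using par[OF s(1) s(1), of i j] s(2)[of i] s(2)[of j] n0 by linarith
      then show ?thesis using e by (meson less_eq_real_def power2_less_imp_less)
    qed
    then show "\<exists>n0. \<forall>m\<ge>n0. \<forall>n\<ge>n0. N (\<lambda>x. s m x - s n x) < e" by blast
  qed
  then obtain p where p: "p \<in> V" "(\<lambda>n. N (\<lambda>x. s n x - p x)) \<longlonglongrightarrow> 0"
    using complete[of s] sV by blast
  have "ip p h = l h" if h: "h \<in> S" for h
  proof -
    have hV: "h \<in> V" using h S(1) by auto
    let ?A = "ip p h - l h"
    have lim: "(\<lambda>n. ip (s n) h - l h) \<longlonglongrightarrow> ?A"
      by (intro tendsto_diff tendsto_const ip_tendsto sV p hV)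
    \<comment> \<open>First variation: the infimum need not be attained in \<open>S\<close>, so the
      competitor \<open>s n + t h\<close> is compared with \<open>m\<close>, at the cost of a term
      1/(n+1) that vanishes in the limit.\<close>
    have key: "0 \<le> 2 * Re (cnj t * ?A) + (cmod t)\<^sup>2 * (N h)\<^sup>2" for t
    proof (rule LIMSEQ_le_const)
      show "(\<lambda>n. 1 / real (Suc n) + (2 * Re (cnj t * (ip (s n) h - l h)) + (cmod t)\<^sup>2 * (N h)\<^sup>2))
          \<longlonglongrightarrow> 2 * Re (cnj t * ?A) + (cmod t)\<^sup>2 * (N h)\<^sup>2"
        using tendsto_add[OF LIMSEQ_Suc[OF lim_1_over_n[where 'a=real]]
            tendsto_add[OF tendsto_mult[OF tendsto_const[of 2] tendsto_Re[OF tendsto_mult[OF tendsto_const[of "cnj t"] lim]]]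
              tendsto_const[of "(cmod t)\<^sup>2 * (N h)\<^sup>2"]]] by simp
      have "0 \<le> 1 / real (Suc n) + (2 * Re (cnj t * (ip (s n) h - l h)) + (cmod t)\<^sup>2 * (N h)\<^sup>2)" for n
      proof -
        have "m \<le> Q (\<lambda>x. s n x + t * h x)" by (rule m_le[OF S(3)[OF s(1) S(4)[OF h]]])
        also have "\<dots> = Q (s n) + 2 * Re (cnj t * (ip (s n) h - l h)) + (cmod t)\<^sup>2 * (N h)\<^sup>2"
          unfolding Q_def using hV sV s(1) h S(4)
          by (simp add: N_add_sq scale_mem N_scale_sq ip_scale_right l_add l_scale right_diff_distrib)
        finally show ?thesis using s(2)[of n] by linarith
      qed
      then show "\<exists>n0. \<forall>n\<ge>n0. 0 \<le> 1 / real (Suc n) + (2 * Re (cnj t * (ip (s n) h - l h)) + (cmod t)\<^sup>2 * (N h)\<^sup>2)"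
        by blast
    qed
    \<comment> \<open>The discriminant lemma with \<open>a = 0\<close>: moving along - r ?A times
      \<open>h\<close> for every real \<open>r\<close> leaves no room for a first-order
      term.\<close>
    have "(cmod ?A)\<^sup>2 \<le> 0 * (N h)\<^sup>2"
    proof (rule quadratic_discriminant_bound)
      fix r :: real
      have "0 \<le> 2 * Re (cnj (- of_real r * ?A) * ?A) + (cmod (- of_real r * ?A))\<^sup>2 * (N h)\<^sup>2"
        by (rule key)
      also have "Re (cnj (- of_real r * ?A) * ?A) = - r * (cmod ?A)\<^sup>2"
        using Re_cnj_scaled_mult[of "- r" ?A] by simp
      also have "(cmod (- of_real r * ?A))\<^sup>2 = r\<^sup>2 * (cmod ?A)\<^sup>2"
        by (simp add: norm_mult power_mult_distrib)
      finally show "0 \<le> 0 - 2 * r * (cmod ?A)\<^sup>2 + r\<^sup>2 * ((cmod ?A)\<^sup>2 * (N h)\<^sup>2)"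
        by (simp add: algebra_simps)
    qed auto
    then show ?thesis by simp
  qed
  with s(1) p show ?thesis by blast
qed

lemma riesz:
  assumes "\<And>f g. f \<in> V \<Longrightarrow> g \<in> V \<Longrightarrow> l (\<lambda>x. f x + g x) = l f + l g"
    and "\<And>f c. f \<in> V \<Longrightarrow> l (\<lambda>x. c * f x) = cnj c * l f"
    and "\<And>f. f \<in> V \<Longrightarrow> cmod (l f) \<le> C * N f"
  shows "\<exists>p\<in>V. \<forall>h\<in>V. ip p h = l h"
  using riesz_on_subspace[of V l C] assms zero_mem add_mem scale_mem by blast

text \<open>Apply the minimisation to the functional \<open>ip u\<close>: the limit \<open>p\<close>
  is the projection of \<open>u\<close> onto the closure of \<open>S\<close>, so
  \<open>p - u\<close> is orthogonal to \<open>S\<close> and \<open>triv\<close> gives it norm 0. A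
  sequence converging to \<open>p\<close> then converges to \<open>u\<close>. In the applications
  \<open>triv\<close> is a uniqueness theorem.\<close>

lemma dense_if_orthogonal_trivial:
  assumes S: "S \<subseteq> V" "(\<lambda>x. 0) \<in> S" "\<And>f g. f \<in> S \<Longrightarrow> g \<in> S \<Longrightarrow> (\<lambda>x. f x + g x) \<in> S"
      "\<And>f c. f \<in> S \<Longrightarrow> (\<lambda>x. c * f x) \<in> S"
    and triv: "\<And>w. w \<in> V \<Longrightarrow> (\<And>s. s \<in> S \<Longrightarrow> ip w s = 0) \<Longrightarrow> N w = 0"
    and u: "u \<in> V"
  shows "\<exists>s. (\<forall>n. s n \<in> S) \<and> (\<lambda>n. N (\<lambda>x. s n x - u x)) \<longlonglongrightarrow> 0"
proof -
  have "\<exists>s p. (\<forall>n. s n \<in> S) \<and> p \<in> V \<and> (\<lambda>n. N (\<lambda>x. s n x - p x)) \<longlonglongrightarrow> 0 \<and>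
           (\<forall>h\<in>S. ip p h = ip u h)"
    by (rule riesz_on_subspace[OF S, where C = "N u"])
      (use S(1) u Cauchy_Schwarz in \<open>auto simp: ip_simps subset_iff\<close>)
  then obtain s p where sp: "\<And>n. s n \<in> S" "p \<in> V" "(\<lambda>n. N (\<lambda>x. s n x - p x)) \<longlonglongrightarrow> 0"
    "\<And>h. h \<in> S \<Longrightarrow> ip p h = ip u h" by blast
  have sV: "s n \<in> V" for n using sp(1) S(1) by auto
  have "N (\<lambda>x. p x - u x) = 0"
    by (rule triv) (use sp u S(1) in \<open>auto simp: ip_simps subset_iff\<close>)
  then have "N (\<lambda>x. s n x - u x) \<le> N (\<lambda>x. s n x - p x)" for n
    using N_triangle_diff[OF sV sp(2) u, of n] by simp
  then have "(\<lambda>n. N (\<lambda>x. s n x - u x)) \<longlonglongrightarrow> 0"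
    by (intro Lim_null_comparison[OF _ sp(3)]) (use sV u in \<open>auto simp: N_nonneg diff_mem\<close>)
  then show ?thesis using sp(1) by blast
qed

text \<open>Coercivity is asked of the modulus because, after subtraction of a non-real
  \<open>z\<close>, the real part of the form may have either sign. If \<open>w\<close> is
  orthogonal to all solvable right-hand sides, then \<open>a w w = 0\<close> and \<open>w\<close>
  has norm 0, so these are dense; the lower bound by \<alpha> makes the solutions of a convergent
  sequence of right-hand sides Cauchy.\<close>

lemma lax_milgram:
  assumes a_add: "\<And>f g h. f \<in> V \<Longrightarrow> g \<in> V \<Longrightarrow> h \<in> V \<Longrightarrow> a (\<lambda>x. f x + g x) h = a f h + a g h"
    and a_scale: "\<And>f h c. f \<in> V \<Longrightarrow> h \<in> V \<Longrightarrow> a (\<lambda>x. c * f x) h = c * a f h"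
    and a_add_right: "\<And>f g h. f \<in> V \<Longrightarrow> g \<in> V \<Longrightarrow> h \<in> V \<Longrightarrow> a h (\<lambda>x. f x + g x) = a h f + a h g"
    and a_scale_right: "\<And>f h c. f \<in> V \<Longrightarrow> h \<in> V \<Longrightarrow> a h (\<lambda>x. c * f x) = cnj c * a h f"
    and a_bound: "\<And>f h. f \<in> V \<Longrightarrow> h \<in> V \<Longrightarrow> cmod (a f h) \<le> M * N f * N h"
    and coercive: "\<And>f. f \<in> V \<Longrightarrow> \<alpha> * (N f)\<^sup>2 \<le> cmod (a f f)" "0 < \<alpha>"
    and l_add: "\<And>f g. f \<in> V \<Longrightarrow> g \<in> V \<Longrightarrow> l (\<lambda>x. f x + g x) = l f + l g"
    and l_scale: "\<And>f c. f \<in> V \<Longrightarrow> l (\<lambda>x. c * f x) = cnj c * l f"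
    and l_bound: "\<And>f. f \<in> V \<Longrightarrow> cmod (l f) \<le> C * N f"
  shows "\<exists>f\<in>V. \<forall>h\<in>V. a f h = l h"
proof -
  have "\<exists>p\<in>V. \<forall>h\<in>V. ip p h = a f h" if "f \<in> V" for f
    using riesz[where l="a f" and C = "M * N f"] a_add_right a_scale_right a_bound that by blast
  then obtain A where A: "\<And>f. f \<in> V \<Longrightarrow> A f \<in> V" "\<And>f h. f \<in> V \<Longrightarrow> h \<in> V \<Longrightarrow> ip (A f) h = a f h"
    by metis
  obtain t where t: "t \<in> V" "\<And>h. h \<in> V \<Longrightarrow> ip t h = l h"
    using riesz[of l C] l_add l_scale l_bound by blast
  \<comment> \<open>Not the image of \<open>A\<close> but all \<open>g\<close> that represent some
    \<open>a f\<close>: equality of vectors is replaced by equality of pairings, as suits a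
    seminorm.\<close>
  let ?S = "{g \<in> V. \<exists>f\<in>V. \<forall>h\<in>V. ip g h = a f h}"
  have "\<exists>s. (\<forall>n. s n \<in> ?S) \<and> (\<lambda>n. N (\<lambda>x. s n x - t x)) \<longlonglongrightarrow> 0"
  proof (rule dense_if_orthogonal_trivial[OF _ _ _ _ _ t(1)])
    show "(\<lambda>x. 0) \<in> ?S"
    proof (rule CollectI, rule conjI[OF zero_mem], rule bexI[OF _ zero_mem], rule ballI)
      fix h assume h: "h \<in> V"
      show "ip (\<lambda>x. 0) h = a (\<lambda>x. 0) h"
        using ip_scale[OF zero_mem h, of 0] a_scale[OF zero_mem h, of 0] by simp
    qed
    show "(\<lambda>x. f x + g x) \<in> ?S" if fg: "f \<in> ?S" "g \<in> ?S" for f g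
    proof -
      obtain f' g' where "f' \<in> V" "g' \<in> V" "\<And>h. h \<in> V \<Longrightarrow> ip f h = a f' h" "\<And>h. h \<in> V \<Longrightarrow> ip g h = a g' h"
        using fg by blast
      then show ?thesis using fg
        by (intro CollectI conjI bexI[of _ "\<lambda>x. f' x + g' x"]) (auto simp: ip_simps a_add)
    qed
    show "(\<lambda>x. c * f x) \<in> ?S" if f: "f \<in> ?S" for f c
    proof -
      obtain f' where "f' \<in> V" "\<And>h. h \<in> V \<Longrightarrow> ip f h = a f' h" using f by blast
      then show ?thesis using f
        by (intro CollectI conjI bexI[of _ "\<lambda>x. c * f' x"]) (auto simp: ip_simps a_scale)
    qed
    show "N w = 0" if w: "w \<in> V" "\<And>s. s \<in> ?S \<Longrightarrow> ip w s = 0" for w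
    proof -
      have "A w \<in> ?S" using w A by blast
      then have "ip w (A w) = 0" using w by blast
      then have "a w w = 0" using A w ip_cnj[of w "A w"] by simp
      then have "\<alpha> * (N w)\<^sup>2 \<le> 0" using coercive(1)[OF w(1)] by simp
      then show ?thesis using coercive(2) by (simp add: mult_le_0_iff)
    qed
  qed auto
  then obtain s where s: "\<And>n. s n \<in> ?S" "(\<lambda>n. N (\<lambda>x. s n x - t x)) \<longlonglongrightarrow> 0" by blast
  have "\<exists>f. \<forall>n. f n \<in> V \<and> (\<forall>h\<in>V. ip (s n) h = a (f n) h)"
    using s(1) by (intro choice) blast
  then obtain f where f: "\<And>n. f n \<in> V" "\<And>n h. h \<in> V \<Longrightarrow> ip (s n) h = a (f n) h" by blast
  have sV: "s n \<in> V" for n using s(1) by blast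
  have a_diff: "a (\<lambda>x. f x - g x) h = a f h - a g h" if "f \<in> V" "g \<in> V" "h \<in> V" for f g h
    using a_add[OF that(1) scale_mem[OF that(2), of "-1"] that(3)] a_scale[OF that(2,3), of "-1"] by simp
  have "cauchy f"
  proof (rule cauchy_mono[OF semi_ip_axioms])
    show "cauchy s" by (rule cauchy_convergent[OF sV t(1) s(2)])
    show "0 \<le> 1 / \<alpha>" using coercive(2) by simp
    fix m n
    let ?d = "\<lambda>x. f m x - f n x" and ?e = "\<lambda>x. s m x - s n x"
    have d: "?d \<in> V" using f by (auto simp: diff_mem)
    have "\<alpha> * (N ?d)\<^sup>2 \<le> cmod (a ?d ?d)" by (rule coercive(1)[OF d])
    also have "a ?d ?d = ip ?e ?d" using f d sV by (simp add: a_diff ip_diff)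
    also have "cmod \<dots> \<le> N ?e * N ?d" using sV d by (simp add: Cauchy_Schwarz diff_mem)
    finally have "\<alpha> * N ?d * N ?d \<le> N ?e * N ?d" by (simp add: power2_eq_square)
    then have "\<alpha> * N ?d \<le> N ?e"
      using N_nonneg[OF d] N_nonneg[OF diff_mem[OF sV sV], of m n]
      by (cases "N ?d = 0") auto
    then show "N ?d \<le> 1 / \<alpha> * N ?e" using coercive(2) by (simp add: field_simps)
  qed
  then obtain p where p: "p \<in> V" "(\<lambda>n. N (\<lambda>x. f n x - p x)) \<longlonglongrightarrow> 0"
    using complete[of f] f(1) by blast
  have "a p h = l h" if h: "h \<in> V" for h
  proof (rule LIMSEQ_unique)
    show "(\<lambda>n. a (f n) h) \<longlonglongrightarrow> l h"
      using ip_tendsto[OF sV t(1) h s(2)] f(2)[OF h] t(2)[OF h] by simp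
    have "(\<lambda>n. a (f n) h - a p h) \<longlonglongrightarrow> 0"
    proof (rule Lim_null_comparison)
      show "(\<lambda>n. M * N (\<lambda>x. f n x - p x) * N h) \<longlonglongrightarrow> 0"
        using tendsto_mult[OF tendsto_mult[OF tendsto_const[of M] p(2)] tendsto_const[of "N h"]] by simp
      show "\<forall>\<^sub>F n in sequentially. cmod (a (f n) h - a p h) \<le> M * N (\<lambda>x. f n x - p x) * N h"
        using a_bound[OF diff_mem[OF f(1) p(1)] h] a_diff[OF f(1) p(1) h] by simp
    qed
    then show "(\<lambda>n. a (f n) h) \<longlonglongrightarrow> a p h" by (simp add: LIM_zero_iff)
  qed
  with p(1) show ?thesis by blast
qed

end

section \<open>Completeness of \<open>L\<^sup>2\<close>\<close>

lemma L2_spaceD: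
  assumes "f \<in> L2_space M"
  shows "f \<in> borel_measurable M" "integrable M (\<lambda>x. (cmod (f x))\<^sup>2)"
  using assms by (auto simp: L2_space_def)

lemma L2_mult_integrable:
  assumes "f \<in> L2_space M" "g \<in> L2_space M"
  shows "integrable M (\<lambda>x. f x * g x)"
proof (rule Bochner_Integration.integrable_bound)
  note [measurable] = L2_spaceD(1)[OF assms(1)] L2_spaceD(1)[OF assms(2)]
  show "integrable M (\<lambda>x. (cmod (f x))\<^sup>2 + (cmod (g x))\<^sup>2)"
    using assms by (intro Bochner_Integration.integrable_add L2_spaceD)
  show "(\<lambda>x. f x * g x) \<in> borel_measurable M" by measurable
  have "a * b \<le> a\<^sup>2 + b\<^sup>2" if "0 \<le> a" "0 \<le> b" for a b :: real
  proof -
    have "0 \<le> (a - b)\<^sup>2" by simp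
    with mult_nonneg_nonneg[OF that] show ?thesis unfolding power2_diff by linarith
  qed
  then show "AE x in M. norm (f x * g x) \<le> norm ((cmod (f x))\<^sup>2 + (cmod (g x))\<^sup>2)"
    by (simp add: norm_mult)
qed

lemma L2_cnj: "f \<in> L2_space M \<Longrightarrow> (\<lambda>x. cnj (f x)) \<in> L2_space M"
  by (auto simp: L2_space_def intro: measurable_compose[OF _ borel_measurable_continuous_onI]
      continuous_intros)

lemma L2_inner_integrable:
  "f \<in> L2_space M \<Longrightarrow> g \<in> L2_space M \<Longrightarrow> integrable M (\<lambda>x. f x * cnj (g x))"
  by (intro L2_mult_integrable L2_cnj)

lemma L2_add:
  assumes "f \<in> L2_space M" "g \<in> L2_space M"
  shows "(\<lambda>x. f x + g x) \<in> L2_space M"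
  unfolding L2_space_def
proof (rule CollectI, rule conjI)
  note [measurable] = L2_spaceD(1)[OF assms(1)] L2_spaceD(1)[OF assms(2)]
  show "(\<lambda>x. f x + g x) \<in> borel_measurable M" by measurable
  show "integrable M (\<lambda>x. (cmod (f x + g x))\<^sup>2)"
  proof (rule Bochner_Integration.integrable_bound)
    show "integrable M (\<lambda>x. 2 * (cmod (f x))\<^sup>2 + 2 * (cmod (g x))\<^sup>2)"
      using assms by (intro Bochner_Integration.integrable_add integrable_mult_right L2_spaceD) auto
    have "(cmod (a + b))\<^sup>2 \<le> 2 * (cmod a)\<^sup>2 + 2 * (cmod b)\<^sup>2" for a b
    proof -
      have "(cmod (a + b))\<^sup>2 \<le> (cmod a + cmod b)\<^sup>2"
        by (intro power_mono norm_triangle_ineq) auto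
      also have "\<dots> \<le> 2 * (cmod a)\<^sup>2 + 2 * (cmod b)\<^sup>2"
        using zero_le_power2[of "cmod a - cmod b"] by (simp add: power2_diff power2_sum)
      finally show ?thesis .
    qed
    then show "AE x in M. norm ((cmod (f x + g x))\<^sup>2) \<le> norm (2 * (cmod (f x))\<^sup>2 + 2 * (cmod (g x))\<^sup>2)"
      by simp
  qed measurable
qed

lemma L2_scale: "f \<in> L2_space M \<Longrightarrow> (\<lambda>x. c * f x) \<in> L2_space M"
  by (auto simp: L2_space_def norm_mult power_mult_distrib)

lemma L2_inner_self: "Re (L2_inner M f f) = (\<integral>x. (cmod (f x))\<^sup>2 \<partial>M)"
  by (simp add: L2_inner_def complex_norm_square[symmetric] del: of_real_power)

lemma semi_ip_L2: "semi_ip (L2_space M) (L2_inner M)"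
proof
  fix f g h assume *: "f \<in> L2_space M" "g \<in> L2_space M" "h \<in> L2_space M"
  show "L2_inner M (\<lambda>x. f x + g x) h = L2_inner M f h + L2_inner M g h"
    unfolding L2_inner_def using *
    by (simp add: distrib_right Bochner_Integration.integral_add L2_inner_integrable)
next
  fix f g assume "f \<in> L2_space M" "g \<in> L2_space M"
  have "L2_inner M g f = (\<integral>x. cnj (f x * cnj (g x)) \<partial>M)"
    by (simp add: L2_inner_def mult.commute)
  also have "\<dots> = cnj (L2_inner M f g)"
    unfolding L2_inner_def by (rule Bochner_Integration.integral_cnj)
  finally show "L2_inner M g f = cnj (L2_inner M f g)" .
next
  fix f h c show "L2_inner M (\<lambda>x. c * f x) h = c * L2_inner M f h"
    by (simp add: L2_inner_def mult.assoc)
qed (auto simp: L2_add L2_scale L2_inner_self, auto simp: L2_space_def)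

lemma L2_norm_eq: "semi_ip.N (L2_inner M) = L2_norm M"
  by (rule ext) (simp add: semi_ip.N_def[OF semi_ip_L2] L2_norm_def L2_inner_self)

lemma L2_norm_sq: "(L2_norm M f)\<^sup>2 = (\<integral>x. (cmod (f x))\<^sup>2 \<partial>M)"
  by (simp add: L2_norm_def)

lemma L2_norm_sq_nn:
  assumes "f \<in> L2_space M"
  shows "ennreal ((L2_norm M f)\<^sup>2) = (\<integral>\<^sup>+x. ennreal ((cmod (f x))\<^sup>2) \<partial>M)"
  using L2_spaceD[OF assms] by (simp add: L2_norm_def nn_integral_eq_integral)

lemma L2_nn_bound:
  assumes "f \<in> borel_measurable M" "(\<integral>\<^sup>+x. ennreal ((cmod (f x))\<^sup>2) \<partial>M) \<le> ennreal (e\<^sup>2)" "0 \<le> e"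
  shows "f \<in> L2_space M" "L2_norm M f \<le> e"
proof -
  note [measurable] = assms(1)
  have "integrable M (\<lambda>x. (cmod (f x))\<^sup>2)"
    by (intro integrableI_bounded) (use assms(2) in \<open>auto simp: less_top[symmetric] top_unique\<close>)
  then show f: "f \<in> L2_space M" using assms by (auto simp: L2_space_def)
  have "0 \<le> (\<integral>x. (cmod (f x))\<^sup>2 \<partial>M)" by simp
  then show "L2_norm M f \<le> e"
    using L2_norm_sq_nn[OF f] assms(2,3)
    by (metis L2_norm_def ennreal_le_iff power2_le_imp_le zero_le_power2)
qed

text \<open>Riesz-Fischer. Along a fast subsequence the weighted squares 2^k |d_k|^2 have summable
  integrals, so their sum is finite almost everywhere, and 2 |d_k| \<le> 2^k |d_k|^2 + 2^(-k) turns
  this into absolute summability of the increments. Working with squares avoids a triangle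
  inequality for infinite sums.\<close>

lemma L2_complete:
  assumes s: "\<And>n. s n \<in> L2_space M" and c: "semi_ip.cauchy (L2_inner M) s"
  shows "\<exists>p\<in>L2_space M. (\<lambda>n. L2_norm M (\<lambda>x. s n x - p x)) \<longlonglongrightarrow> 0"
proof -
  interpret semi_ip "L2_space M" "L2_inner M" rewrites "semi_ip.N (L2_inner M) = L2_norm M"
    by (rule semi_ip_L2, rule L2_norm_eq)
  note [measurable] = L2_spaceD(1)[OF s]
  have "\<exists>n0. \<forall>m\<ge>n0. \<forall>n\<ge>n0. L2_norm M (\<lambda>x. s m x - s n x) < (1/2)^k" for k
    using c[unfolded cauchy_def] by (auto dest!: spec[of _ "(1/2)^k"])
  then obtain n0 where n0: "\<And>k m n. m \<ge> n0 k \<Longrightarrow> n \<ge> n0 k \<Longrightarrow> L2_norm M (\<lambda>x. s m x - s n x) < (1/2)^k"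
    by metis
  \<comment> \<open>Partial sums of the thresholds dominate each threshold and are monotone at the
    same time.\<close>
  define r where "r k = (\<Sum>i\<le>k. n0 i)" for k
  have r: "n0 k \<le> r k" "r k \<le> r (Suc k)" for k
    by (auto simp: r_def intro: member_le_sum)
  define d where "d k x = s (r (Suc k)) x - s (r k) x" for k x
  have [measurable]: "d k \<in> borel_measurable M" for k unfolding d_def by measurable
  have dL: "d k \<in> L2_space M" for k
    unfolding d_def[abs_def] using s by (intro diff_mem) auto
  have dn: "L2_norm M (d k) < (1/2)^k" for k
    unfolding d_def[abs_def] by (intro n0) (use r[of k] in auto)
  have "(\<integral>\<^sup>+x. (\<Sum>k. ennreal (2^k * (cmod (d k x))\<^sup>2)) \<partial>M) = (\<Sum>k. \<integral>\<^sup>+x. ennreal (2^k * (cmod (d k x))\<^sup>2) \<partial>M)"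
    by (rule nn_integral_suminf) measurable
  also have "\<dots> \<le> (\<Sum>k. ennreal ((1/2)^k))"
  proof (intro suminf_le allI)
    fix k
    have "(\<integral>\<^sup>+x. ennreal (2^k * (cmod (d k x))\<^sup>2) \<partial>M) = ennreal (2^k) * (\<integral>\<^sup>+x. ennreal ((cmod (d k x))\<^sup>2) \<partial>M)"
      by (subst nn_integral_cmult[symmetric]) (auto simp: ennreal_mult')
    also have "\<dots> = ennreal (2^k * (L2_norm M (d k))\<^sup>2)"
      by (simp add: L2_norm_sq_nn[OF dL, symmetric] ennreal_mult')
    also have "\<dots> \<le> ennreal (2^k * ((1/2)^k)\<^sup>2)"
      by (intro ennreal_leI mult_left_mono power_mono less_imp_le[OF dn] N_nonneg dL) auto
    also have "2^k * ((1/2)^k)\<^sup>2 = ((1/2)^k :: real)"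
      by (simp add: power2_eq_square power_one_over field_simps)
    finally show "(\<integral>\<^sup>+x. ennreal (2^k * (cmod (d k x))\<^sup>2) \<partial>M) \<le> ennreal ((1/2)^k)" .
  qed auto
  also have "\<dots> < \<infinity>"
    by (subst suminf_ennreal_eq[OF _ summable_sums]) (auto simp: summable_geometric)
  finally have "AE x in M. (\<Sum>k. ennreal (2^k * (cmod (d k x))\<^sup>2)) \<noteq> \<infinity>"
    by (intro nn_integral_noteq_infinite) (auto simp: less_top)
  then have conv: "AE x in M. convergent (\<lambda>k. s (r k) x)"
  proof eventually_elim
    case (elim x)
    then have "summable (\<lambda>k. 2^k * (cmod (d k x))\<^sup>2)"
      by (intro summable_suminf_not_top) auto
    then have "summable (\<lambda>k. 2^k * (cmod (d k x))\<^sup>2 + (1/2)^k)"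
      by (intro summable_add summable_geometric) auto
    then have "summable (\<lambda>k. cmod (d k x))"
    proof (rule summable_comparison_test'[where N = 0])
      fix k
      have *: "2 * a \<le> b * a\<^sup>2 + 1 / b" if "b > 0" for a b :: real
      proof -
        have "0 \<le> (b * a - 1)\<^sup>2 / b" using that by simp
        also have "\<dots> = b * a\<^sup>2 - 2 * a + 1 / b"
          using that by (simp add: field_simps power2_eq_square)
        finally show ?thesis by simp
      qed
      from *[of "2^k" "cmod (d k x)"]
      have "2 * cmod (d k x) \<le> 2^k * (cmod (d k x))\<^sup>2 + (1/2)^k"
        by (simp add: power_one_over)
      with norm_ge_zero[of "d k x"] have "cmod (d k x) \<le> 2^k * (cmod (d k x))\<^sup>2 + (1/2)^k"
        by linarith
      then show "norm (cmod (d k x)) \<le> 2^k * (cmod (d k x))\<^sup>2 + (1/2)^k" by simp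
    qed
    then have "summable (\<lambda>k. d k x)" by (rule summable_norm_cancel)
    then have "convergent (\<lambda>n. \<Sum>k<n. d k x)" by (simp only: summable_iff_convergent)
    then have "convergent (\<lambda>n. s (r n) x - s (r 0) x)"
      by (simp only: d_def sum_lessThan_telescope[of "\<lambda>n. s (r n) x"])
    from convergent_add[OF this convergent_const[of "s (r 0) x"]]
    have "convergent (\<lambda>n. s (r n) x)" by simp
    then show ?case by simp
  qed
  define p where "p x = lim (\<lambda>k. s (r k) x)" for x
  have [measurable]: "p \<in> borel_measurable M" unfolding p_def[abs_def] by measurable
  have lim: "AE x in M. (\<lambda>k. s (r k) x) \<longlonglongrightarrow> p x"
    using conv by eventually_elim (simp add: p_def convergent_LIMSEQ_iff)
  \<comment> \<open>Fatou's lemma along the subsequence. It yields membership of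
    \<open>s n - p\<close> in L^2 together with the bound, and \<open>p\<close> itself is then a
    difference of two L^2 functions.\<close>
  have bound: "(\<lambda>x. s n x - p x) \<in> L2_space M \<and> L2_norm M (\<lambda>x. s n x - p x) \<le> (1/2)^j" if n: "n \<ge> n0 j" for n j
  proof -
    have "(\<integral>\<^sup>+x. ennreal ((cmod (s n x - p x))\<^sup>2) \<partial>M)
        = (\<integral>\<^sup>+x. liminf (\<lambda>k. ennreal ((cmod (s n x - s (r k) x))\<^sup>2)) \<partial>M)"
    proof (rule nn_integral_cong_AE, use lim in eventually_elim)
      case (elim x)
      have "(\<lambda>k. ennreal ((cmod (s n x - s (r k) x))\<^sup>2)) \<longlonglongrightarrow> ennreal ((cmod (s n x - p x))\<^sup>2)"
        by (intro tendsto_ennrealI tendsto_intros elim)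
      from lim_imp_Liminf[OF trivial_limit_sequentially this] show ?case by (rule sym)
    qed
    also have "\<dots> \<le> liminf (\<lambda>k. \<integral>\<^sup>+x. ennreal ((cmod (s n x - s (r k) x))\<^sup>2) \<partial>M)"
      by (rule nn_integral_liminf) measurable
    also have "\<dots> \<le> limsup (\<lambda>k. \<integral>\<^sup>+x. ennreal ((cmod (s n x - s (r k) x))\<^sup>2) \<partial>M)"
      by (rule Liminf_le_Limsup) simp
    also have "\<dots> \<le> ennreal (((1/2)^j)\<^sup>2)"
    proof (rule Limsup_bounded)
      have "(\<integral>\<^sup>+x. ennreal ((cmod (s n x - s (r k) x))\<^sup>2) \<partial>M) \<le> ennreal (((1/2)^j)\<^sup>2)" if "k \<ge> j" for k
      proof -
        have "n0 j \<le> r k" using r(1)[of j] lift_Suc_mono_le[of r, OF r(2) that] by linarith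
        then have "L2_norm M (\<lambda>x. s n x - s (r k) x) < (1/2)^j" by (intro n0 n)
        then show ?thesis
          unfolding L2_norm_sq_nn[OF diff_mem[OF s s], symmetric]
          by (intro ennreal_leI power_mono) (auto intro: N_nonneg diff_mem s)
      qed
      then show "\<forall>\<^sub>F k in sequentially. (\<integral>\<^sup>+x. ennreal ((cmod (s n x - s (r k) x))\<^sup>2) \<partial>M) \<le> ennreal (((1/2)^j)\<^sup>2)"
        by (auto simp: eventually_sequentially)
    qed
    finally show ?thesis by (intro conjI L2_nn_bound[of _ M "(1/2)^j"]) auto
  qed
  have "(\<lambda>x. s (n0 0) x - p x) \<in> L2_space M" using bound[of 0 "n0 0"] by simp
  from diff_mem[OF s[of "n0 0"] this] have p: "p \<in> L2_space M" by simp
  have "(\<lambda>n. L2_norm M (\<lambda>x. s n x - p x)) \<longlonglongrightarrow> 0"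
  proof (rule LIMSEQ_I)
    fix e :: real assume "0 < e"
    then obtain j where j: "(1/2)^j < e" using real_arch_pow_inv[of e "1/2"] by auto
    have "norm (L2_norm M (\<lambda>x. s n x - p x) - 0) < e" if "n \<ge> n0 j" for n
      using bound[OF that] j N_nonneg[OF conjunct1[OF bound[OF that]]] by simp
    then show "\<exists>no. \<forall>n\<ge>no. norm (L2_norm M (\<lambda>x. s n x - p x) - 0) < e" by blast
  qed
  with p show ?thesis by blast
qed

interpretation L2: semi_hilbert "L2_space M" "L2_inner M"
  rewrites "semi_ip.N (L2_inner M) = L2_norm M" for M
proof -
  interpret semi_ip "L2_space M" "L2_inner M" by (rule semi_ip_L2)
  show "semi_hilbert (L2_space M) (L2_inner M)"
  proof
    fix s assume "\<And>n. s n \<in> L2_space M" "cauchy s"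
    from L2_complete[OF this] show "\<exists>p\<in>L2_space M. (\<lambda>n. N (\<lambda>x. s n x - p x)) \<longlonglongrightarrow> 0"
      unfolding L2_norm_eq .
  qed
qed (rule L2_norm_eq)

lemma L2_inner_cong_AE:
  assumes "f \<in> borel_measurable M" "f' \<in> borel_measurable M" "g \<in> borel_measurable M" "g' \<in> borel_measurable M"
    and "AE x in M. f x = f' x" "AE x in M. g x = g' x"
  shows "L2_inner M f g = L2_inner M f' g'"
proof -
  note [measurable] = assms(1-4)
  have cnj [measurable]: "cnj \<in> borel_measurable borel"
    by (intro borel_measurable_continuous_onI continuous_intros)
  show ?thesis unfolding L2_inner_def
    by (rule integral_cong_AE) (use assms(5,6) in auto)
qed

lemma L2_norm_cong_AE:
  assumes "f \<in> borel_measurable M" "f' \<in> borel_measurable M" "AE x in M. f x = f' x"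
  shows "L2_norm M f = L2_norm M f'"
  using L2_inner_cong_AE[OF assms(1,2,1,2,3,3)] by (simp add: L2_norm_def L2_inner_self[symmetric])

lemma L2_inner_cong:
  assumes "f \<in> L2_space M" "f' \<in> L2_space M" "g \<in> L2_space M" "g' \<in> L2_space M"
    and "AE x in M. f x = f' x" "AE x in M. g x = g' x"
  shows "L2_inner M f g = L2_inner M f' g'"
  by (rule L2_inner_cong_AE[OF assms(1-4)[THEN L2_spaceD(1)] assms(5,6)])

lemma L2_norm_cong:
  assumes "f \<in> L2_space M" "f' \<in> L2_space M" "AE x in M. f x = f' x"
  shows "L2_norm M f = L2_norm M f'"
  by (rule L2_norm_cong_AE[OF assms(1,2)[THEN L2_spaceD(1)] assms(3)])

lemma L2_norm_eq_0_iff: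
  assumes "f \<in> L2_space M"
  shows "L2_norm M f = 0 \<longleftrightarrow> (AE x in M. f x = 0)"
  using integral_nonneg_eq_0_iff_AE[OF L2_spaceD(2)[OF assms]] by (simp add: L2_norm_def)

lemma L2_inner_sum_left:
  assumes "finite I" "\<And>i. i \<in> I \<Longrightarrow> f i \<in> L2_space M" "h \<in> L2_space M"
  shows "(\<lambda>x. \<Sum>i\<in>I. f i x) \<in> L2_space M \<and> L2_inner M (\<lambda>x. \<Sum>i\<in>I. f i x) h = (\<Sum>i\<in>I. L2_inner M (f i) h)"
  using assms
proof (induction I rule: finite_induct)
  case empty
  then show ?case using L2.zero_mem by (simp add: L2_inner_def)
qed (simp add: L2.ip_simps)

section \<open>Test functions\<close>

lemma partial_deriv_eq: "(f has_derivative D) (at x) \<Longrightarrow> partial_deriv b f x = D b"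
  using frechet_derivative_at by (force simp: partial_deriv_def)

lemma Ck_SucD:
  assumes "Ck (Suc k) f"
  shows "(f has_derivative frechet_derivative f (at x)) (at x)" "b \<in> Basis \<Longrightarrow> Ck k (partial_deriv b f)"
  using assms by (auto simp: differentiable_on_def frechet_derivative_works)

lemma Ck_SucI:
  assumes "\<And>x. (f has_derivative D x) (at x)" "\<And>b. b \<in> Basis \<Longrightarrow> Ck k (\<lambda>x. D x b)"
  shows "Ck (Suc k) f"
proof -
  have "partial_deriv b f = (\<lambda>x. D x b)" for b
    by (rule ext, rule partial_deriv_eq, rule assms(1))
  then show ?thesis using assms by (auto simp: differentiable_on_def differentiable_def)
qed

lemma Ck_pred: "Ck (Suc k) f \<Longrightarrow> Ck k f"
proof (induction k arbitrary: f)
  case 0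
  then show ?case by (simp add: differentiable_imp_continuous_on)
next
  case (Suc k)
  then show ?case by auto
qed

lemma Ck_const: "Ck k (\<lambda>x. c)"
proof (induction k arbitrary: c)
  case (Suc k)
  then show ?case by (intro Ck_SucI[where D = "\<lambda>x h. 0"]) (auto intro!: derivative_eq_intros)
qed simp

lemma Ck_add: "Ck k f \<Longrightarrow> Ck k g \<Longrightarrow> Ck k (\<lambda>x. f x + g x)"
proof (induction k arbitrary: f g)
  case (Suc k)
  show ?case
  proof (rule Ck_SucI[OF has_derivative_add[OF Ck_SucD(1)[OF Suc.prems(1)] Ck_SucD(1)[OF Suc.prems(2)]]])
    fix b :: 'a assume b: "b \<in> Basis"
    show "Ck k (\<lambda>x. frechet_derivative f (at x) b + frechet_derivative g (at x) b)"
      using Suc.IH[OF Ck_SucD(2)[OF Suc.prems(1) b] Ck_SucD(2)[OF Suc.prems(2) b]]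
      by (simp add: partial_deriv_def)
  qed
qed (auto intro: continuous_intros)

lemma Ck_mult: "Ck k f \<Longrightarrow> Ck k g \<Longrightarrow> Ck k (\<lambda>x. f x * g x)"
proof (induction k arbitrary: f g)
  case (Suc k)
  show ?case
  proof (rule Ck_SucI[OF has_derivative_mult[OF Ck_SucD(1)[OF Suc.prems(1)] Ck_SucD(1)[OF Suc.prems(2)]]])
    fix b :: 'a assume b: "b \<in> Basis"
    show "Ck k (\<lambda>x. f x * frechet_derivative g (at x) b + frechet_derivative f (at x) b * g x)"
      using Ck_add[OF Suc.IH[OF Ck_pred[OF Suc.prems(1)] Ck_SucD(2)[OF Suc.prems(2) b]]
          Suc.IH[OF Ck_SucD(2)[OF Suc.prems(1) b] Ck_pred[OF Suc.prems(2)]]]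
      by (simp add: partial_deriv_def)
  qed
qed (auto intro: continuous_intros)

lemma Ck_cnj: "Ck k f \<Longrightarrow> Ck k (\<lambda>x. cnj (f x))"
proof (induction k arbitrary: f)
  case (Suc k)
  show ?case
  proof (rule Ck_SucI[OF has_derivative_cnj[OF Ck_SucD(1)[OF Suc.prems]]])
    fix b :: 'a assume b: "b \<in> Basis"
    show "Ck k (\<lambda>x. cnj (frechet_derivative f (at x) b))"
      using Suc.IH[OF Ck_SucD(2)[OF Suc.prems b]] by (simp add: partial_deriv_def)
  qed
qed (auto intro: continuous_intros)

lemma has_derivative_translate:
  assumes "(f has_derivative D) (at (x + a))"
  shows "((\<lambda>x. f (x + a)) has_derivative D) (at x)"
proof -
  have "((\<lambda>x. x + a) has_derivative (\<lambda>h. h)) (at x)" by (auto intro!: derivative_eq_intros)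
  from has_derivative_compose[OF this, of f D] assms show ?thesis by simp
qed

lemma Ck_translate: "Ck k f \<Longrightarrow> Ck k (\<lambda>x. f (x + a))"
proof (induction k arbitrary: f)
  case 0
  then have "continuous_on UNIV f" by simp
  then have "continuous_on UNIV (\<lambda>x. f (x + a))"
    by (rule continuous_on_compose2) (auto intro!: continuous_intros)
  then show ?case by simp
next
  case (Suc k)
  show ?case
  proof (rule Ck_SucI[OF has_derivative_translate[OF Ck_SucD(1)[OF Suc.prems]]])
    fix b :: 'a assume b: "b \<in> Basis"
    show "Ck k (\<lambda>x. frechet_derivative f (at (x + a)) b)"
      using Suc.IH[OF Ck_SucD(2)[OF Suc.prems b]] by (simp add: partial_deriv_def)
  qed
qed

lemma Ck_prod:
  "finite I \<Longrightarrow> (\<And>i. i \<in> I \<Longrightarrow> Ck k (f i)) \<Longrightarrow> Ck k (\<lambda>x. \<Prod>i\<in>I. f i x)"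
  by (induction I rule: finite_induct) (auto simp: Ck_const Ck_mult)

lemma C0_infinity_iff:
  "f \<in> C0_infinity \<longleftrightarrow> (\<forall>k. Ck k f) \<and> (\<exists>r. \<forall>x. r < norm x \<longrightarrow> f x = 0)"
proof -
  have "compact (closure {x. f x \<noteq> 0}) \<longleftrightarrow> (\<exists>r. \<forall>x. r < norm x \<longrightarrow> f x = 0)"
  proof
    assume "compact (closure {x. f x \<noteq> 0})"
    then have "bounded {x. f x \<noteq> 0}"
      by (rule bounded_subset[OF compact_imp_bounded closure_subset])
    then obtain a where "\<And>x. f x \<noteq> 0 \<Longrightarrow> norm x \<le> a" by (auto simp: bounded_iff)
    then show "\<exists>r. \<forall>x. r < norm x \<longrightarrow> f x = 0" by (meson not_le)
  next
    assume "\<exists>r. \<forall>x. r < norm x \<longrightarrow> f x = 0"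
    then obtain r where "{x. f x \<noteq> 0} \<subseteq> cball 0 r" by (force simp: not_less)
    then have "bounded {x. f x \<noteq> 0}" using bounded_cball bounded_subset by blast
    then show "compact (closure {x. f x \<noteq> 0})" by (simp add: compact_closure)
  qed
  then show ?thesis by (simp add: C0_infinity_def)
qed

lemma C0_support:
  assumes "f \<in> C0_infinity"
  obtains r where "0 < r" "\<And>x. r < norm x \<Longrightarrow> f x = 0"
proof -
  obtain r where "\<And>x. r < norm x \<Longrightarrow> f x = 0" using assms by (auto simp: C0_infinity_iff)
  then show thesis using that[of "max r 1"] by auto
qed

lemma C0_Ck: "f \<in> C0_infinity \<Longrightarrow> Ck k f"
  by (simp add: C0_infinity_def)

lemma C0_zero: "(\<lambda>x. 0) \<in> C0_infinity"
  by (simp add: C0_infinity_iff Ck_const)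

lemma C0_add:
  assumes "f \<in> C0_infinity" "g \<in> C0_infinity"
  shows "(\<lambda>x. f x + g x) \<in> C0_infinity"
proof -
  obtain r s where "\<And>x. r < norm x \<Longrightarrow> f x = 0" "\<And>x. s < norm x \<Longrightarrow> g x = 0"
    using C0_support[OF assms(1)] C0_support[OF assms(2)] by metis
  then have "\<exists>r. \<forall>x. r < norm x \<longrightarrow> f x + g x = 0" by (intro exI[of _ "max r s"]) simp
  with assms show ?thesis by (simp add: C0_infinity_iff Ck_add)
qed

lemma C0_mult: "f \<in> C0_infinity \<Longrightarrow> (\<And>k. Ck k g) \<Longrightarrow> (\<lambda>x. g x * f x) \<in> C0_infinity"
  by (auto simp: C0_infinity_iff Ck_mult)

lemma C0_scale: "f \<in> C0_infinity \<Longrightarrow> (\<lambda>x. c * f x) \<in> C0_infinity"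
  by (rule C0_mult) (auto simp: Ck_const)

lemma C0_diff: "f \<in> C0_infinity \<Longrightarrow> g \<in> C0_infinity \<Longrightarrow> (\<lambda>x. f x - g x) \<in> C0_infinity"
  using C0_add[OF _ C0_scale[of g "-1"], of f] by simp

lemma C0_cnj: "f \<in> C0_infinity \<Longrightarrow> (\<lambda>x. cnj (f x)) \<in> C0_infinity"
  by (auto simp: C0_infinity_iff Ck_cnj)

lemma C0_sum:
  "finite I \<Longrightarrow> (\<And>i. i \<in> I \<Longrightarrow> f i \<in> C0_infinity) \<Longrightarrow> (\<lambda>x. \<Sum>i\<in>I. f i x) \<in> C0_infinity"
  by (induction I rule: finite_induct) (auto simp: C0_zero C0_add)

lemma C0_translate:
  assumes "f \<in> C0_infinity"
  shows "(\<lambda>x. f (x + a)) \<in> C0_infinity"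
proof -
  obtain r where r: "\<And>x. r < norm x \<Longrightarrow> f x = 0" using C0_support[OF assms] by blast
  have "f (x + a) = 0" if "r + norm a < norm x" for x
    by (rule r) (use that norm_triangle_ineq4[of "x + a" a] in simp)
  then show ?thesis using assms by (auto simp: C0_infinity_iff Ck_translate)
qed

lemma C0_has_derivative:
  "f \<in> C0_infinity \<Longrightarrow> (f has_derivative frechet_derivative f (at x)) (at x)"
  using Ck_SucD(1)[OF C0_Ck] .

lemma C0_partial:
  assumes "f \<in> C0_infinity" "b \<in> Basis"
  shows "partial_deriv b f \<in> C0_infinity"
proof -
  obtain r where r: "\<And>x. r < norm x \<Longrightarrow> f x = 0" using C0_support[OF assms(1)] by blast
  have "partial_deriv b f x = 0" if x: "r < norm x" for x
  proof -
    have "open {x::'a. r < norm x}" by (intro open_Collect_less continuous_intros)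
    from has_derivative_transform_within_open[OF has_derivative_const this, where g = f and x = x] r x
    have "(f has_derivative (\<lambda>h. 0)) (at x)" by simp
    then show ?thesis by (simp add: partial_deriv_eq)
  qed
  moreover have "Ck k (partial_deriv b f)" for k
    using Ck_SucD(2)[OF C0_Ck[OF assms(1)] assms(2)] .
  ultimately show ?thesis by (auto simp: C0_infinity_iff)
qed

lemma C0_continuous: "f \<in> C0_infinity \<Longrightarrow> continuous_on S f"
  using C0_Ck[of f 0] continuous_on_subset by auto

lemma C0_measurable: "f \<in> C0_infinity \<Longrightarrow> sets M = sets borel \<Longrightarrow> f \<in> borel_measurable M"
  using borel_measurable_continuous_onI[OF C0_continuous[of f UNIV]] measurable_cong_sets by blast

lemma C0_bounded:
  assumes "f \<in> C0_infinity"
  obtains M where "0 < M" "\<And>x. cmod (f x) \<le> M"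
proof -
  obtain r where r: "0 < r" "\<And>x. r < norm x \<Longrightarrow> f x = 0" using C0_support[OF assms] by blast
  have "compact (f ` cball 0 r)"
    by (intro compact_continuous_image C0_continuous assms compact_cball)
  then obtain M where "0 < M" "\<And>y. y \<in> f ` cball 0 r \<Longrightarrow> cmod y \<le> M"
    using compact_imp_bounded bounded_pos by metis
  then have "cmod (f x) \<le> M" for x
    using r(2)[of x] by (cases "r < norm x") auto
  then show thesis using that \<open>0 < M\<close> by blast
qed

lemma partial_deriv_cnj:
  "f \<in> C0_infinity \<Longrightarrow> partial_deriv b (\<lambda>x. cnj (f x)) = (\<lambda>x. cnj (partial_deriv b f x))"
  using partial_deriv_eq[OF has_derivative_cnj[OF C0_has_derivative]] by (force simp: partial_deriv_def)

lemma partial_deriv_add: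
  "f \<in> C0_infinity \<Longrightarrow> g \<in> C0_infinity \<Longrightarrow>
    partial_deriv b (\<lambda>x. f x + g x) = (\<lambda>x. partial_deriv b f x + partial_deriv b g x)"
  using partial_deriv_eq[OF has_derivative_add[OF C0_has_derivative C0_has_derivative]]
  by (force simp: partial_deriv_def)

lemma partial_deriv_diff:
  "f \<in> C0_infinity \<Longrightarrow> g \<in> C0_infinity \<Longrightarrow>
    partial_deriv b (\<lambda>x. f x - g x) = (\<lambda>x. partial_deriv b f x - partial_deriv b g x)"
  using partial_deriv_eq[OF has_derivative_diff[OF C0_has_derivative C0_has_derivative]]
  by (force simp: partial_deriv_def)

lemma partial_deriv_scale:
  "f \<in> C0_infinity \<Longrightarrow> partial_deriv b (\<lambda>x. c * f x) = (\<lambda>x. c * partial_deriv b f x)"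
  using partial_deriv_eq[OF has_derivative_mult_right[OF C0_has_derivative]]
  by (force simp: partial_deriv_def)

lemma partial_deriv_translate:
  "f \<in> C0_infinity \<Longrightarrow> partial_deriv b (\<lambda>x. f (x + a)) = (\<lambda>x. partial_deriv b f (x + a))"
  using partial_deriv_eq[OF has_derivative_translate[OF C0_has_derivative]]
  by (force simp: partial_deriv_def)

lemma partial_deriv_mult:
  "f \<in> C0_infinity \<Longrightarrow> g \<in> C0_infinity \<Longrightarrow>
    partial_deriv b (\<lambda>x. f x * g x) = (\<lambda>x. f x * partial_deriv b g x + partial_deriv b f x * g x)"
  using partial_deriv_eq[OF has_derivative_mult[OF C0_has_derivative C0_has_derivative]]
  by (force simp: partial_deriv_def)

section \<open>Derivatives along coordinate lines and symmetry of second derivatives\<close>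

lemma C0_line_derivative:
  assumes "f \<in> C0_infinity"
  shows "((\<lambda>t. f (x + t *\<^sub>R b)) has_vector_derivative partial_deriv b f (x + t *\<^sub>R b)) (at t)"
proof -
  let ?D = "frechet_derivative f (at (x + t *\<^sub>R b))"
  have "((\<lambda>t. x + t *\<^sub>R b) has_derivative (\<lambda>s. s *\<^sub>R b)) (at t)"
    by (auto intro!: derivative_eq_intros)
  from has_derivative_compose[OF this C0_has_derivative[OF assms]]
  have "((\<lambda>t. f (x + t *\<^sub>R b)) has_derivative (\<lambda>s. ?D (s *\<^sub>R b))) (at t)" .
  moreover have "(\<lambda>s. ?D (s *\<^sub>R b)) = (\<lambda>s. s *\<^sub>R partial_deriv b f (x + t *\<^sub>R b))"
    using linear_scale[OF has_derivative_linear[OF C0_has_derivative[OF assms]]]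
    by (auto simp: partial_deriv_def)
  ultimately show ?thesis by (simp add: has_vector_derivative_def)
qed

lemma vector_derivative_increment_bound:
  fixes g :: "real \<Rightarrow> 'b::real_normed_vector"
  assumes "\<And>s. s \<in> closed_segment u v \<Longrightarrow> (g has_vector_derivative g' s) (at s)"
    and "\<And>s. s \<in> closed_segment u v \<Longrightarrow> norm (g' s) \<le> B"
  shows "norm (g v - g u) \<le> B * \<bar>v - u\<bar>"
proof -
  have "norm (g v - g u) \<le> B * norm (v - u)"
  proof (rule differentiable_bound[of "closed_segment u v" g "\<lambda>s h. h *\<^sub>R g' s"])
    fix s assume s: "s \<in> closed_segment u v"
    show "(g has_derivative (\<lambda>h. h *\<^sub>R g' s)) (at s within closed_segment u v)"
      using assms(1)[OF s] has_derivative_at_withinI by (auto simp: has_vector_derivative_def)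
    show "onorm (\<lambda>h. h *\<^sub>R g' s) \<le> B"
      by (rule onorm_le) (use mult_left_mono[OF assms(2)[OF s] abs_ge_zero] in \<open>simp add: mult.commute\<close>)
  qed auto
  then show ?thesis by simp
qed

lemma C0_Lipschitz:
  assumes "f \<in> C0_infinity" "b \<in> Basis"
  obtains M where "0 < M" "\<And>x t. cmod (f (x + t *\<^sub>R b) - f x) \<le> M * \<bar>t\<bar>"
proof -
  obtain M where M: "0 < M" "\<And>x. cmod (partial_deriv b f x) \<le> M"
    using C0_bounded[OF C0_partial[OF assms]] by metis
  have "cmod (f (x + t *\<^sub>R b) - f x) \<le> M * \<bar>t\<bar>" for x t
    using vector_derivative_increment_bound[of 0 t "\<lambda>t. f (x + t *\<^sub>R b)" "\<lambda>t. partial_deriv b f (x + t *\<^sub>R b)" M]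
      C0_line_derivative[OF assms(1)] M by simp
  then show thesis using M(1) that by blast
qed

text \<open>The mean value inequality is used twice on the second difference with t^2 times the
  limit removed: in direction \<open>c\<close> for the first derivative, then in direction
  \<open>b\<close> for the function. Continuity of the mixed derivative bounds the innermost
  derivative by e/2, which becomes e/2 t and finally e/2 t^2.\<close>

lemma second_difference_limit:
  assumes f: "f \<in> C0_infinity" and b: "b \<in> Basis" and c: "c \<in> Basis"
  shows "((\<lambda>t. (f (x + t *\<^sub>R b + t *\<^sub>R c) - f (x + t *\<^sub>R b) - (f (x + t *\<^sub>R c) - f x)) / of_real (t\<^sup>2))
    \<longlongrightarrow> partial_deriv c (partial_deriv b f) x) (at_right 0)"
proof (rule tendstoI)
  fix e :: real assume e: "0 < e"
  let ?fb = "partial_deriv b f" and ?fcb = "partial_deriv c (partial_deriv b f)"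
  let ?L = "?fcb x"
  have fb: "?fb \<in> C0_infinity" and fcb: "?fcb \<in> C0_infinity" using f b c C0_partial by auto
  have "isCont ?fcb x" using C0_continuous[OF fcb, of UNIV] by (simp add: continuous_on_eq_continuous_at)
  then obtain d where d: "d > 0" "\<And>y. dist y x < d \<Longrightarrow> dist (?fcb y) ?L < e / 2"
    using e unfolding continuous_at_eps_delta by (meson half_gt_zero)
  have "dist ((f (x + t *\<^sub>R b + t *\<^sub>R c) - f (x + t *\<^sub>R b) - (f (x + t *\<^sub>R c) - f x)) / of_real (t\<^sup>2)) ?L < e"
    if t: "0 < t" "t < d / 2" for t
  proof -
    have inner: "cmod ((?fb (x + s *\<^sub>R b + t *\<^sub>R c) - t *\<^sub>R ?L) - (?fb (x + s *\<^sub>R b + 0 *\<^sub>R c) - 0 *\<^sub>R ?L)) \<le> e / 2 * \<bar>t - 0\<bar>"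
      if s: "s \<in> closed_segment 0 t" for s
    proof (rule vector_derivative_increment_bound)
      fix r assume r: "r \<in> closed_segment 0 t"
      show "((\<lambda>r. ?fb (x + s *\<^sub>R b + r *\<^sub>R c) - r *\<^sub>R ?L) has_vector_derivative
          ?fcb (x + s *\<^sub>R b + r *\<^sub>R c) - ?L) (at r)"
        by (rule derivative_eq_intros C0_line_derivative[OF fb] refl | simp)+
      have "norm (s *\<^sub>R b + r *\<^sub>R c) \<le> norm (s *\<^sub>R b) + norm (r *\<^sub>R c)" by (rule norm_triangle_ineq)
      also have "\<dots> < d" using r s t b c by (auto simp: closed_segment_eq_real_ivl)
      finally have "dist (x + s *\<^sub>R b + r *\<^sub>R c) x < d" by (simp add: dist_norm add.assoc)
      then show "cmod (?fcb (x + s *\<^sub>R b + r *\<^sub>R c) - ?L) \<le> e / 2"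
        using d(2) by (simp add: dist_norm less_imp_le)
    qed
    let ?g = "\<lambda>s. f (x + t *\<^sub>R c + s *\<^sub>R b) - f (x + s *\<^sub>R b) - (s * t) *\<^sub>R ?L"
    have "cmod (?g t - ?g 0) \<le> (e / 2 * t) * \<bar>t - 0\<bar>"
    proof (rule vector_derivative_increment_bound)
      fix s assume s: "s \<in> closed_segment 0 t"
      have "((\<lambda>s. (s * t) *\<^sub>R ?L) has_vector_derivative t *\<^sub>R ?L) (at s)"
        by (rule derivative_eq_intros refl | simp)+
      then show "(?g has_vector_derivative ?fb (x + t *\<^sub>R c + s *\<^sub>R b) - ?fb (x + s *\<^sub>R b) - t *\<^sub>R ?L) (at s)"
        by (intro has_vector_derivative_diff C0_line_derivative[OF f])
      show "cmod (?fb (x + t *\<^sub>R c + s *\<^sub>R b) - ?fb (x + s *\<^sub>R b) - t *\<^sub>R ?L) \<le> e / 2 * t"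
        using inner[OF s] t by (simp add: algebra_simps)
    qed
    also have "?g t - ?g 0 = (f (x + t *\<^sub>R b + t *\<^sub>R c) - f (x + t *\<^sub>R b) - (f (x + t *\<^sub>R c) - f x)) - of_real (t\<^sup>2) * ?L"
      by (simp add: algebra_simps power2_eq_square scaleR_conv_of_real)
    finally have "cmod ((f (x + t *\<^sub>R b + t *\<^sub>R c) - f (x + t *\<^sub>R b) - (f (x + t *\<^sub>R c) - f x)) - of_real (t\<^sup>2) * ?L)
      \<le> e / 2 * t\<^sup>2" using t by (simp add: power2_eq_square)
    moreover have "dist (z / of_real (t\<^sup>2)) ?L = cmod (z - of_real (t\<^sup>2) * ?L) / t\<^sup>2" for z
    proof -
      have "z / of_real (t\<^sup>2) - ?L = (z - of_real (t\<^sup>2) * ?L) / of_real (t\<^sup>2)"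
        using t by (simp add: field_simps)
      then show ?thesis using t by (simp add: dist_norm norm_divide norm_power)
    qed
    ultimately have "dist ((f (x + t *\<^sub>R b + t *\<^sub>R c) - f (x + t *\<^sub>R b) - (f (x + t *\<^sub>R c) - f x)) / of_real (t\<^sup>2)) ?L \<le> e / 2"
      using t by (simp add: divide_le_eq)
    with e show ?thesis by simp
  qed
  moreover have "\<forall>\<^sub>F t in at_right 0. 0 < t \<and> t < d / 2"
    using d(1) eventually_at_right_real[of 0 "d/2"] by simp
  ultimately show "\<forall>\<^sub>F t in at_right 0. dist ((f (x + t *\<^sub>R b + t *\<^sub>R c) - f (x + t *\<^sub>R b) - (f (x + t *\<^sub>R c) - f x)) / of_real (t\<^sup>2)) ?L < e"
    by (auto elim!: eventually_mono)
qed

text \<open>The second difference is symmetric in \<open>b\<close> and \<open>c\<close>, so both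
  iterated derivatives are limits of the same quotient. Symmetry is needed for the a priori bound,
  where the norm of \<Delta> \<phi> is rewritten through mixed derivatives.\<close>

lemma partial_deriv_commute:
  assumes f: "f \<in> C0_infinity" and b: "b \<in> Basis" and c: "c \<in> Basis"
  shows "partial_deriv c (partial_deriv b f) = partial_deriv b (partial_deriv c f)"
proof
  fix x
  have "(\<lambda>t. (f (x + t *\<^sub>R b + t *\<^sub>R c) - f (x + t *\<^sub>R b) - (f (x + t *\<^sub>R c) - f x)) / of_real (t\<^sup>2))
    = (\<lambda>t. (f (x + t *\<^sub>R c + t *\<^sub>R b) - f (x + t *\<^sub>R c) - (f (x + t *\<^sub>R b) - f x)) / of_real (t\<^sup>2))"
    by (simp add: algebra_simps)
  then show "partial_deriv c (partial_deriv b f) x = partial_deriv b (partial_deriv c f) x"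
    using tendsto_unique[OF _ second_difference_limit[OF f b c, of x]] second_difference_limit[OF f c b, of x]
    by simp
qed

section \<open>Bump functions\<close>

text \<open>The classical flat function exp(-1/t) with a polynomial factor in 1/t. With the factor
  the family is closed under differentiation, so smoothness is a single induction with
  \<open>p\<close> arbitrary; the bumps themselves use \<open>p = 1\<close>.\<close>

definition flat_exp :: "real poly \<Rightarrow> real \<Rightarrow> real" where
  "flat_exp p t = (if 0 < t then poly p (1 / t) * exp (- (1 / t)) else 0)"

lemma poly_times_exp_tendsto_0:
  fixes p :: "real poly"
  shows "((\<lambda>u. poly p u * exp (- u)) \<longlongrightarrow> 0) at_top"
proof -
  have "((\<lambda>u. \<Sum>i\<le>degree p. coeff p i * (u ^ i / exp u)) \<longlongrightarrow> (\<Sum>i\<le>degree p. coeff p i * 0)) at_top"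
    by (intro tendsto_intros tendsto_power_div_exp_0)
  then show ?thesis
    by (simp add: poly_altdef sum_distrib_right exp_minus divide_inverse mult.assoc)
qed

text \<open>With u = 1/t, the derivative of p(u) exp(-u) in t is u^2 (p(u) - p'(u)) exp(-u); this is
  the polynomial of the statement.\<close>

lemma flat_exp_derivative:
  "(flat_exp p has_real_derivative flat_exp ([:0, 0, 1:] * (p - pderiv p)) t) (at t)"
proof -
  consider "t < 0" | "t = 0" | "t > 0" by linarith
  then show ?thesis
  proof cases
    case 1
    have "((\<lambda>t. 0) has_real_derivative 0) (at t)" by simp
    then have "(flat_exp p has_real_derivative 0) (at t)"
      by (rule has_field_derivative_transform_within_open[of _ _ _ "{..<0}"])
        (use 1 in \<open>auto simp: flat_exp_def\<close>)
    then show ?thesis using 1 by (simp add: flat_exp_def)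
  next
    case 2
    \<comment> \<open>The right difference quotient at 0 is u p(u) exp(-u) with u = 1/h, and
      \<open>pCons 0 p\<close> is the polynomial u p(u).\<close>
    have "((\<lambda>h. poly (pCons 0 p) (inverse h) * exp (- inverse h)) \<longlongrightarrow> 0) (at_right 0)"
      using filterlim_compose[OF poly_times_exp_tendsto_0 filterlim_inverse_at_top_right] .
    then have "((\<lambda>h. flat_exp p h / h) \<longlongrightarrow> 0) (at_right 0)"
      by (rule Lim_transform_eventually)
        (auto simp: eventually_at_filter flat_exp_def field_simps)
    moreover have "((\<lambda>h. flat_exp p h / h) \<longlongrightarrow> 0) (at_left 0)"
      by (rule tendsto_eventually) (auto simp: eventually_at_filter flat_exp_def)
    ultimately have "((\<lambda>h. flat_exp p h / h) \<longlongrightarrow> 0) (at 0)"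
      by (simp add: filterlim_split_at)
    then show ?thesis using 2 by (simp add: has_field_derivative_def has_derivative_at DERIV_def flat_exp_def flip: has_field_derivative_def)
  next
    case 3
    have "((\<lambda>t. poly p (1 / t) * exp (- (1 / t))) has_real_derivative
        flat_exp ([:0, 0, 1:] * (p - pderiv p)) t) (at t)"
      using 3 by (auto intro!: derivative_eq_intros DERIV_chain2[OF poly_DERIV]
          simp: flat_exp_def field_simps power2_eq_square)
    then show ?thesis
      by (rule has_field_derivative_transform_within_open[of _ _ _ "{0<..}"])
        (use 3 in \<open>auto simp: flat_exp_def\<close>)
  qed
qed

lemma Ck_flat_exp: "Ck k (\<lambda>x. complex_of_real (flat_exp p (c * (x \<bullet> a) + d)))"
proof (induction k arbitrary: p)
  case 0
  have "continuous_on UNIV (flat_exp p)"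
    using flat_exp_derivative by (meson DERIV_continuous_on has_field_derivative_at_within)
  then have "continuous_on UNIV (\<lambda>x. flat_exp p (c * (x \<bullet> a) + d))"
    by (rule continuous_on_compose2) (auto intro!: continuous_intros)
  then show ?case by (auto intro: continuous_intros)
next
  case (Suc k)
  let ?q = "[:0, 0, 1:] * (p - pderiv p)"
  show ?case
  proof (rule Ck_SucI)
    fix x
    have "(flat_exp p has_derivative (\<lambda>h. flat_exp ?q (c * (x \<bullet> a) + d) * h)) (at (c * (x \<bullet> a) + d))"
      using flat_exp_derivative[of p "c * (x \<bullet> a) + d"] by (simp add: has_field_derivative_def)
    moreover have "((\<lambda>x. c * (x \<bullet> a) + d) has_derivative (\<lambda>h. c * (h \<bullet> a))) (at x)"
      by (auto intro!: derivative_eq_intros)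
    ultimately have "((\<lambda>x. flat_exp p (c * (x \<bullet> a) + d)) has_derivative (\<lambda>h. flat_exp ?q (c * (x \<bullet> a) + d) * (c * (h \<bullet> a)))) (at x)"
      using has_derivative_compose by blast
    then show "((\<lambda>x. complex_of_real (flat_exp p (c * (x \<bullet> a) + d))) has_derivative
        (\<lambda>h. complex_of_real (flat_exp ?q (c * (x \<bullet> a) + d) * (c * (h \<bullet> a))))) (at x)"
      by (rule has_derivative_of_real)
    fix b :: 'a
    show "Ck k (\<lambda>x. complex_of_real (flat_exp ?q (c * (x \<bullet> a) + d) * (c * (b \<bullet> a))))"
      unfolding of_real_mult by (intro Ck_mult Ck_const Suc.IH)
  qed
qed

section \<open>The fundamental lemma of the calculus of variations\<close>

text \<open>Wide enough for L^2 functions and for the constant 1, whose convolution with a test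
  function will give integration by parts.\<close>

definition loc_integrable :: "('a::euclidean_space \<Rightarrow> complex) \<Rightarrow> bool" where
  "loc_integrable f \<longleftrightarrow> f \<in> borel_measurable borel \<and>
     (\<forall>r. integrable lborel (\<lambda>x. indicator (cball 0 r) x * cmod (f x)))"

lemma loc_integrable_const: "loc_integrable (\<lambda>x. c)"
  unfolding loc_integrable_def
  by (auto intro!: integrable_mult_left integrable_real_indicator emeasure_bounded_finite)

lemma L2_loc_integrable:
  assumes "f \<in> L2_space lborel"
  shows "loc_integrable f"
proof -
  have [measurable]: "f \<in> borel_measurable borel" using L2_spaceD(1)[OF assms] by simp
  have "integrable lborel (\<lambda>x. indicator (cball 0 r) x * cmod (f x))" for r
  proof (rule Bochner_Integration.integrable_bound)
    show "integrable lborel (\<lambda>x. indicator (cball 0 r) x + (cmod (f x))\<^sup>2)"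
      using L2_spaceD(2)[OF assms]
      by (intro Bochner_Integration.integrable_add integrable_real_indicator)
        (use emeasure_bounded_finite[of "cball 0 r"] in auto)
    have "a \<le> 1 + a\<^sup>2" for a :: real
    proof -
      have "0 \<le> (a - 1)\<^sup>2" by simp
      then have "2 * a \<le> a\<^sup>2 + 1" by (simp add: power2_diff)
      then show ?thesis using zero_le_power2[of a] by linarith
    qed
    then show "AE x in lborel. norm (indicator (cball 0 r) x * cmod (f x)) \<le> norm (indicator (cball 0 r) x + (cmod (f x))\<^sup>2)"
      by (auto simp: indicator_def)
    show "(\<lambda>x. indicator (cball 0 r) x * cmod (f x)) \<in> borel_measurable lborel"
      by (intro borel_measurable_times borel_measurable_indicator borel_measurable_norm) auto
  qed
  then show ?thesis by (simp add: loc_integrable_def)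
qed

text \<open>Dominated convergence in the form that test functions call for: a uniform bound and one
  ball containing all supports, so that \<open>M\<close> |f| on that ball is the majorant. It serves
  indicators of boxes as well as continuity and differentiation of convolutions.\<close>

lemma loc_integrable_dominated:
  assumes f: "loc_integrable f"
    and meas: "\<And>n. g n \<in> borel_measurable borel" "h \<in> borel_measurable borel"
    and lim: "\<And>x. (\<lambda>n. g n x) \<longlonglongrightarrow> h x"
    and bound: "\<And>n x. cmod (g n x) \<le> M * indicator (cball 0 r) x"
  shows "(\<lambda>n. \<integral>x. f x * g n x \<partial>lborel) \<longlonglongrightarrow> (\<integral>x. f x * h x \<partial>lborel)"
    and "integrable lborel (\<lambda>x. f x * h x)"
proof -
  have [measurable]: "f \<in> borel_measurable borel" using f by (simp add: loc_integrable_def)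
  note [measurable] = meas
  have w: "integrable lborel (\<lambda>x. M * (indicator (cball 0 r) x * cmod (f x)))"
    using f by (intro integrable_mult_right) (simp add: loc_integrable_def)
  have b: "AE x in lborel. norm (f x * g n x) \<le> M * (indicator (cball 0 r) x * cmod (f x))" for n
    using mult_left_mono[OF bound norm_ge_zero] by (auto simp: norm_mult mult_ac)
  have l: "AE x in lborel. (\<lambda>n. f x * g n x) \<longlonglongrightarrow> f x * h x"
    by (intro AE_I2 tendsto_intros lim)
  show "(\<lambda>n. \<integral>x. f x * g n x \<partial>lborel) \<longlonglongrightarrow> (\<integral>x. f x * h x \<partial>lborel)"
    by (rule integral_dominated_convergence[OF _ _ w l b]) auto
  show "integrable lborel (\<lambda>x. f x * h x)"
    by (rule integrable_dominated_convergence[OF _ _ w l b]) auto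
qed

lemma C0_bounded_indicator:
  assumes "\<phi> \<in> C0_infinity"
  obtains M r where "0 < M" "0 < r" "\<And>x. cmod (\<phi> x) \<le> M * indicator (cball 0 r) x"
proof -
  obtain M where M: "0 < M" "\<And>x. cmod (\<phi> x) \<le> M" using C0_bounded[OF assms] by blast
  obtain r where r: "0 < r" "\<And>x. r < norm x \<Longrightarrow> \<phi> x = 0" using C0_support[OF assms] by blast
  have "cmod (\<phi> x) \<le> M * indicator (cball 0 r) x" for x
    using M(2)[of x] r(2)[of x] by (auto simp: indicator_def not_le)
  then show thesis using that M r by blast
qed

lemma C0_borel: "\<phi> \<in> C0_infinity \<Longrightarrow> \<phi> \<in> borel_measurable borel"
  by (rule C0_measurable) auto

lemma loc_integrable_mult_C0:
  assumes "loc_integrable f" "\<phi> \<in> C0_infinity"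
  shows "integrable lborel (\<lambda>x. f x * \<phi> x)"
proof -
  obtain M r where "\<And>x. cmod (\<phi> x) \<le> M * indicator (cball 0 r) x"
    using C0_bounded_indicator[OF assms(2)] by metis
  then show ?thesis
    using loc_integrable_dominated(2)[OF assms(1), of "\<lambda>_. \<phi>" \<phi> M r] C0_borel[OF assms(2)] by auto
qed

lemma flat_exp_1: "0 \<le> flat_exp 1 t" "flat_exp 1 t \<le> 1"
  by (auto simp: flat_exp_def)

lemma flat_exp_1_tendsto:
  assumes "0 < t"
  shows "(\<lambda>n. flat_exp 1 (real (Suc n) * t)) \<longlonglongrightarrow> 1"
proof -
  have "(\<lambda>n. exp (- (1 / real (Suc n) * (1 / t)))) \<longlonglongrightarrow> exp (- (0 * (1 / t)))"
    by (intro tendsto_intros LIMSEQ_Suc[OF lim_1_over_n])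
  then show ?thesis using assms by (simp add: flat_exp_def)
qed

text \<open>Multiply the factors exp(-1/(k t)) over all faces, with t the signed distance to the
  face and k = \<open>Suc n\<close>, and replace them by 0 for t \<le> 0. The product is smooth,
  vanishes off the box and tends to 1 inside, so the indicator of a box is a bounded limit of test
  functions with common support.\<close>

lemma box_integral_zero:
  assumes f: "loc_integrable f" and zero: "\<And>\<phi>. \<phi> \<in> C0_infinity \<Longrightarrow> (\<integral>x. f x * \<phi> x \<partial>lborel) = 0"
  shows "(\<integral>x. f x * indicator (box l u) x \<partial>lborel) = 0" "integrable lborel (\<lambda>x. f x * indicator (box l u) x)"
proof -
  define \<phi> where "\<phi> n x = (\<Prod>b\<in>Basis. complex_of_real (flat_exp 1 (real (Suc n) * (x \<bullet> b) + - (real (Suc n) * (l \<bullet> b)))) *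
      complex_of_real (flat_exp 1 (- real (Suc n) * (x \<bullet> b) + real (Suc n) * (u \<bullet> b))))" for n :: nat and x :: 'a
  \<comment> \<open>The definition is spelled out as affine functions of the coordinates, as
    \<open>Ck_flat_exp\<close> expects; this factored form shows the signs and the limit.\<close>
  have \<phi>_eq: "\<phi> n x = (\<Prod>b\<in>Basis. complex_of_real (flat_exp 1 (real (Suc n) * (x \<bullet> b - l \<bullet> b))) *
      complex_of_real (flat_exp 1 (real (Suc n) * (u \<bullet> b - x \<bullet> b))))" for n x
    unfolding \<phi>_def by (simp add: algebra_simps)
  have out: "\<phi> n x = 0" if x: "x \<notin> box l u" for n x
  proof -
    obtain b where b: "b \<in> Basis" "\<not> (l \<bullet> b < x \<bullet> b \<and> x \<bullet> b < u \<bullet> b)"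
      using x unfolding mem_box by blast
    then have "flat_exp 1 (real (Suc n) * (x \<bullet> b - l \<bullet> b)) = 0 \<or> flat_exp 1 (real (Suc n) * (u \<bullet> b - x \<bullet> b)) = 0"
      by (auto simp: flat_exp_def zero_less_mult_iff)
    then show ?thesis unfolding \<phi>_eq using b(1) by (intro prod_zero) auto
  qed
  obtain r where "\<forall>x\<in>box l u. norm x \<le> r"
    using bounded_box[of l u] unfolding bounded_iff by blast
  then have r: "box l u \<subseteq> cball 0 r" by auto
  have C0: "\<phi> n \<in> C0_infinity" for n
    unfolding C0_infinity_iff
  proof (intro conjI allI exI[of _ r] impI)
    fix k
    show "Ck k (\<phi> n)" unfolding \<phi>_def[abs_def] by (intro Ck_prod finite_Basis Ck_mult Ck_flat_exp)
    fix x :: 'a assume "r < norm x"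
    then show "\<phi> n x = 0" using r by (intro out) auto
  qed
  have "cmod (\<phi> n x) \<le> 1" for n x
    unfolding \<phi>_eq prod_norm[symmetric] norm_mult
    by (intro prod_le_1) (auto simp: flat_exp_1 abs_of_nonneg intro!: mult_le_one)
  then have bound: "cmod (\<phi> n x) \<le> 1 * indicator (cball 0 r) x" for n x
    using out[of x n] r by (cases "x \<in> box l u") (auto simp: indicator_def)
  have lim: "(\<lambda>n. \<phi> n x) \<longlonglongrightarrow> indicator (box l u) x" for x
  proof (cases "x \<in> box l u")
    case True
    have "(\<lambda>n. \<phi> n x) \<longlonglongrightarrow> (\<Prod>b\<in>(Basis::'a set). of_real 1 * of_real 1)"
      unfolding \<phi>_eq using True
      by (intro tendsto_intros flat_exp_1_tendsto) (auto simp: mem_box)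
    with True show ?thesis by simp
  qed (simp add: out)
  have m: "\<phi> n \<in> borel_measurable borel" "(indicator (box l u) :: 'a \<Rightarrow> complex) \<in> borel_measurable borel" for n
    using C0_borel[OF C0] by auto
  note D = loc_integrable_dominated[OF f m lim bound]
  show "integrable lborel (\<lambda>x. f x * indicator (box l u) x)" by (rule D(2))
  have "(\<lambda>n. 0 :: complex) \<longlonglongrightarrow> (\<integral>x. f x * indicator (box l u) x \<partial>lborel)"
    using D(1) zero[OF C0] by simp
  then show "(\<integral>x. f x * indicator (box l u) x \<partial>lborel) = 0"
    using LIMSEQ_unique tendsto_const by blast
qed

text \<open>Positive and negative part are Lebesgue densities of two measures that agree on boxes,
  hence on all Borel sets, and densities with respect to a sigma-finite measure are unique almost
  everywhere. The two parts can coincide only where \<open>r\<close> is 0.\<close>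

lemma AE_zero_if_box_integrals_zero:
  fixes r :: "'a::euclidean_space \<Rightarrow> real"
  assumes meas [measurable]: "r \<in> borel_measurable borel"
    and int: "\<And>l u. integrable lborel (\<lambda>x. r x * indicator (box l u) x)"
    and zero: "\<And>l u. (\<integral>x. r x * indicator (box l u) x \<partial>lborel) = 0"
  shows "AE x in lborel. r x = 0"
proof -
  let ?p = "\<lambda>x. ennreal (max 0 (r x))" and ?m = "\<lambda>x. ennreal (max 0 (- r x))"
  \<comment> \<open>The factor \<open>s\<close> will be 1 for the positive and -1 for the negative
    part.\<close>
  have part: "integrable lborel (\<lambda>x. max 0 (s * r x) * indicator (box l u) x) \<and>
      emeasure (density lborel (\<lambda>x. ennreal (max 0 (s * r x)))) (box l u)
      = ennreal (\<integral>x. max 0 (s * r x) * indicator (box l u) x \<partial>lborel)" for s l u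
  proof -
    have i: "integrable lborel (\<lambda>x. max 0 (s * r x) * indicator (box l u) x)"
      by (rule Bochner_Integration.integrable_bound[OF integrable_mult_right[OF int[of l u], of s]])
        (auto simp: indicator_def)
    have "emeasure (density lborel (\<lambda>x. ennreal (max 0 (s * r x)))) (box l u)
        = (\<integral>\<^sup>+x. ennreal (max 0 (s * r x)) * indicator (box l u) x \<partial>lborel)"
      by (rule emeasure_density) auto
    also have "\<dots> = (\<integral>\<^sup>+x. ennreal (max 0 (s * r x) * indicator (box l u) x) \<partial>lborel)"
      by (intro nn_integral_cong) (auto simp: indicator_def)
    also have "\<dots> = ennreal (\<integral>x. max 0 (s * r x) * indicator (box l u) x \<partial>lborel)"
      by (rule nn_integral_eq_integral[OF i]) auto
    finally show ?thesis using i by blast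
  qed
  have eq: "emeasure (density lborel ?p) (box l u) = emeasure (density lborel ?m) (box l u)" for l u
  proof -
    have "0 = (\<integral>x. r x * indicator (box l u) x \<partial>lborel)" by (simp add: zero)
    also have "\<dots> = (\<integral>x. max 0 (r x) * indicator (box l u) x - max 0 (- r x) * indicator (box l u) x \<partial>lborel)"
      by (rule Bochner_Integration.integral_cong) (auto simp: indicator_def max_def)
    also have "\<dots> = (\<integral>x. max 0 (r x) * indicator (box l u) x \<partial>lborel) - (\<integral>x. max 0 (- r x) * indicator (box l u) x \<partial>lborel)"
      using part[of 1 l u] part[of "-1" l u] by (intro Bochner_Integration.integral_diff) auto
    finally show ?thesis using part[of 1 l u] part[of "-1" l u] by simp
  qed
  have "density lborel ?p = density lborel ?m"
  proof (rule measure_eqI_generator_eq)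
    let ?E = "range (\<lambda>(a, b). box a b::'a set)"
    show "Int_stable ?E"
      by (auto simp: Int_stable_def box_Int_box)
    show "?E \<subseteq> Pow UNIV" "sets (density lborel ?p) = sigma_sets UNIV ?E" "sets (density lborel ?m) = sigma_sets UNIV ?E"
      by (simp_all add: borel_eq_box)
    let ?A = "\<lambda>n::nat. box (- (real n *\<^sub>R One)) (real n *\<^sub>R One) :: 'a set"
    show "range ?A \<subseteq> ?E" "(\<Union>i. ?A i) = UNIV"
      unfolding UN_box_eq_UNIV by auto
    show "emeasure (density lborel ?p) (?A i) \<noteq> \<infinity>" for i
      using part[of 1] by simp
    fix X assume "X \<in> ?E" then show "emeasure (density lborel ?p) X = emeasure (density lborel ?m) X"
      using eq by auto
  qed
  then have "AE x in lborel. ?p x = ?m x"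
    by (intro sigma_finite_measure.density_unique[OF sigma_finite_lborel]) auto
  then show ?thesis
    by eventually_elim (auto simp: max_def split: if_splits)
qed

lemma fundamental_lemma:
  assumes f: "loc_integrable f" and zero: "\<And>\<phi>. \<phi> \<in> C0_infinity \<Longrightarrow> (\<integral>x. f x * \<phi> x \<partial>lborel) = 0"
  shows "AE x in lborel. f x = 0"
proof -
  have [measurable]: "f \<in> borel_measurable borel" using f by (simp add: loc_integrable_def)
  have ind: "f x * indicator A x = of_real (Re (f x) * indicator A x) + \<i> * of_real (Im (f x) * indicator A x)" for x A
    by (simp add: indicator_def complex_eq)
  have int: "integrable lborel (\<lambda>x. Re (f x) * indicator (box l u) x)"
    "integrable lborel (\<lambda>x. Im (f x) * indicator (box l u) x)" for l u
    using integrable_Re[OF box_integral_zero(2)[OF f zero, of l u]]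
      integrable_Im[OF box_integral_zero(2)[OF f zero, of l u]]
    by (simp_all add: ind)
  have "Re (\<integral>x. f x * indicator (box l u) x \<partial>lborel) = (\<integral>x. Re (f x) * indicator (box l u) x \<partial>lborel)"
    "Im (\<integral>x. f x * indicator (box l u) x \<partial>lborel) = (\<integral>x. Im (f x) * indicator (box l u) x \<partial>lborel)" for l u
    using integral_Re[OF box_integral_zero(2)[OF f zero, of l u]]
      integral_Im[OF box_integral_zero(2)[OF f zero, of l u]]
    by (simp_all add: ind)
  then have "AE x in lborel. Re (f x) = 0" "AE x in lborel. Im (f x) = 0"
    using box_integral_zero(1)[OF f zero] int by (auto intro!: AE_zero_if_box_integrals_zero)
  then show ?thesis by eventually_elim (simp add: complex_eq_iff)
qed

section \<open>Convolution with test functions\<close>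

text \<open>Convolution with the reflected test function. With this sign the value at 0 is the plain
  pairing of \<open>f\<close> with \<phi>, and every other value is the pairing with a translate;
  the price is a minus sign in each derivative.\<close>

definition conv :: "('a::euclidean_space \<Rightarrow> complex) \<Rightarrow> ('a \<Rightarrow> complex) \<Rightarrow> 'a \<Rightarrow> complex" where
  "conv f \<phi> x = (\<integral>z. f z * \<phi> (z - x) \<partial>lborel)"

lemma C0_translate_diff: "\<phi> \<in> C0_infinity \<Longrightarrow> (\<lambda>z. \<phi> (z - x)) \<in> C0_infinity"
  using C0_translate[of \<phi> "- x"] by simp

lemma continuous_conv:
  assumes f: "loc_integrable f" and \<phi>: "\<phi> \<in> C0_infinity"
  shows "continuous_on UNIV (conv f \<phi>)"
proof (rule continuous_on_sequentiallyI)
  fix X :: "nat \<Rightarrow> 'a" and x assume X: "X \<longlonglongrightarrow> x"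
  then obtain R where R: "\<And>n. norm (X n) \<le> R"
    by (meson BseqE Bseq_def convergentI convergent_imp_Bseq)
  obtain M r where Mr: "0 < M" "\<And>x. cmod (\<phi> x) \<le> M * indicator (cball 0 r) x"
    using C0_bounded_indicator[OF \<phi>] by metis
  show "(\<lambda>n. conv f \<phi> (X n)) \<longlonglongrightarrow> conv f \<phi> x"
    unfolding conv_def
  proof (rule loc_integrable_dominated(1)[OF f])
    show "(\<lambda>n. \<phi> (z - X n)) \<longlonglongrightarrow> \<phi> (z - x)" for z
      using C0_continuous[OF \<phi>, of UNIV] X
      by (intro continuous_on_tendsto_compose[of UNIV \<phi>]) (auto intro!: tendsto_intros)
    fix n z
    have "cmod (\<phi> (z - X n)) \<le> M * indicator (cball 0 r) (z - X n)" by (rule Mr(2))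
    also have "\<dots> \<le> M * indicator (cball 0 (r + R)) z"
      using R[of n] norm_triangle_ineq2[of z "X n"] Mr(1) by (auto simp: indicator_def)
    finally show "cmod (\<phi> (z - X n)) \<le> M * indicator (cball 0 (r + R)) z" .
  qed (auto intro!: C0_borel C0_translate_diff \<phi>)
qed

lemma C0_difference_quotient:
  assumes "\<phi> \<in> C0_infinity"
  shows "((\<lambda>t. (\<phi> (x + t *\<^sub>R b) - \<phi> x) / of_real t) \<longlongrightarrow> partial_deriv b \<phi> x) (at 0)"
proof -
  have d: "((\<lambda>t. \<phi> (x + t *\<^sub>R b)) has_vector_derivative partial_deriv b \<phi> x) (at 0)"
    using C0_line_derivative[OF assms, of x b 0] by simp
  have "((\<lambda>t. (Re (\<phi> (x + t *\<^sub>R b)) - Re (\<phi> x)) / t) \<longlongrightarrow> Re (partial_deriv b \<phi> x)) (at 0)"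
    using bounded_linear.has_vector_derivative[OF bounded_linear_Re d]
    by (simp add: has_real_derivative_iff_has_vector_derivative[symmetric] DERIV_def)
  moreover have "((\<lambda>t. (Im (\<phi> (x + t *\<^sub>R b)) - Im (\<phi> x)) / t) \<longlongrightarrow> Im (partial_deriv b \<phi> x)) (at 0)"
    using bounded_linear.has_vector_derivative[OF bounded_linear_Im d]
    by (simp add: has_real_derivative_iff_has_vector_derivative[symmetric] DERIV_def)
  ultimately show ?thesis by (simp add: tendsto_complex_iff)
qed

text \<open>All differentiation falls on the test function: its Lipschitz constant bounds the
  difference quotients, and boundedness of the null sequence keeps their supports in one
  ball.\<close>

lemma conv_difference_quotient:
  assumes f: "loc_integrable f" and \<phi>: "\<phi> \<in> C0_infinity" and b: "b \<in> Basis"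
  shows "((\<lambda>t. (conv f \<phi> (x + t *\<^sub>R b) - conv f \<phi> x) / of_real t) \<longlongrightarrow> - conv f (partial_deriv b \<phi>) x) (at 0)"
  unfolding tendsto_at_iff_sequentially
proof (intro allI impI)
  fix X :: "nat \<Rightarrow> real" assume nz: "\<forall>i. X i \<in> UNIV - {0}" and X: "X \<longlonglongrightarrow> 0"
  then obtain R where R: "\<And>n. \<bar>X n\<bar> \<le> R"
    by (metis BseqE convergentI convergent_imp_Bseq real_norm_def)
  obtain r where r: "0 < r" "\<And>x. r < norm x \<Longrightarrow> \<phi> x = 0" using C0_support[OF \<phi>] by blast
  obtain M where M: "0 < M" "\<And>x t. cmod (\<phi> (x + t *\<^sub>R b) - \<phi> x) \<le> M * \<bar>t\<bar>"
    using C0_Lipschitz[OF \<phi> b] by blast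
  let ?g = "\<lambda>n z. (\<phi> (z - (x + X n *\<^sub>R b)) - \<phi> (z - x)) / of_real (X n)"
  have "(\<lambda>n. \<integral>z. f z * ?g n z \<partial>lborel) \<longlonglongrightarrow> (\<integral>z. f z * - partial_deriv b \<phi> (z - x) \<partial>lborel)"
  proof (rule loc_integrable_dominated(1)[OF f])
    show "?g n \<in> borel_measurable borel" for n
      by (intro borel_measurable_divide borel_measurable_diff borel_measurable_const C0_borel C0_translate_diff \<phi>)
    show "(\<lambda>z. - partial_deriv b \<phi> (z - x)) \<in> borel_measurable borel"
      by (intro borel_measurable_uminus C0_borel C0_translate_diff C0_partial \<phi> b)
    fix z
    have "filterlim (\<lambda>n. - X n) (at 0) sequentially"
      using nz tendsto_minus[OF X] by (auto simp: filterlim_at)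
    from filterlim_compose[OF C0_difference_quotient[OF \<phi>, of "z - x" b] this]
    have "(\<lambda>n. - ((\<phi> (z - x + - X n *\<^sub>R b) - \<phi> (z - x)) / of_real (- X n))) \<longlonglongrightarrow> - partial_deriv b \<phi> (z - x)"
      by (rule tendsto_minus)
    then show "(\<lambda>n. ?g n z) \<longlonglongrightarrow> - partial_deriv b \<phi> (z - x)" by (simp add: algebra_simps)
    fix n
    have "z - (x + X n *\<^sub>R b) = z - x + (- X n) *\<^sub>R b" by simp
    then have "cmod (\<phi> (z - (x + X n *\<^sub>R b)) - \<phi> (z - x)) \<le> M * \<bar>- X n\<bar>"
      by (simp only: M(2))
    then have "cmod (?g n z) \<le> M" using nz by (simp add: norm_divide divide_le_eq)
    moreover have "?g n z = 0" if "r + norm x + R < norm z"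
    proof -
      have "norm (X n *\<^sub>R b) \<le> R" using R[of n] b by simp
      then have "r < norm (z - (x + X n *\<^sub>R b))" "r < norm (z - x)"
        using that norm_triangle_ineq2[of z "x + X n *\<^sub>R b"] norm_triangle_ineq[of x "X n *\<^sub>R b"]
          norm_triangle_ineq2[of z x] R[of n] by linarith+
      then show ?thesis using r(2) by simp
    qed
    ultimately show "cmod (?g n z) \<le> M * indicator (cball 0 (r + norm x + R)) z"
      by (auto simp: indicator_def not_le)
  qed
  moreover have "(\<integral>z. f z * ?g n z \<partial>lborel) = (conv f \<phi> (x + X n *\<^sub>R b) - conv f \<phi> x) / of_real (X n)" for n
  proof -
    have "(\<integral>z. f z * ?g n z \<partial>lborel) = (\<integral>z. (f z * \<phi> (z - (x + X n *\<^sub>R b)) - f z * \<phi> (z - x)) / of_real (X n) \<partial>lborel)"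
      by (simp add: right_diff_distrib)
    also have "\<dots> = (\<integral>z. f z * \<phi> (z - (x + X n *\<^sub>R b)) - f z * \<phi> (z - x) \<partial>lborel) / of_real (X n)"
      by (rule integral_divide_zero)
    finally show ?thesis unfolding conv_def
      by (simp add: Bochner_Integration.integral_diff loc_integrable_mult_C0[OF f C0_translate_diff[OF \<phi>]])
  qed
  moreover have "(\<integral>z. f z * - partial_deriv b \<phi> (z - x) \<partial>lborel) = - conv f (partial_deriv b \<phi>) x"
    by (simp add: conv_def)
  ultimately show "((\<lambda>t. (conv f \<phi> (x + t *\<^sub>R b) - conv f \<phi> x) / of_real t) \<circ> X) \<longlonglongrightarrow> - conv f (partial_deriv b \<phi>) x"
    by (simp only: comp_def)
qed

lemma conv_Re_derivative:
  assumes "loc_integrable f" "\<phi> \<in> C0_infinity" "b \<in> Basis"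
  shows "((\<lambda>t. Re (conv f \<phi> (x + t *\<^sub>R b))) has_real_derivative - Re (conv f (partial_deriv b \<phi>) (x + t *\<^sub>R b))) (at t)"
proof -
  have "((\<lambda>h. Re ((conv f \<phi> (x + t *\<^sub>R b + h *\<^sub>R b) - conv f \<phi> (x + t *\<^sub>R b)) / of_real h))
      \<longlongrightarrow> Re (- conv f (partial_deriv b \<phi>) (x + t *\<^sub>R b))) (at 0)"
    by (intro tendsto_Re conv_difference_quotient assms)
  then show ?thesis by (simp add: DERIV_def algebra_simps)
qed

section \<open>Translation invariance and integration by parts\<close>

lemma integral_lborel_translate:
  fixes \<phi> :: "'a::euclidean_space \<Rightarrow> complex"
  assumes [measurable]: "\<phi> \<in> borel_measurable borel"
  shows "(\<integral>z. \<phi> (z - x) \<partial>lborel) = (\<integral>z. \<phi> z \<partial>lborel)"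
proof -
  have "(\<integral>z. \<phi> z \<partial>lborel) = (\<integral>z. \<phi> z \<partial>distr lborel borel ((+) (- x)))"
    by (simp add: lborel_distr_plus)
  also have "\<dots> = (\<integral>z. \<phi> (- x + z) \<partial>lborel)" by (rule integral_distr) auto
  finally show ?thesis by (simp add: algebra_simps)
qed

text \<open>The convolution of the constant 1 with \<phi> does not depend on the point, by
  translation invariance, so its derivative vanishes. Integration by parts follows without iterated
  integrals.\<close>

lemma integral_partial_deriv_zero:
  assumes \<phi>: "\<phi> \<in> C0_infinity" and b: "b \<in> Basis"
  shows "(\<integral>x. partial_deriv b \<phi> x \<partial>lborel) = 0"
proof -
  have "conv (\<lambda>_. 1) \<phi> y = (\<integral>x. \<phi> x \<partial>lborel)" for y
    using integral_lborel_translate[OF C0_borel[OF \<phi>]] by (simp add: conv_def)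
  then have "((\<lambda>t. 0) \<longlongrightarrow> - conv (\<lambda>_. 1) (partial_deriv b \<phi>) 0) (at (0::real))"
    using conv_difference_quotient[OF loc_integrable_const[of 1] \<phi> b, of 0] by simp
  then have "- conv (\<lambda>_. 1) (partial_deriv b \<phi>) 0 = 0"
    by (simp add: tendsto_const_iff)
  then show ?thesis by (simp add: conv_def)
qed

lemma C0_integrable: "\<phi> \<in> C0_infinity \<Longrightarrow> integrable lborel \<phi>"
  using loc_integrable_mult_C0[OF loc_integrable_const[of 1]] by simp

lemma C0_mult_C0: "f \<in> C0_infinity \<Longrightarrow> g \<in> C0_infinity \<Longrightarrow> (\<lambda>x. f x * g x) \<in> C0_infinity"
  by (rule C0_mult) (auto simp: C0_Ck)

lemma integration_by_parts:
  assumes f: "f \<in> C0_infinity" and g: "g \<in> C0_infinity" and b: "b \<in> Basis"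
  shows "(\<integral>x. f x * partial_deriv b g x \<partial>lborel) = - (\<integral>x. partial_deriv b f x * g x \<partial>lborel)"
proof -
  have "0 = (\<integral>x. f x * partial_deriv b g x + partial_deriv b f x * g x \<partial>lborel)"
    using integral_partial_deriv_zero[OF C0_mult_C0[OF f g] b] by (simp add: partial_deriv_mult[OF f g])
  also have "\<dots> = (\<integral>x. f x * partial_deriv b g x \<partial>lborel) + (\<integral>x. partial_deriv b f x * g x \<partial>lborel)"
    by (intro Bochner_Integration.integral_add C0_integrable C0_mult_C0 C0_partial f g b)
  finally show ?thesis by (simp add: eq_neg_iff_add_eq_0)
qed

section \<open>Injectivity of \<open>1 - \<Delta>\<close>\<close>

lemma second_derivative_at_max:
  fixes k :: "real \<Rightarrow> real"
  assumes "\<And>t. (k has_real_derivative k' t) (at t)" "(k' has_real_derivative l) (at 0)" "\<And>t. k t \<le> k 0"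
  shows "l \<le> 0"
proof (rule ccontr)
  assume "\<not> l \<le> 0"
  then obtain d where d: "d > 0" "\<And>h. 0 < h \<Longrightarrow> h < d \<Longrightarrow> k' 0 < k' (0 + h)"
    using DERIV_pos_inc_right[OF assms(2)] by auto
  have "k' 0 = 0" by (rule DERIV_local_max[OF assms(1), of 1]) (use assms(3) in auto)
  moreover obtain z where "0 < z" "z < d / 2" "k (d / 2) - k 0 = (d / 2 - 0) * k' z"
    using MVT2[of 0 "d / 2" k k'] assms(1) d(1) by auto
  ultimately have "0 < (d / 2 - 0) * k' z" using d by (intro mult_pos_pos) auto
  with \<open>k (d / 2) - k 0 = _\<close> assms(3)[of "d / 2"] show False by linarith
qed

lemma norm_le_sum_cosh:
  fixes x :: "'a::euclidean_space"
  shows "norm x \<le> 2 * (\<Sum>b\<in>Basis. cosh (x \<bullet> b))"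
proof -
  have "\<bar>t\<bar> \<le> 2 * cosh t" for t :: real
  proof -
    have "\<bar>t\<bar> \<le> exp \<bar>t\<bar>" using exp_ge_add_one_self[of "\<bar>t\<bar>"] by linarith
    also have "\<dots> \<le> 2 * cosh \<bar>t\<bar>" unfolding cosh_field_def by simp
    finally show ?thesis by simp
  qed
  then have "(\<Sum>b\<in>Basis. \<bar>x \<bullet> b\<bar>) \<le> (\<Sum>b\<in>Basis. 2 * cosh (x \<bullet> b))" by (intro sum_mono)
  then show ?thesis using norm_le_l1[of x] by (simp add: sum_distrib_left)
qed

text \<open>
  Phragmen-Lindelof: \<open>\<Sum> cosh (x \<bullet> b)\<close> also solves \<open>\<Delta> G = G\<close> and tends to infinity, so \<open>u - \<delta> G\<close>
  attains its maximum, where \<open>\<Delta> \<le> 0\<close>.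
\<close>
lemma bounded_eigenfunction_nonpos:
  fixes u :: "'a::euclidean_space \<Rightarrow> real"
  assumes cont: "continuous_on UNIV u" and bound: "\<And>x. u x \<le> M"
    and d1: "\<And>b x t. b \<in> Basis \<Longrightarrow> ((\<lambda>t. u (x + t *\<^sub>R b)) has_real_derivative u1 b (x + t *\<^sub>R b)) (at t)"
    and d2: "\<And>b x t. b \<in> Basis \<Longrightarrow> ((\<lambda>t. u1 b (x + t *\<^sub>R b)) has_real_derivative u2 b (x + t *\<^sub>R b)) (at t)"
    and eq: "\<And>x. (\<Sum>b\<in>Basis. u2 b x) = u x"
  shows "u x \<le> 0"
proof (rule ccontr)
  assume "\<not> u x \<le> 0"
  then have pos: "u x > 0" by simp
  define G where "G y = (\<Sum>b\<in>Basis. cosh (y \<bullet> b))" for y :: 'a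
  have G: "0 < G y" for y unfolding G_def by (intro sum_pos) auto
  \<comment> \<open>Half the critical value, so that \<open>u - \<delta> G\<close> still equals u x
    / 2 > 0 at \<open>x\<close>.\<close>
  define \<delta> where "\<delta> = u x / (2 * G x)"
  have \<delta>: "\<delta> > 0" "\<delta> * G x < u x" using pos G[of x] by (auto simp: \<delta>_def)
  define h where "h y = u y - \<delta> * G y" for y
  have hx: "h x > 0" using \<delta> by (simp add: h_def)
  have big: "norm y \<le> 2 * M / \<delta>" if "h y > 0" for y
  proof -
    have "\<delta> * G y < M" using that bound[of y] by (simp add: h_def)
    then have "G y < M / \<delta>" using \<delta> by (simp add: field_simps)
    then show ?thesis using norm_le_sum_cosh[of y] by (simp add: G_def)
  qed
  have "continuous_on (cball 0 (2 * M / \<delta>)) h"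
    unfolding h_def G_def cosh_field_def
    by (intro continuous_intros continuous_on_subset[OF cont]) auto
  moreover have "x \<in> cball 0 (2 * M / \<delta>)" using big[OF hx] by simp
  ultimately obtain y where y: "\<And>z. z \<in> cball 0 (2 * M / \<delta>) \<Longrightarrow> h z \<le> h y" "y \<in> cball 0 (2 * M / \<delta>)"
    using continuous_attains_sup[OF compact_cball] by (metis empty_iff)
  have hy: "h y > 0" using y(1)[of x] hx big[OF hx] by simp
  \<comment> \<open>Outside the ball \<open>h\<close> is at most 0 by \<open>big\<close>, so the
    maximum over the ball is global.\<close>
  have max: "h z \<le> h y" for z
    using y(1)[of z] big[of z] hy by (cases "h z > 0") auto
  have "u2 b y - \<delta> * cosh (y \<bullet> b) \<le> 0" if b: "b \<in> Basis" for b
  proof (rule second_derivative_at_max)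
    have G1: "((\<lambda>t. G (y + t *\<^sub>R b)) has_real_derivative sinh (y \<bullet> b + t)) (at t)" for t
    proof -
      have "((\<lambda>t. G (y + t *\<^sub>R b)) has_real_derivative (\<Sum>c\<in>Basis. sinh (y \<bullet> c + t * (b \<bullet> c)) * (b \<bullet> c))) (at t)"
        unfolding G_def inner_add_left inner_scaleR_left
        by (auto intro!: derivative_eq_intros simp: mult_ac)
      moreover have "(\<Sum>c\<in>Basis. sinh (y \<bullet> c + t * (b \<bullet> c)) * (b \<bullet> c)) = (\<Sum>c\<in>Basis. if c = b then sinh (y \<bullet> b + t) else 0)"
        by (intro sum.cong) (auto simp: inner_Basis b)
      ultimately show ?thesis using b by simp
    qed
    show "((\<lambda>t. h (y + t *\<^sub>R b)) has_real_derivative u1 b (y + t *\<^sub>R b) - \<delta> * sinh (y \<bullet> b + t)) (at t)" for t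
      unfolding h_def by (intro DERIV_diff d1 b DERIV_cmult G1)
    have "((\<lambda>t. u1 b (y + t *\<^sub>R b) - \<delta> * sinh (y \<bullet> b + t)) has_real_derivative u2 b (y + 0 *\<^sub>R b) - \<delta> * cosh (y \<bullet> b)) (at 0)"
      by (intro DERIV_diff d2 b DERIV_cmult) (auto intro!: derivative_eq_intros)
    then show "((\<lambda>t. u1 b (y + t *\<^sub>R b) - \<delta> * sinh (y \<bullet> b + t)) has_real_derivative u2 b y - \<delta> * cosh (y \<bullet> b)) (at 0)"
      by simp
    show "h (y + t *\<^sub>R b) \<le> h (y + 0 *\<^sub>R b)" for t using max by simp
  qed
  then have "(\<Sum>b\<in>Basis. u2 b y - \<delta> * cosh (y \<bullet> b)) \<le> 0" by (intro sum_nonpos)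
  then have "h y \<le> 0" by (simp add: h_def G_def sum_subtractf eq sum_distrib_left)
  with hy show False by simp
qed

section \<open>Bounded solutions of \<Delta> y = y obtained by convolution, and the uniqueness
  theorem\<close>

definition test_laplacian :: "('a::euclidean_space \<Rightarrow> complex) \<Rightarrow> 'a \<Rightarrow> complex" where
  "test_laplacian \<phi> x = (\<Sum>b\<in>Basis. partial_deriv b (partial_deriv b \<phi>) x)"

lemma C0_laplacian: "\<phi> \<in> C0_infinity \<Longrightarrow> test_laplacian \<phi> \<in> C0_infinity"
  unfolding test_laplacian_def[abs_def] by (intro C0_sum C0_partial) auto

lemma C0_one_minus_laplacian:
  "\<phi> \<in> C0_infinity \<Longrightarrow> (\<lambda>x. \<phi> x - test_laplacian \<phi> x) \<in> C0_infinity"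
  by (intro C0_diff C0_laplacian)

lemma C0_L2:
  assumes "radon_measure M" "\<phi> \<in> C0_infinity"
  shows "\<phi> \<in> L2_space M"
proof -
  have s: "sets M = sets borel" using assms by (simp add: radon_measure_def)
  have [measurable]: "\<phi> \<in> borel_measurable M" using C0_measurable[OF assms(2) s] .
  obtain C r where C: "\<And>x. cmod (\<phi> x) \<le> C * indicator (cball 0 r) x"
    using C0_bounded_indicator[OF assms(2)] by metis
  have [measurable]: "cball (0::'a) r \<in> sets M" using s by simp
  have "integrable M (\<lambda>x. (cmod (\<phi> x))\<^sup>2)"
  proof (rule Bochner_Integration.integrable_bound)
    show "integrable M (\<lambda>x. C\<^sup>2 * indicator (cball 0 r) x :: real)"
      using assms(1) by (intro integrable_mult_right integrable_real_indicator) (auto simp: radon_measure_def)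
    have "(cmod (\<phi> x))\<^sup>2 \<le> (C * indicator (cball 0 r) x)\<^sup>2" for x
      by (intro power_mono C) auto
    moreover have "(C * indicator (cball 0 r) x)\<^sup>2 = norm (C\<^sup>2 * indicator (cball 0 r) x :: real)" for x :: 'a
      by (simp add: power_mult_distrib indicator_def)
    ultimately show "AE x in M. norm ((cmod (\<phi> x))\<^sup>2) \<le> norm (C\<^sup>2 * indicator (cball 0 r) x :: real)"
      by simp
  qed measurable
  then show ?thesis by (simp add: L2_space_def)
qed

lemma radon_lborel: "radon_measure (lborel :: 'a::euclidean_space measure)"
  unfolding radon_measure_def
proof (intro conjI allI impI)
  fix K :: "'a set" assume "compact K"
  then show "emeasure lborel K < \<infinity>" by (intro emeasure_bounded_finite compact_imp_bounded)
qed simp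

lemma radon_abs_measure:
  assumes "radon_measure mp" "radon_measure mm"
  shows "radon_measure (abs_measure mp mm)"
  unfolding radon_measure_def
proof (intro conjI allI impI)
  fix K :: "'a set" assume K: "compact K"
  then have "emeasure (abs_measure mp mm) K = emeasure mp K + emeasure mm K"
    using assms by (intro emeasure_abs_measure) (auto simp: radon_measure_def compact_imp_closed)
  then show "emeasure (abs_measure mp mm) K < \<infinity>" using assms K by (simp add: radon_measure_def)
qed simp

text \<open>Cauchy-Schwarz and translation invariance of the norm of \<phi>. The bound is essential
  for uniqueness, since \<Delta> y = y has unbounded solutions such as exponentials.\<close>

lemma conv_bounded:
  assumes f: "f \<in> L2_space lborel" and \<phi>: "\<phi> \<in> C0_infinity"
  shows "cmod (conv f \<phi> x) \<le> L2_norm lborel f * L2_norm lborel \<phi>"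
proof -
  let ?g = "\<lambda>z. cnj (\<phi> (z - x))"
  have g: "?g \<in> L2_space lborel" by (intro L2_cnj C0_L2 radon_lborel C0_translate_diff \<phi>)
  have "conv f \<phi> x = L2_inner lborel f ?g" by (simp add: conv_def L2_inner_def)
  then have "cmod (conv f \<phi> x) \<le> L2_norm lborel f * L2_norm lborel ?g"
    using L2.Cauchy_Schwarz[OF f g] by simp
  also have "(\<integral>z. complex_of_real ((cmod (\<phi> (z - x)))\<^sup>2) \<partial>lborel) = (\<integral>z. complex_of_real ((cmod (\<phi> z))\<^sup>2) \<partial>lborel)"
  proof -
    note [measurable] = C0_borel[OF \<phi>]
    show ?thesis by (rule integral_lborel_translate) measurable
  qed
  then have "L2_norm lborel ?g = L2_norm lborel \<phi>"
    unfolding L2_norm_def integral_complex_of_real by simp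
  finally show ?thesis .
qed

text \<open>Differentiating \<open>conv\<close> twice puts both derivatives on \<phi> and cancels
  the signs, so \<open>conv f \<phi>\<close> is reproduced by the Laplacian. The maximum principle
  only bounds real parts from above; it is therefore applied to \<open>c f\<close> for every complex
  \<open>c\<close>.\<close>

lemma conv_eigenfunction_zero:
  assumes f: "f \<in> L2_space lborel" and \<phi>: "\<phi> \<in> C0_infinity"
    and eq: "\<And>x. conv f (\<lambda>y. \<phi> y - test_laplacian \<phi> y) x = 0"
  shows "conv f \<phi> x = 0"
proof -
  note lf = L2_loc_integrable[OF f]
  have lap: "(\<Sum>b\<in>Basis. conv f (partial_deriv b (partial_deriv b \<phi>)) x) = conv f \<phi> x" for x
  proof -
    have "conv f (\<lambda>y. \<phi> y - test_laplacian \<phi> y) x =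
        (\<integral>z. f z * \<phi> (z - x) - (\<Sum>b\<in>Basis. f z * partial_deriv b (partial_deriv b \<phi>) (z - x)) \<partial>lborel)"
      by (simp add: conv_def test_laplacian_def right_diff_distrib sum_distrib_left)
    also have "\<dots> = conv f \<phi> x - (\<Sum>b\<in>Basis. conv f (partial_deriv b (partial_deriv b \<phi>)) x)"
      unfolding conv_def
      by (subst Bochner_Integration.integral_diff)
        (auto intro!: loc_integrable_mult_C0[OF lf] C0_translate_diff C0_partial \<phi> Bochner_Integration.integral_sum)
    finally show ?thesis using eq[of x] by simp
  qed
  have *: "Re (conv g \<phi> x) \<le> 0" if g: "g = f \<or> g = (\<lambda>x. c * f x)" for g c
  proof -
    have gc: "\<exists>c. \<forall>\<psi> x. conv g \<psi> x = c * conv f \<psi> x"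
      using g by (auto simp: conv_def mult.assoc intro: exI[of _ 1] exI[of _ c])
    have gL: "g \<in> L2_space lborel" using g f L2_scale by auto
    note lg = L2_loc_integrable[OF gL]
    show ?thesis
    proof (rule bounded_eigenfunction_nonpos[where ?u1.0 = "\<lambda>b x. - Re (conv g (partial_deriv b \<phi>) x)"
          and ?u2.0 = "\<lambda>b x. Re (conv g (partial_deriv b (partial_deriv b \<phi>)) x)"
          and M = "L2_norm lborel g * L2_norm lborel \<phi>"])
      show "continuous_on UNIV (\<lambda>x. Re (conv g \<phi> x))"
        by (intro continuous_intros continuous_conv lg \<phi>)
      show "Re (conv g \<phi> x) \<le> L2_norm lborel g * L2_norm lborel \<phi>" for x
        using conv_bounded[OF gL \<phi>] complex_Re_le_cmod order_trans by blast
      show "((\<lambda>t. Re (conv g \<phi> (x + t *\<^sub>R b))) has_real_derivative - Re (conv g (partial_deriv b \<phi>) (x + t *\<^sub>R b))) (at t)"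
        if "b \<in> Basis" for b x t by (rule conv_Re_derivative[OF lg \<phi> that])
      show "((\<lambda>t. - Re (conv g (partial_deriv b \<phi>) (x + t *\<^sub>R b))) has_real_derivative Re (conv g (partial_deriv b (partial_deriv b \<phi>)) (x + t *\<^sub>R b))) (at t)"
        if "b \<in> Basis" for b x t
        using DERIV_minus[OF conv_Re_derivative[OF lg C0_partial[OF \<phi> that] that]] by simp
      obtain c where c: "\<And>\<psi> x. conv g \<psi> x = c * conv f \<psi> x" using gc by blast
      show "(\<Sum>b\<in>Basis. Re (conv g (partial_deriv b (partial_deriv b \<phi>)) x)) = Re (conv g \<phi> x)" for x
        unfolding c Re_sum[symmetric] sum_distrib_left[symmetric] lap ..
    qed
  qed
  have "Re (c * conv f \<phi> x) \<le> 0" for c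
    using *[of "\<lambda>x. c * f x" c] by (simp add: conv_def mult.assoc)
  \<comment> \<open>This \<open>c\<close> turns the real part into the squared modulus.\<close>
  from this[of "cnj (conv f \<phi> x)"] show ?thesis
    by (simp add: complex_eq_iff sum_nonneg_eq_0_iff not_le[symmetric] add_nonneg_eq_0_iff order_antisym_conv flip: power2_eq_square)
qed

text \<open>The hypothesis is the weak form of f - \<Delta> f = 0. Tested with translates of \<phi>,
  it says that the convolution with \<phi> - \<Delta> \<phi> vanishes at every point; hence so does
  \<open>conv f \<phi>\<close>, whose value at 0 is the pairing of \<open>f\<close> with
  \<phi>.\<close>

lemma one_minus_laplacian_injective:
  assumes f: "f \<in> L2_space lborel"
    and eq: "\<And>\<phi>. \<phi> \<in> C0_infinity \<Longrightarrow> (\<integral>x. f x * (\<phi> x - test_laplacian \<phi> x) \<partial>lborel) = 0"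
  shows "AE x in lborel. f x = 0"
proof (rule fundamental_lemma[OF L2_loc_integrable[OF f]])
  fix \<phi> :: "'a \<Rightarrow> complex" assume \<phi>: "\<phi> \<in> C0_infinity"
  have "conv f (\<lambda>y. \<phi> y - test_laplacian \<phi> y) x = 0" for x
  proof -
    have "test_laplacian (\<lambda>z. \<phi> (z + - x)) z = test_laplacian \<phi> (z - x)" for z
      unfolding test_laplacian_def
      by (intro sum.cong refl) (simp add: partial_deriv_translate C0_partial \<phi> del: add_uminus_conv_diff, simp)
    then show ?thesis
      using eq[OF C0_translate[OF \<phi>, of "- x"]] by (simp add: conv_def)
  qed
  from conv_eigenfunction_zero[OF f \<phi> this, of 0]
  show "(\<integral>x. f x * \<phi> x \<partial>lborel) = 0" by (simp add: conv_def)
qed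

section \<open>Sesquilinear forms pulled back from \<open>L\<^sup>2\<close>\<close>

definition fun_subspace :: "('x \<Rightarrow> complex) set \<Rightarrow> bool" where
  "fun_subspace V \<longleftrightarrow> (\<lambda>x. 0) \<in> V \<and> (\<forall>f\<in>V. \<forall>g\<in>V. (\<lambda>x. f x + g x) \<in> V) \<and> (\<forall>f\<in>V. \<forall>c. (\<lambda>x. c * f x) \<in> V)"

text \<open>Weak derivatives, the weak Laplacian and the trace are picked by \<open>SOME\<close>
  separately for each function, so linearity is guaranteed only up to null sets.\<close>

definition ae_linear :: "'y measure \<Rightarrow> ('x \<Rightarrow> complex) set \<Rightarrow> (('x \<Rightarrow> complex) \<Rightarrow> ('y \<Rightarrow> complex)) \<Rightarrow> bool" where
  "ae_linear M V D \<longleftrightarrow> (\<forall>f\<in>V. D f \<in> L2_space M) \<and>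
     (\<forall>f\<in>V. \<forall>g\<in>V. AE x in M. D (\<lambda>y. f y + g y) x = D f x + D g x) \<and>
     (\<forall>f\<in>V. \<forall>c. AE x in M. D (\<lambda>y. c * f y) x = c * D f x)"

lemma fun_subspaceD:
  assumes "fun_subspace V"
  shows "(\<lambda>x. 0) \<in> V" "\<And>f g. f \<in> V \<Longrightarrow> g \<in> V \<Longrightarrow> (\<lambda>x. f x + g x) \<in> V"
    "\<And>f c. f \<in> V \<Longrightarrow> (\<lambda>x. c * f x) \<in> V"
  using assms by (auto simp: fun_subspace_def)

lemma fun_subspace_diff: "fun_subspace V \<Longrightarrow> f \<in> V \<Longrightarrow> g \<in> V \<Longrightarrow> (\<lambda>x. f x - g x) \<in> V"
  using fun_subspaceD(2)[of V f "\<lambda>x. (-1) * g x"] fun_subspaceD(3)[of V g "-1"] by simp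

lemma ae_linearD:
  assumes "ae_linear M V D"
  shows "\<And>f. f \<in> V \<Longrightarrow> D f \<in> L2_space M"
    "\<And>f g. f \<in> V \<Longrightarrow> g \<in> V \<Longrightarrow> AE x in M. D (\<lambda>y. f y + g y) x = D f x + D g x"
    "\<And>f c. f \<in> V \<Longrightarrow> AE x in M. D (\<lambda>y. c * f y) x = c * D f x"
  using assms by (auto simp: ae_linear_def)

lemma ae_linear_diff:
  assumes "ae_linear M V D" "fun_subspace V" "f \<in> V" "g \<in> V"
  shows "AE x in M. D (\<lambda>y. f y - g y) x = D f x - D g x"
proof -
  have g: "(\<lambda>y. (-1) * g y) \<in> V" by (rule fun_subspaceD(3)[OF assms(2,4)])
  show ?thesis
    using ae_linearD(2)[OF assms(1,3) g] ae_linearD(3)[OF assms(1,4), of "-1"]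
    by eventually_elim simp
qed

definition sesquilinear :: "('x \<Rightarrow> complex) set \<Rightarrow> (('x \<Rightarrow> complex) \<Rightarrow> ('x \<Rightarrow> complex) \<Rightarrow> complex) \<Rightarrow> bool" where
  "sesquilinear V a \<longleftrightarrow>
     (\<forall>f\<in>V. \<forall>g\<in>V. \<forall>h\<in>V. a (\<lambda>x. f x + g x) h = a f h + a g h \<and> a h (\<lambda>x. f x + g x) = a h f + a h g) \<and>
     (\<forall>f\<in>V. \<forall>h\<in>V. \<forall>c. a (\<lambda>x. c * f x) h = c * a f h \<and> a h (\<lambda>x. c * f x) = cnj c * a h f)"

lemma sesquilinearD:
  assumes "sesquilinear V a" "f \<in> V" "h \<in> V"
  shows "g \<in> V \<Longrightarrow> a (\<lambda>x. f x + g x) h = a f h + a g h"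
    "g \<in> V \<Longrightarrow> a h (\<lambda>x. f x + g x) = a h f + a h g"
    "a (\<lambda>x. c * f x) h = c * a f h" "a h (\<lambda>x. c * f x) = cnj c * a h f"
  using assms by (auto simp: sesquilinear_def)

lemma sesquilinear_diff:
  assumes "sesquilinear V a" "fun_subspace V" "f \<in> V" "g \<in> V" "h \<in> V"
  shows "a (\<lambda>x. f x - g x) h = a f h - a g h" "a h (\<lambda>x. f x - g x) = a h f - a h g"
proof -
  have g: "(\<lambda>x. (-1) * g x) \<in> V" by (rule fun_subspaceD(3)[OF assms(2,4)])
  show "a (\<lambda>x. f x - g x) h = a f h - a g h"
    using sesquilinearD(1)[OF assms(1,3,5) g] sesquilinearD(3)[OF assms(1,4,5), of "-1"] by simp
  show "a h (\<lambda>x. f x - g x) = a h f - a h g"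
    using sesquilinearD(2)[OF assms(1,3,5) g] sesquilinearD(4)[OF assms(1,4,5), of "-1"] by simp
qed

text \<open>L^2 products do not see null sets, so almost everywhere linearity becomes the exact
  sesquilinearity that the abstract theory requires. Two maps \<open>D\<close> and \<open>E\<close>
  are allowed because of the sign operator in the first slot of the trace form.\<close>

lemma sesquilinear_pullback:
  assumes D: "ae_linear M V D" and E: "ae_linear M V E" and V: "fun_subspace V"
  shows "sesquilinear V (\<lambda>f g. L2_inner M (D f) (E g))"
proof -
  have 1: "L2_inner M (D (\<lambda>x. f x + g x)) (E h) = L2_inner M (D f) (E h) + L2_inner M (D g) (E h)"
    if "f \<in> V" "g \<in> V" "h \<in> V" for f g h
  proof -
    note L = ae_linearD(1)[OF D] ae_linearD(1)[OF E] fun_subspaceD(2)[OF V]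
    have "L2_inner M (D (\<lambda>x. f x + g x)) (E h) = L2_inner M (\<lambda>x. D f x + D g x) (E h)"
      by (rule L2_inner_cong) (use that ae_linearD(2)[OF D] in \<open>auto intro!: L L2.add_mem\<close>)
    then show ?thesis using that by (simp add: L2.ip_add L)
  qed
  have 2: "L2_inner M (D h) (E (\<lambda>x. f x + g x)) = L2_inner M (D h) (E f) + L2_inner M (D h) (E g)"
    if "f \<in> V" "g \<in> V" "h \<in> V" for f g h
  proof -
    note L = ae_linearD(1)[OF D] ae_linearD(1)[OF E] fun_subspaceD(2)[OF V]
    have "L2_inner M (D h) (E (\<lambda>x. f x + g x)) = L2_inner M (D h) (\<lambda>x. E f x + E g x)"
      by (rule L2_inner_cong) (use that ae_linearD(2)[OF E] in \<open>auto intro!: L L2.add_mem\<close>)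
    then show ?thesis using that by (simp add: L2.ip_add_right L)
  qed
  have 3: "L2_inner M (D (\<lambda>x. c * f x)) (E h) = c * L2_inner M (D f) (E h)"
    if "f \<in> V" "h \<in> V" for f h c
  proof -
    note L = ae_linearD(1)[OF D] ae_linearD(1)[OF E] fun_subspaceD(3)[OF V]
    have "L2_inner M (D (\<lambda>x. c * f x)) (E h) = L2_inner M (\<lambda>x. c * D f x) (E h)"
      by (rule L2_inner_cong) (use that ae_linearD(3)[OF D] in \<open>auto intro!: L L2.scale_mem\<close>)
    then show ?thesis using that by (simp add: L2.ip_scale L)
  qed
  have 4: "L2_inner M (D h) (E (\<lambda>x. c * f x)) = cnj c * L2_inner M (D h) (E f)"
    if "f \<in> V" "h \<in> V" for f h c
  proof -
    note L = ae_linearD(1)[OF D] ae_linearD(1)[OF E] fun_subspaceD(3)[OF V]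
    have "L2_inner M (D h) (E (\<lambda>x. c * f x)) = L2_inner M (D h) (\<lambda>x. c * E f x)"
      by (rule L2_inner_cong) (use that ae_linearD(3)[OF E] in \<open>auto intro!: L L2.scale_mem\<close>)
    then show ?thesis using that by (simp add: L2.ip_scale_right L)
  qed
  show ?thesis unfolding sesquilinear_def using 1 2 3 4 by blast
qed

lemma sesquilinear_plus:
  assumes "sesquilinear V a" "sesquilinear V b"
  shows "sesquilinear V (\<lambda>f g. a f g + b f g)"
  using assms unfolding sesquilinear_def by (simp add: algebra_simps)

lemma sesquilinear_cmult:
  assumes "sesquilinear V a"
  shows "sesquilinear V (\<lambda>f g. c * a f g)"
  using assms unfolding sesquilinear_def by (simp add: algebra_simps)

lemma sesquilinear_mono: "sesquilinear V a \<Longrightarrow> W \<subseteq> V \<Longrightarrow> sesquilinear W a"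
  unfolding sesquilinear_def by blast

lemma sesquilinear_sum:
  assumes "finite I" "\<And>i. i \<in> I \<Longrightarrow> sesquilinear V (a i)"
  shows "sesquilinear V (\<lambda>f g. \<Sum>i\<in>I. a i f g)"
  using assms(1) assms(2)
proof (induction I rule: finite_induct)
  case empty
  then show ?case by (simp add: sesquilinear_def)
next
  case (insert i I)
  then show ?case by (simp add: sesquilinear_plus)
qed

lemma semi_ipI:
  assumes "fun_subspace V" "sesquilinear V ip"
    "\<And>f g. f \<in> V \<Longrightarrow> g \<in> V \<Longrightarrow> ip g f = cnj (ip f g)" "\<And>f. f \<in> V \<Longrightarrow> 0 \<le> Re (ip f f)"
  shows "semi_ip V ip"
  by unfold_locales
    (assumption | rule fun_subspaceD[OF assms(1)] sesquilinearD[OF assms(2)] assms(3,4))+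

section \<open>Sobolev spaces\<close>

lemma test_pair: "f \<in> L2_space lborel \<Longrightarrow> \<phi> \<in> C0_infinity \<Longrightarrow> (\<integral>x. f x * \<phi> x \<partial>lborel) = L2_inner lborel f (\<lambda>x. cnj (\<phi> x))"
  by (simp add: L2_inner_def)

lemmas C0_L2_lborel = C0_L2[OF radon_lborel]
lemmas L2_C0_integrable = loc_integrable_mult_C0[OF L2_loc_integrable]

lemma weak_partial_unique:
  assumes "g \<in> L2_space lborel" "g' \<in> L2_space lborel" "has_weak_partial b f g" "has_weak_partial b f g'"
  shows "AE x in lborel. g x = g' x"
proof -
  have "AE x in lborel. g x - g' x = 0"
  proof (rule fundamental_lemma)
    show "loc_integrable (\<lambda>x. g x - g' x)" by (intro L2_loc_integrable L2.diff_mem assms)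
    fix \<phi> :: "'a \<Rightarrow> complex" assume \<phi>: "\<phi> \<in> C0_infinity"
    have "(\<integral>x. g x * \<phi> x \<partial>lborel) = (\<integral>x. g' x * \<phi> x \<partial>lborel)"
      using assms(3,4) \<phi> unfolding has_weak_partial_def by (metis minus_equation_iff)
    then show "(\<integral>x. (g x - g' x) * \<phi> x \<partial>lborel) = 0"
      using assms \<phi> by (simp add: left_diff_distrib Bochner_Integration.integral_diff L2_C0_integrable)
  qed
  then show ?thesis by simp
qed

text \<open>The only access to the \<open>SOME\<close> in \<open>weak_partial\<close>: any L^2
  function that passes the test identifies the chosen derivative almost everywhere.\<close>

lemma weak_partial_someI:
  assumes "g \<in> L2_space lborel" "has_weak_partial b f g"
  shows "weak_partial b f \<in> L2_space lborel" "has_weak_partial b f (weak_partial b f)"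
    "AE x in lborel. weak_partial b f x = g x"
proof -
  have "weak_partial b f \<in> L2_space lborel \<and> has_weak_partial b f (weak_partial b f)"
    unfolding weak_partial_def by (rule someI[of _ g]) (use assms in auto)
  then show *: "weak_partial b f \<in> L2_space lborel" "has_weak_partial b f (weak_partial b f)" by auto
  show "AE x in lborel. weak_partial b f x = g x"
    by (rule weak_partial_unique[OF *(1) assms(1) *(2) assms(2)])
qed

lemma H1_weak_partial:
  assumes "f \<in> H1" "b \<in> Basis"
  shows "weak_partial b f \<in> L2_space lborel" "has_weak_partial b f (weak_partial b f)"
  using assms weak_partial_someI unfolding H1_def by blast+

lemma H1_L2: "f \<in> H1 \<Longrightarrow> f \<in> L2_space lborel"
  by (simp add: H1_def)

lemma H1I:
  assumes "f \<in> L2_space lborel" "\<And>b. b \<in> Basis \<Longrightarrow> g b \<in> L2_space lborel" "\<And>b. b \<in> Basis \<Longrightarrow> has_weak_partial b f (g b)"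
  shows "f \<in> H1"
  using assms unfolding H1_def by blast

lemma has_weak_partial_add:
  assumes "f \<in> L2_space lborel" "g \<in> L2_space lborel" "f' \<in> L2_space lborel" "g' \<in> L2_space lborel" "b \<in> Basis"
    and "has_weak_partial b f f'" "has_weak_partial b g g'"
  shows "has_weak_partial b (\<lambda>x. f x + g x) (\<lambda>x. f' x + g' x)"
  using assms unfolding has_weak_partial_def
  by (simp add: distrib_right Bochner_Integration.integral_add L2_C0_integrable C0_partial)

lemma has_weak_partial_scale:
  assumes "has_weak_partial b f f'"
  shows "has_weak_partial b (\<lambda>x. c * f x) (\<lambda>x. c * f' x)"
  using assms unfolding has_weak_partial_def by (simp add: mult.assoc)

lemma has_weak_partial_cong_AE:
  assumes "has_weak_partial b f f'" "f \<in> L2_space lborel" "g \<in> L2_space lborel" "f' \<in> L2_space lborel" "g' \<in> L2_space lborel"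
    and "AE x in lborel. f x = g x" "AE x in lborel. f' x = g' x" "b \<in> Basis"
  shows "has_weak_partial b g g'"
  unfolding has_weak_partial_def
proof
  fix \<phi> :: "'a \<Rightarrow> complex" assume \<phi>: "\<phi> \<in> C0_infinity"
  note [measurable] = C0_borel[OF \<phi>] C0_borel[OF C0_partial[OF \<phi> assms(8)]]
    L2_spaceD(1)[OF assms(2)] L2_spaceD(1)[OF assms(3)] L2_spaceD(1)[OF assms(4)] L2_spaceD(1)[OF assms(5)]
  have "(\<integral>x. g x * partial_deriv b \<phi> x \<partial>lborel) = (\<integral>x. f x * partial_deriv b \<phi> x \<partial>lborel)"
    by (rule integral_cong_AE) (use assms(6) in auto)
  moreover have "(\<integral>x. g' x * \<phi> x \<partial>lborel) = (\<integral>x. f' x * \<phi> x \<partial>lborel)"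
    by (rule integral_cong_AE) (use assms(7) in auto)
  ultimately show "(\<integral>x. g x * partial_deriv b \<phi> x \<partial>lborel) = - (\<integral>x. g' x * \<phi> x \<partial>lborel)"
    using assms(1) \<phi> by (simp add: has_weak_partial_def)
qed

text \<open>The defining identity pairs with fixed test functions, and such pairings are continuous
  in L^2, so the weak derivative is a closed operator. Completeness of H^1 and the regularity
  theorem both depend on this.\<close>

lemma has_weak_partial_limit:
  assumes "\<And>n. s n \<in> L2_space lborel" "\<And>n. t n \<in> L2_space lborel" "f \<in> L2_space lborel" "g \<in> L2_space lborel"
    and "\<And>n. has_weak_partial b (s n) (t n)" "b \<in> Basis"
    and "(\<lambda>n. L2_norm lborel (\<lambda>x. s n x - f x)) \<longlonglongrightarrow> 0" "(\<lambda>n. L2_norm lborel (\<lambda>x. t n x - g x)) \<longlonglongrightarrow> 0"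
  shows "has_weak_partial b f g"
  unfolding has_weak_partial_def
proof
  fix \<phi> :: "'a \<Rightarrow> complex" assume \<phi>: "\<phi> \<in> C0_infinity"
  note \<psi> = C0_partial[OF \<phi> assms(6)]
  have "(\<lambda>n. \<integral>x. s n x * partial_deriv b \<phi> x \<partial>lborel) \<longlonglongrightarrow> (\<integral>x. f x * partial_deriv b \<phi> x \<partial>lborel)"
    unfolding test_pair[OF assms(1) \<psi>] test_pair[OF assms(3) \<psi>]
    by (intro L2.ip_tendsto assms L2_cnj C0_L2_lborel \<psi>)
  moreover have "(\<lambda>n. - (\<integral>x. t n x * \<phi> x \<partial>lborel)) \<longlonglongrightarrow> - (\<integral>x. g x * \<phi> x \<partial>lborel)"
    unfolding test_pair[OF assms(2) \<phi>] test_pair[OF assms(4) \<phi>]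
    by (intro tendsto_minus L2.ip_tendsto assms L2_cnj C0_L2_lborel \<phi>)
  ultimately show "(\<integral>x. f x * partial_deriv b \<phi> x \<partial>lborel) = - (\<integral>x. g x * \<phi> x \<partial>lborel)"
    using assms(5) \<phi> LIMSEQ_unique by (simp add: has_weak_partial_def)
qed

lemma fun_subspace_H1: "fun_subspace H1"
  unfolding fun_subspace_def
proof (intro conjI ballI allI)
  show "(\<lambda>x. 0) \<in> (H1 :: ('a \<Rightarrow> complex) set)"
    by (rule H1I[where g = "\<lambda>b x. 0"]) (auto simp: L2.zero_mem has_weak_partial_def)
  fix f g :: "'a \<Rightarrow> complex" and c assume f: "f \<in> H1"
  show "(\<lambda>x. c * f x) \<in> H1"
    by (rule H1I[OF L2.scale_mem[OF H1_L2[OF f]] L2.scale_mem[OF H1_weak_partial(1)[OF f]]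
          has_weak_partial_scale[OF H1_weak_partial(2)[OF f]]])
  assume g: "g \<in> H1"
  show "(\<lambda>x. f x + g x) \<in> H1"
    by (rule H1I[OF L2.add_mem[OF H1_L2[OF f] H1_L2[OF g]]
          L2.add_mem[OF H1_weak_partial(1)[OF f] H1_weak_partial(1)[OF g]]
          has_weak_partial_add[OF H1_L2[OF f] H1_L2[OF g] H1_weak_partial(1)[OF f] H1_weak_partial(1)[OF g]
            _ H1_weak_partial(2)[OF f] H1_weak_partial(2)[OF g]]])
qed

lemma ae_linear_weak_partial:
  assumes b: "b \<in> Basis"
  shows "ae_linear lborel H1 (weak_partial b)"
  unfolding ae_linear_def
proof (intro conjI ballI allI)
  fix f :: "'a \<Rightarrow> complex" and c assume f: "f \<in> H1"
  note pf = H1_weak_partial[OF f b]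
  show "weak_partial b f \<in> L2_space lborel" by (rule pf)
  show "AE x in lborel. weak_partial b (\<lambda>x. c * f x) x = c * weak_partial b f x"
    by (rule weak_partial_someI(3)) (intro L2.scale_mem pf has_weak_partial_scale)+
  fix g :: "'a \<Rightarrow> complex" assume g: "g \<in> H1"
  note pg = H1_weak_partial[OF g b]
  show "AE x in lborel. weak_partial b (\<lambda>x. f x + g x) x = weak_partial b f x + weak_partial b g x"
    by (rule weak_partial_someI(3)) (intro L2.add_mem pf pg has_weak_partial_add H1_L2 f g b)+
qed

lemma ae_linear_id: "ae_linear lborel H1 (\<lambda>f. f)"
  by (simp add: ae_linear_def H1_L2)

lemma C0_has_weak_partial: "f \<in> C0_infinity \<Longrightarrow> b \<in> Basis \<Longrightarrow> has_weak_partial b f (partial_deriv b f)"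
  unfolding has_weak_partial_def using integration_by_parts by blast

lemma C0_H1: "f \<in> C0_infinity \<Longrightarrow> f \<in> H1"
  by (rule H1I[where g = "\<lambda>b. partial_deriv b f"]) (auto intro: C0_L2_lborel C0_partial C0_has_weak_partial)

lemma C0_weak_partial:
  "f \<in> C0_infinity \<Longrightarrow> b \<in> Basis \<Longrightarrow> AE x in lborel. weak_partial b f x = partial_deriv b f x"
  by (rule weak_partial_someI(3)) (auto intro: C0_L2_lborel C0_partial C0_has_weak_partial)

section \<open>The Hilbert space H^1 and density of test functions\<close>

definition H1_ip :: "('a::euclidean_space \<Rightarrow> complex) \<Rightarrow> ('a \<Rightarrow> complex) \<Rightarrow> complex" where
  "H1_ip f g = L2_inner lborel f g + (\<Sum>b\<in>Basis. L2_inner lborel (weak_partial b f) (weak_partial b g))"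

lemma sesquilinear_H1_ip: "sesquilinear H1 H1_ip"
  unfolding H1_ip_def[abs_def]
  by (intro sesquilinear_plus sesquilinear_sum finite_Basis
      sesquilinear_pullback[OF ae_linear_id ae_linear_id fun_subspace_H1]
      sesquilinear_pullback[OF ae_linear_weak_partial ae_linear_weak_partial fun_subspace_H1])

lemma semi_ip_H1: "semi_ip H1 H1_ip"
proof (rule semi_ipI[OF fun_subspace_H1 sesquilinear_H1_ip])
  fix f g :: "'a \<Rightarrow> complex" assume fg: "f \<in> H1" "g \<in> H1"
  have "L2_inner lborel (weak_partial b g) (weak_partial b f) = cnj (L2_inner lborel (weak_partial b f) (weak_partial b g))"
    if "b \<in> Basis" for b using that fg by (intro L2.ip_cnj H1_weak_partial)
  then show "H1_ip g f = cnj (H1_ip f g)"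
    unfolding H1_ip_def using L2.ip_cnj[OF H1_L2[OF fg(1)] H1_L2[OF fg(2)]] by simp
next
  fix f :: "'a \<Rightarrow> complex" assume f: "f \<in> H1"
  then show "0 \<le> Re (H1_ip f f)"
    unfolding H1_ip_def by (auto intro!: add_nonneg_nonneg sum_nonneg L2.ip_nonneg intro: H1_L2 H1_weak_partial)
qed

lemma Re_L2_inner_self: "f \<in> L2_space M \<Longrightarrow> Re (L2_inner M f f) = (L2_norm M f)\<^sup>2"
  by (simp add: L2.N_sq)

lemma H1_ip_self:
  "f \<in> H1 \<Longrightarrow> Re (H1_ip f f) = (L2_norm lborel f)\<^sup>2 + (\<Sum>b\<in>Basis. (L2_norm lborel (weak_partial b f))\<^sup>2)"
  by (simp add: H1_ip_def Re_L2_inner_self H1_L2 H1_weak_partial)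

interpretation H1: semi_ip H1 H1_ip by (rule semi_ip_H1)

lemma Re_H1_ip_commute: "f \<in> H1 \<Longrightarrow> g \<in> H1 \<Longrightarrow> Re (H1_ip f g) = Re (H1_ip g f)"
  using H1.ip_cnj[of f g] by simp

lemma H1_N_sq: "f \<in> H1 \<Longrightarrow> (H1.N f)\<^sup>2 = (L2_norm lborel f)\<^sup>2 + (\<Sum>b\<in>Basis. (L2_norm lborel (weak_partial b f))\<^sup>2)"
  by (simp add: H1.N_sq H1_ip_self)

lemma H1_N_eq: "f \<in> H1 \<Longrightarrow> H1.N f = H1_norm f"
  by (simp add: H1.N_def H1_norm_def H1_ip_self)

lemma L2_norm_le_H1:
  assumes "f \<in> H1"
  shows "L2_norm lborel f \<le> H1.N f"
proof (rule power2_le_imp_le)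
  show "(L2_norm lborel f)\<^sup>2 \<le> (H1.N f)\<^sup>2"
    using assms by (simp add: H1_N_sq sum_nonneg)
qed (rule H1.N_nonneg[OF assms])

lemma L2_norm_partial_le_H1:
  assumes "f \<in> H1" "b \<in> Basis"
  shows "L2_norm lborel (weak_partial b f) \<le> H1.N f"
proof (rule power2_le_imp_le)
  have "(L2_norm lborel (weak_partial b f))\<^sup>2 \<le> (\<Sum>b\<in>Basis. (L2_norm lborel (weak_partial b f))\<^sup>2)"
    using assms(2) by (intro member_le_sum) auto
  then show "(L2_norm lborel (weak_partial b f))\<^sup>2 \<le> (H1.N f)\<^sup>2"
    using zero_le_power2[of "L2_norm lborel f"] unfolding H1_N_sq[OF assms(1)] by linarith
qed (rule H1.N_nonneg[OF assms(1)])

lemma L2_norm_partial_diff: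
  assumes "f \<in> H1" "g \<in> H1" "b \<in> Basis"
  shows "L2_norm lborel (\<lambda>x. weak_partial b f x - weak_partial b g x) = L2_norm lborel (weak_partial b (\<lambda>x. f x - g x))"
proof (rule L2_norm_cong)
  show "AE x in lborel. weak_partial b f x - weak_partial b g x = weak_partial b (\<lambda>x. f x - g x) x"
    using ae_linear_diff[OF ae_linear_weak_partial[OF assms(3)] fun_subspace_H1 assms(1,2)]
    by eventually_elim simp
qed (intro L2.diff_mem H1_weak_partial H1.diff_mem assms)+

lemma H1_tendstoI:
  assumes s: "\<And>n. s n \<in> H1" and f: "f \<in> H1"
    and "(\<lambda>n. L2_norm lborel (\<lambda>x. s n x - f x)) \<longlonglongrightarrow> 0"
    and "\<And>b. b \<in> Basis \<Longrightarrow> (\<lambda>n. L2_norm lborel (\<lambda>x. weak_partial b (s n) x - weak_partial b f x)) \<longlonglongrightarrow> 0"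
  shows "(\<lambda>n. H1.N (\<lambda>x. s n x - f x)) \<longlonglongrightarrow> 0"
proof -
  have "(\<lambda>n. sqrt ((L2_norm lborel (\<lambda>x. s n x - f x))\<^sup>2 +
      (\<Sum>b\<in>Basis. (L2_norm lborel (\<lambda>x. weak_partial b (s n) x - weak_partial b f x))\<^sup>2))) \<longlonglongrightarrow> sqrt (0\<^sup>2 + (\<Sum>b\<in>(Basis::'a set). 0\<^sup>2))"
    by (intro tendsto_intros assms)
  also have "(\<lambda>n. sqrt ((L2_norm lborel (\<lambda>x. s n x - f x))\<^sup>2 +
      (\<Sum>b\<in>Basis. (L2_norm lborel (\<lambda>x. weak_partial b (s n) x - weak_partial b f x))\<^sup>2))) = (\<lambda>n. H1.N (\<lambda>x. s n x - f x))"
    by (simp add: H1.N_def H1_ip_self H1.diff_mem s f L2_norm_partial_diff)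
  finally show ?thesis by simp
qed

lemma H1_cauchy_L2:
  assumes "H1.cauchy s" "\<And>n. s n \<in> H1"
  shows "L2.cauchy lborel s"
proof (rule H1.cauchy_mono[OF semi_ip_L2 assms(1), of 1], unfold L2_norm_eq)
  show "L2_norm lborel (\<lambda>x. s m x - s n x) \<le> 1 * H1.N (\<lambda>x. s m x - s n x)" for m n
    using L2_norm_le_H1[OF H1.diff_mem[OF assms(2) assms(2)], of m n] by simp
qed simp

lemma H1_cauchy_partial:
  assumes "H1.cauchy s" "\<And>n. s n \<in> H1" "b \<in> Basis"
  shows "L2.cauchy lborel (\<lambda>n. weak_partial b (s n))"
proof (rule H1.cauchy_mono[OF semi_ip_L2 assms(1), of 1], unfold L2_norm_eq)
  show "L2_norm lborel (\<lambda>x. weak_partial b (s m) x - weak_partial b (s n) x) \<le> 1 * H1.N (\<lambda>x. s m x - s n x)" for m n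
    using L2_norm_partial_le_H1[OF H1.diff_mem[OF assms(2) assms(2)] assms(3), of m n]
    by (simp add: L2_norm_partial_diff assms)
qed simp

text \<open>The functions and each of their weak derivatives converge separately in L^2; closedness
  of weak derivatives ties the limits together.\<close>

interpretation H1: semi_hilbert H1 H1_ip
proof
  fix s :: "nat \<Rightarrow> 'a \<Rightarrow> complex" assume s: "\<And>n. s n \<in> H1" and c: "H1.cauchy s"
  obtain f where f: "f \<in> L2_space lborel" "(\<lambda>n. L2_norm lborel (\<lambda>x. s n x - f x)) \<longlonglongrightarrow> 0"
    using L2.complete[OF H1_L2[OF s] H1_cauchy_L2[OF c s]] by blast
  have "\<forall>b\<in>Basis. \<exists>g\<in>L2_space lborel. (\<lambda>n. L2_norm lborel (\<lambda>x. weak_partial b (s n) x - g x)) \<longlonglongrightarrow> 0"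
    using L2.complete[OF H1_weak_partial(1)[OF s] H1_cauchy_partial[OF c s]] by blast
  then obtain g where g: "\<And>b. b \<in> Basis \<Longrightarrow> g b \<in> L2_space lborel"
    "\<And>b. b \<in> Basis \<Longrightarrow> (\<lambda>n. L2_norm lborel (\<lambda>x. weak_partial b (s n) x - g b x)) \<longlonglongrightarrow> 0" by metis
  have w: "has_weak_partial b f (g b)" if "b \<in> Basis" for b
    by (rule has_weak_partial_limit[OF H1_L2[OF s] H1_weak_partial(1)[OF s that] f(1) g(1)[OF that]
          H1_weak_partial(2)[OF s that] that f(2) g(2)[OF that]])
  have fH: "f \<in> H1" by (rule H1I[OF f(1) g(1) w])
  have "(\<lambda>n. L2_norm lborel (\<lambda>x. weak_partial b (s n) x - weak_partial b f x)) \<longlonglongrightarrow> 0" if b: "b \<in> Basis" for b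
  proof -
    have "L2_norm lborel (\<lambda>x. weak_partial b (s n) x - weak_partial b f x) = L2_norm lborel (\<lambda>x. weak_partial b (s n) x - g b x)" for n
      by (rule L2_norm_cong)
        (use weak_partial_someI(3)[OF g(1)[OF b] w[OF b]] in
          \<open>auto intro!: L2.diff_mem H1_weak_partial s b g(1) fH\<close>)
    then show ?thesis using g(2)[OF b] by simp
  qed
  then have "(\<lambda>n. H1.N (\<lambda>x. s n x - f x)) \<longlonglongrightarrow> 0" by (intro H1_tendstoI s fH f(2))
  with fH show "\<exists>p\<in>H1. (\<lambda>n. H1.N (\<lambda>x. s n x - p x)) \<longlonglongrightarrow> 0" by blast
qed

lemma H1_pair_test:
  assumes f: "f \<in> H1" and \<phi>: "\<phi> \<in> C0_infinity"
  shows "(\<integral>x. f x * (\<phi> x - test_laplacian \<phi> x) \<partial>lborel)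
    = (\<integral>x. f x * \<phi> x \<partial>lborel) + (\<Sum>b\<in>Basis. \<integral>x. weak_partial b f x * partial_deriv b \<phi> x \<partial>lborel)"
proof -
  note fL = H1_L2[OF f]
  have "(\<integral>x. f x * (\<phi> x - test_laplacian \<phi> x) \<partial>lborel)
      = (\<integral>x. f x * \<phi> x - (\<Sum>b\<in>Basis. f x * partial_deriv b (partial_deriv b \<phi>) x) \<partial>lborel)"
    by (simp add: test_laplacian_def right_diff_distrib sum_distrib_left)
  also have "\<dots> = (\<integral>x. f x * \<phi> x \<partial>lborel) - (\<Sum>b\<in>Basis. \<integral>x. f x * partial_deriv b (partial_deriv b \<phi>) x \<partial>lborel)"
    by (subst Bochner_Integration.integral_diff)
      (auto intro!: L2_C0_integrable[OF fL] C0_partial \<phi> Bochner_Integration.integral_sum)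
  also have "(\<Sum>b\<in>Basis. \<integral>x. f x * partial_deriv b (partial_deriv b \<phi>) x \<partial>lborel)
      = (\<Sum>b\<in>Basis. - (\<integral>x. weak_partial b f x * partial_deriv b \<phi> x \<partial>lborel))"
    using H1_weak_partial(2)[OF f] C0_partial[OF \<phi>] unfolding has_weak_partial_def
    by (intro sum.cong) auto
  finally show ?thesis by (simp add: sum_negf)
qed

text \<open>Translates orthogonality to test functions in H^1 into the weak equation f - \<Delta> f
  = 0 in L^2. The conjugate appears since weak derivatives are defined by bilinear pairings while
  the product is sesquilinear.\<close>

lemma H1_ip_C0:
  assumes f: "f \<in> H1" and \<phi>: "\<phi> \<in> C0_infinity"
  shows "H1_ip f (\<lambda>x. cnj (\<phi> x)) = (\<integral>x. f x * (\<phi> x - test_laplacian \<phi> x) \<partial>lborel)"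
proof -
  have "L2_inner lborel (weak_partial b f) (weak_partial b (\<lambda>x. cnj (\<phi> x))) = (\<integral>x. weak_partial b f x * partial_deriv b \<phi> x \<partial>lborel)"
    if b: "b \<in> Basis" for b
  proof -
    have "L2_inner lborel (weak_partial b f) (weak_partial b (\<lambda>x. cnj (\<phi> x)))
        = L2_inner lborel (weak_partial b f) (partial_deriv b (\<lambda>x. cnj (\<phi> x)))"
      by (rule L2_inner_cong)
        (use C0_weak_partial[OF C0_cnj[OF \<phi>] b] H1_weak_partial(1)[OF f b]
            H1_weak_partial(1)[OF C0_H1[OF C0_cnj[OF \<phi>]] b] C0_L2_lborel[OF C0_partial[OF C0_cnj[OF \<phi>] b]] in auto)
    then show ?thesis by (simp add: partial_deriv_cnj \<phi> L2_inner_def)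
  qed
  then show ?thesis
    unfolding H1_ip_def H1_pair_test[OF assms] by (simp add: L2_inner_def)
qed

text \<open>Orthogonality to all test functions puts \<open>w\<close> in the scope of
  \<open>one_minus_laplacian_injective\<close>, hence \<open>w\<close> is 0 almost everywhere. The
  H^1 norm also contains the chosen weak derivatives; they vanish because 0 is a weak derivative of
  a null function.\<close>

lemma C0_dense_H1:
  assumes "f \<in> H1"
  obtains s where "\<And>n. s n \<in> C0_infinity" "(\<lambda>n. H1.N (\<lambda>x. s n x - f x)) \<longlonglongrightarrow> 0"
proof -
  have "\<exists>s. (\<forall>n. s n \<in> C0_infinity) \<and> (\<lambda>n. H1.N (\<lambda>x. s n x - f x)) \<longlonglongrightarrow> 0"
  proof (rule H1.dense_if_orthogonal_trivial[OF _ _ _ _ _ assms])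
    fix w :: "'a \<Rightarrow> complex" assume w: "w \<in> H1" and orth: "\<And>s. s \<in> C0_infinity \<Longrightarrow> H1_ip w s = 0"
    have w0: "AE x in lborel. w x = 0"
      by (rule one_minus_laplacian_injective[OF H1_L2[OF w]])
        (use H1_ip_C0[OF w] orth C0_cnj in metis)
    have "AE x in lborel. weak_partial b w x = 0" if b: "b \<in> Basis" for b
    proof (rule weak_partial_someI(3)[OF L2.zero_mem])
      show "has_weak_partial b w (\<lambda>x. 0)"
        by (rule has_weak_partial_cong_AE[of b "\<lambda>x. 0" "\<lambda>x. 0"])
          (use w0 b w in \<open>auto simp: has_weak_partial_def L2.zero_mem H1_L2\<close>)
    qed
    then show "H1.N w = 0"
      using w0 w by (simp add: H1.N_def H1_ip_self L2_norm_eq_0_iff[THEN iffD2] H1_L2 H1_weak_partial)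
  qed (auto simp: C0_H1 C0_zero C0_add C0_scale)
  then show thesis using that by blast
qed

section \<open>Elliptic regularity\<close>

lemma test_laplacian_linear:
  assumes "\<phi> \<in> C0_infinity"
  shows "\<psi> \<in> C0_infinity \<Longrightarrow> test_laplacian (\<lambda>x. \<phi> x + \<psi> x) = (\<lambda>x. test_laplacian \<phi> x + test_laplacian \<psi> x)"
    "test_laplacian (\<lambda>x. c * \<phi> x) = (\<lambda>x. c * test_laplacian \<phi> x)"
    "test_laplacian (\<lambda>x. cnj (\<phi> x)) = (\<lambda>x. cnj (test_laplacian \<phi> x))"
  using assms
  by (auto simp: test_laplacian_def fun_eq_iff partial_deriv_add partial_deriv_scale partial_deriv_cnj
      C0_partial sum.distrib sum_distrib_left)

lemma test_laplacian_diff: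
  "\<phi> \<in> C0_infinity \<Longrightarrow> \<psi> \<in> C0_infinity \<Longrightarrow>
    test_laplacian (\<lambda>x. \<phi> x - \<psi> x) = (\<lambda>x. test_laplacian \<phi> x - test_laplacian \<psi> x)"
  by (simp add: test_laplacian_def fun_eq_iff partial_deriv_diff C0_partial sum_subtractf)

text \<open>The orthogonal complement of the range consists of weak solutions of w - \<Delta> w = 0,
  which vanish. The Laplacian commutes with conjugation, so sesquilinear and bilinear orthogonality
  amount to the same.\<close>

lemma dense_one_minus_laplacian:
  assumes "g \<in> L2_space (lborel :: 'a::euclidean_space measure)"
  obtains s where "\<And>n. s n \<in> C0_infinity"
    "(\<lambda>n. L2_norm lborel (\<lambda>x. s n x - test_laplacian (s n) x - g x)) \<longlonglongrightarrow> 0"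
proof -
  let ?L = "\<lambda>(\<phi> :: 'a \<Rightarrow> complex) x. \<phi> x - test_laplacian \<phi> x"
  have "\<exists>s. (\<forall>n. s n \<in> ?L ` C0_infinity) \<and> (\<lambda>n. L2_norm lborel (\<lambda>x. s n x - g x)) \<longlonglongrightarrow> 0"
  proof (rule L2.dense_if_orthogonal_trivial[OF _ _ _ _ _ assms])
    show "?L ` C0_infinity \<subseteq> L2_space lborel"
      by (auto intro!: C0_L2_lborel C0_one_minus_laplacian)
    show "(\<lambda>x. 0) \<in> ?L ` C0_infinity"
    proof (rule image_eqI[OF _ C0_zero])
      show "(\<lambda>x. 0) = ?L (\<lambda>x. 0)" using test_laplacian_linear(2)[OF C0_zero, of 0] by (simp add: fun_eq_iff)
    qed
    show "(\<lambda>x. f x + h x) \<in> ?L ` C0_infinity" if "f \<in> ?L ` C0_infinity" "h \<in> ?L ` C0_infinity" for f h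
    proof -
      obtain \<phi> \<psi> where "\<phi> \<in> C0_infinity" "f = ?L \<phi>" "\<psi> \<in> C0_infinity" "h = ?L \<psi>" using \<open>f \<in> _\<close> \<open>h \<in> _\<close> by blast
      then show ?thesis
        by (intro image_eqI[of _ _ "\<lambda>x. \<phi> x + \<psi> x"]) (auto simp: test_laplacian_linear C0_add)
    qed
    show "(\<lambda>x. c * f x) \<in> ?L ` C0_infinity" if "f \<in> ?L ` C0_infinity" for f c
    proof -
      obtain \<phi> where "\<phi> \<in> C0_infinity" "f = ?L \<phi>" using \<open>f \<in> _\<close> by blast
      then show ?thesis
        by (intro image_eqI[of _ _ "\<lambda>x. c * \<phi> x"]) (auto simp: test_laplacian_linear C0_scale right_diff_distrib)
    qed
    fix w :: "'a \<Rightarrow> complex" assume w: "w \<in> L2_space lborel" and orth: "\<And>s. s \<in> ?L ` C0_infinity \<Longrightarrow> L2_inner lborel w s = 0"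
    have "AE x in lborel. w x = 0"
    proof (rule one_minus_laplacian_injective[OF w])
      fix \<phi> :: "'a \<Rightarrow> complex" assume \<phi>: "\<phi> \<in> C0_infinity"
      have "L2_inner lborel w (?L (\<lambda>x. cnj (\<phi> x))) = 0" by (rule orth, rule image_eqI[OF refl C0_cnj[OF \<phi>]])
      then show "(\<integral>x. w x * (\<phi> x - test_laplacian \<phi> x) \<partial>lborel) = 0"
        by (simp add: L2_inner_def test_laplacian_linear \<phi>)
    qed
    then show "L2_norm lborel w = 0" by (simp add: L2_norm_eq_0_iff w)
  qed
  then obtain s where s: "\<And>n. s n \<in> ?L ` C0_infinity" "(\<lambda>n. L2_norm lborel (\<lambda>x. s n x - g x)) \<longlonglongrightarrow> 0" by blast
  then have "\<forall>n. \<exists>\<phi>. \<phi> \<in> C0_infinity \<and> s n = ?L \<phi>" by blast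
  then obtain \<phi> where "\<And>n. \<phi> n \<in> C0_infinity" "\<And>n. s n = ?L (\<phi> n)" by metis
  with s(2) that show thesis by auto
qed

lemma L2_inner_partial:
  assumes "f \<in> C0_infinity" "g \<in> C0_infinity" "b \<in> Basis"
  shows "L2_inner lborel f (partial_deriv b g) = - L2_inner lborel (partial_deriv b f) g"
  using integration_by_parts[OF assms(1) C0_cnj[OF assms(2)] assms(3)]
  by (simp add: L2_inner_def partial_deriv_cnj assms)

text \<open>Expanding the square and integrating by parts gives, in L^2 norms, R^2 = |\<phi>|^2 + 2
  |grad \<phi>|^2 + the sum of all |d_c d_b \<phi>|^2, with only nonnegative terms. The last sum is
  |\<Delta> \<phi>|^2: in the product of d_b d_b \<phi> with d_c d_c \<phi>, one derivative of each
  kind is moved across.\<close>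

lemma one_minus_laplacian_bound:
  assumes \<phi>: "\<phi> \<in> C0_infinity" and b: "b \<in> Basis" and c: "c \<in> Basis"
  defines "R \<equiv> L2_norm lborel (\<lambda>x. \<phi> x - test_laplacian \<phi> x)"
  shows "L2_norm lborel \<phi> \<le> R" "L2_norm lborel (partial_deriv b \<phi>) \<le> R"
    "L2_norm lborel (partial_deriv c (partial_deriv b \<phi>)) \<le> R"
proof -
  let ?S1 = "\<Sum>b\<in>Basis. (L2_norm lborel (partial_deriv b \<phi>))\<^sup>2"
  let ?S2 = "\<Sum>b\<in>Basis. \<Sum>c\<in>Basis. (L2_norm lborel (partial_deriv c (partial_deriv b \<phi>)))\<^sup>2"
  note L = C0_L2_lborel
  have lapsum: "test_laplacian \<phi> = (\<lambda>x. \<Sum>b\<in>Basis. partial_deriv b (partial_deriv b \<phi>) x)"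
    by (simp add: test_laplacian_def fun_eq_iff)
  have inner_lap: "L2_inner lborel (test_laplacian \<phi>) h = (\<Sum>b\<in>Basis. L2_inner lborel (partial_deriv b (partial_deriv b \<phi>)) h)"
    if "h \<in> C0_infinity" for h
    unfolding lapsum using L2_inner_sum_left[of Basis "\<lambda>b. partial_deriv b (partial_deriv b \<phi>)" lborel h]
    by (simp add: L C0_partial \<phi> that)
  have "Re (L2_inner lborel (test_laplacian \<phi>) \<phi>) = - ?S1"
  proof -
    have "Re (L2_inner lborel (partial_deriv b (partial_deriv b \<phi>)) \<phi>) = - (L2_norm lborel (partial_deriv b \<phi>))\<^sup>2"
      if b: "b \<in> Basis" for b
      using L2_inner_partial[OF C0_partial[OF \<phi> b] \<phi> b] Re_L2_inner_self[OF L[OF C0_partial[OF \<phi> b]]] by simp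
    then show ?thesis by (simp add: inner_lap[OF \<phi>] sum_negf)
  qed
  moreover have "Re (L2_inner lborel \<phi> (test_laplacian \<phi>)) = Re (L2_inner lborel (test_laplacian \<phi>) \<phi>)"
    using L2.ip_cnj[OF L[OF \<phi>] L[OF C0_laplacian[OF \<phi>]]] by simp
  moreover have "(L2_norm lborel (test_laplacian \<phi>))\<^sup>2 = ?S2"
  proof -
    have *: "L2_inner lborel (partial_deriv b (partial_deriv b \<phi>)) (partial_deriv c (partial_deriv c \<phi>))
        = L2_inner lborel (partial_deriv c (partial_deriv b \<phi>)) (partial_deriv c (partial_deriv b \<phi>))"
      if b: "b \<in> Basis" and c: "c \<in> Basis" for b c
    proof -
      have "L2_inner lborel (partial_deriv b (partial_deriv b \<phi>)) (partial_deriv c (partial_deriv c \<phi>))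
          = - L2_inner lborel (partial_deriv b \<phi>) (partial_deriv b (partial_deriv c (partial_deriv c \<phi>)))"
        by (subst L2_inner_partial) (auto intro!: C0_partial \<phi> b c)
      also have "partial_deriv b (partial_deriv c (partial_deriv c \<phi>)) = partial_deriv c (partial_deriv c (partial_deriv b \<phi>))"
        using partial_deriv_commute[OF C0_partial[OF \<phi> c] c b] partial_deriv_commute[OF \<phi> c b] by simp
      also have "- L2_inner lborel (partial_deriv b \<phi>) \<dots>
          = L2_inner lborel (partial_deriv c (partial_deriv b \<phi>)) (partial_deriv c (partial_deriv b \<phi>))"
        by (subst L2_inner_partial) (auto intro!: C0_partial \<phi> b c)
      finally show ?thesis .
    qed
    have "L2_inner lborel (partial_deriv b (partial_deriv b \<phi>)) (test_laplacian \<phi>)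
        = (\<Sum>c\<in>Basis. L2_inner lborel (partial_deriv b (partial_deriv b \<phi>)) (partial_deriv c (partial_deriv c \<phi>)))"
      if b: "b \<in> Basis" for b
    proof -
      have "cnj (L2_inner lborel (test_laplacian \<phi>) (partial_deriv b (partial_deriv b \<phi>)))
        = (\<Sum>c\<in>Basis. cnj (L2_inner lborel (partial_deriv c (partial_deriv c \<phi>)) (partial_deriv b (partial_deriv b \<phi>))))"
        by (simp add: inner_lap C0_partial \<phi> b)
      moreover have "L2_inner lborel f g = cnj (L2_inner lborel g f)" if "f \<in> C0_infinity" "g \<in> C0_infinity" for f g :: "'a \<Rightarrow> complex"
        using that by (intro L2.ip_cnj L)
      ultimately show ?thesis using \<phi> b C0_partial C0_laplacian by (metis (no_types, lifting) sum.cong)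
    qed
    then have "L2_inner lborel (test_laplacian \<phi>) (test_laplacian \<phi>)
        = (\<Sum>b\<in>Basis. \<Sum>c\<in>Basis. L2_inner lborel (partial_deriv c (partial_deriv b \<phi>)) (partial_deriv c (partial_deriv b \<phi>)))"
      by (simp add: inner_lap[OF C0_laplacian[OF \<phi>]]) (intro sum.cong refl *, assumption+)
    then have "Re (L2_inner lborel (test_laplacian \<phi>) (test_laplacian \<phi>)) = ?S2"
      by (simp add: Re_L2_inner_self L C0_partial \<phi>)
    then show ?thesis by (simp add: Re_L2_inner_self L C0_laplacian \<phi>)
  qed
  ultimately have R: "R\<^sup>2 = (L2_norm lborel \<phi>)\<^sup>2 + 2 * ?S1 + ?S2"
    unfolding R_def by (simp add: L2.N_diff_sq L \<phi> C0_laplacian)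
  have nn: "0 \<le> ?S1" "0 \<le> ?S2" by (auto intro!: sum_nonneg)
  have R0: "0 \<le> R" unfolding R_def by (intro L2.N_nonneg L C0_one_minus_laplacian \<phi>)
  have 1: "(L2_norm lborel (partial_deriv b \<phi>))\<^sup>2 \<le> ?S1" by (rule member_le_sum) (use b in auto)
  have "(L2_norm lborel (partial_deriv c (partial_deriv b \<phi>)))\<^sup>2 \<le> (\<Sum>c\<in>Basis. (L2_norm lborel (partial_deriv c (partial_deriv b \<phi>)))\<^sup>2)"
    by (rule member_le_sum[of c]) (use c in auto)
  also have "\<dots> \<le> ?S2" by (rule member_le_sum[of b]) (use b in \<open>auto intro!: sum_nonneg\<close>)
  finally have 2: "(L2_norm lborel (partial_deriv c (partial_deriv b \<phi>)))\<^sup>2 \<le> ?S2" .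
  have "(L2_norm lborel \<phi>)\<^sup>2 \<le> R\<^sup>2" "(L2_norm lborel (partial_deriv b \<phi>))\<^sup>2 \<le> R\<^sup>2"
    "(L2_norm lborel (partial_deriv c (partial_deriv b \<phi>)))\<^sup>2 \<le> R\<^sup>2"
    using R nn 1 2 zero_le_power2[of "L2_norm lborel \<phi>"] by linarith+
  then show "L2_norm lborel \<phi> \<le> R" "L2_norm lborel (partial_deriv b \<phi>) \<le> R"
    "L2_norm lborel (partial_deriv c (partial_deriv b \<phi>)) \<le> R"
    using R0 power2_le_imp_le by blast+
qed

text \<open>\<open>H2\<close> asks that the representative selected by \<open>weak_partial\<close>
  lie in H^1. This permits any function equal to it almost everywhere to vouch for that, and it also
  governs nested weak derivatives.\<close>

lemma H1_cong_AE:
  assumes "f \<in> H1" "g \<in> L2_space lborel" "AE x in lborel. f x = g x"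
  shows "g \<in> H1" "b \<in> Basis \<Longrightarrow> AE x in lborel. weak_partial b f x = weak_partial b g x"
proof -
  have w: "has_weak_partial b g (weak_partial b f)" if b: "b \<in> Basis" for b
    by (rule has_weak_partial_cong_AE[OF H1_weak_partial(2)[OF assms(1) b] H1_L2[OF assms(1)] assms(2)
          H1_weak_partial(1)[OF assms(1) b] H1_weak_partial(1)[OF assms(1) b] assms(3) _ b]) simp
  show "g \<in> H1" by (rule H1I[OF assms(2) H1_weak_partial(1)[OF assms(1)] w])
  show "AE x in lborel. weak_partial b f x = weak_partial b g x" if b: "b \<in> Basis"
    using weak_partial_someI(3)[OF H1_weak_partial(1)[OF assms(1) b] w[OF b]] by eventually_elim simp
qed

lemma H2_H1: "f \<in> H2 \<Longrightarrow> f \<in> H1"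
  by (simp add: H2_def)

lemma H2_weak_partial: "f \<in> H2 \<Longrightarrow> b \<in> Basis \<Longrightarrow> weak_partial b f \<in> H1"
  by (simp add: H2_def)

lemma weak_laplacian_L2: "f \<in> H2 \<Longrightarrow> weak_laplacian f \<in> L2_space lborel"
  using L2_inner_sum_left[OF finite_Basis, of "\<lambda>b. weak_partial b (weak_partial b f)", OF _ L2.zero_mem]
  unfolding weak_laplacian_def by (simp add: H1_weak_partial(1) H2_weak_partial)

lemma integral_sum_L2_C0:
  assumes "\<And>b. b \<in> Basis \<Longrightarrow> g b \<in> L2_space lborel" "\<phi> \<in> C0_infinity"
  shows "(\<integral>x. (\<Sum>b\<in>Basis. g b x) * \<phi> x \<partial>lborel) = (\<Sum>b\<in>Basis. \<integral>x. g b x * \<phi> x \<partial>lborel)"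
  unfolding sum_distrib_right
  by (intro Bochner_Integration.integral_sum L2_C0_integrable assms)

lemma weak_laplacian_test:
  assumes f: "f \<in> H2" and \<phi>: "\<phi> \<in> C0_infinity"
  shows "(\<Sum>b\<in>Basis. \<integral>x. weak_partial b f x * partial_deriv b \<phi> x \<partial>lborel)
    = - (\<integral>x. weak_laplacian f x * \<phi> x \<partial>lborel)"
proof -
  have "(\<integral>x. weak_laplacian f x * \<phi> x \<partial>lborel) = (\<Sum>b\<in>Basis. \<integral>x. weak_partial b (weak_partial b f) x * \<phi> x \<partial>lborel)"
    unfolding weak_laplacian_def by (rule integral_sum_L2_C0[OF H1_weak_partial(1)[OF H2_weak_partial[OF f]] \<phi>])
  moreover have "(\<integral>x. weak_partial b f x * partial_deriv b \<phi> x \<partial>lborel) = - (\<integral>x. weak_partial b (weak_partial b f) x * \<phi> x \<partial>lborel)"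
    if b: "b \<in> Basis" for b
    using H1_weak_partial(2)[OF H2_weak_partial[OF f b] b] \<phi> unfolding has_weak_partial_def by blast
  ultimately show ?thesis by (simp add: sum_negf)
qed

lemma weak_laplacian_unique:
  assumes f: "f \<in> H2" and v: "v \<in> L2_space lborel"
    and weak: "\<And>\<phi>. \<phi> \<in> C0_infinity \<Longrightarrow>
      (\<Sum>b\<in>Basis. \<integral>x. weak_partial b f x * partial_deriv b \<phi> x \<partial>lborel) = - (\<integral>x. v x * \<phi> x \<partial>lborel)"
  shows "AE x in lborel. weak_laplacian f x = v x"
proof -
  note w = weak_laplacian_L2[OF f]
  have "AE x in lborel. weak_laplacian f x - v x = 0"
  proof (rule fundamental_lemma)
    show "loc_integrable (\<lambda>x. weak_laplacian f x - v x)" by (intro L2_loc_integrable L2.diff_mem w v)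
    fix \<phi> :: "'a \<Rightarrow> complex" assume \<phi>: "\<phi> \<in> C0_infinity"
    have "(\<integral>x. weak_laplacian f x * \<phi> x \<partial>lborel) = (\<integral>x. v x * \<phi> x \<partial>lborel)"
      using weak[OF \<phi>] weak_laplacian_test[OF f \<phi>] by simp
    then show "(\<integral>x. (weak_laplacian f x - v x) * \<phi> x \<partial>lborel) = 0"
      using \<phi> w v by (simp add: left_diff_distrib Bochner_Integration.integral_diff L2_C0_integrable)
  qed
  then show ?thesis by simp
qed

text \<open>
  Approximating \<open>f - v\<close> by \<open>\<phi> - \<Delta> \<phi>\<close> with test functions \<open>\<phi>\<close>, the a priori bound makes all derivatives
  of \<open>\<phi>\<close> up to order two converge, and injectivity of \<open>1 - \<Delta>\<close> identifies the limit of \<open>\<phi>\<close> as \<open>f\<close>.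
\<close>
lemma elliptic_regularity:
  fixes f v :: "'a::euclidean_space \<Rightarrow> complex"
  assumes f: "f \<in> H1" and v: "v \<in> L2_space lborel"
    and weak: "\<And>\<phi>. \<phi> \<in> C0_infinity \<Longrightarrow>
      (\<Sum>b\<in>Basis. \<integral>x. weak_partial b f x * partial_deriv b \<phi> x \<partial>lborel) = - (\<integral>x. v x * \<phi> x \<partial>lborel)"
  shows "f \<in> H2" "AE x in lborel. weak_laplacian f x = v x"
proof -
  note fL = H1_L2[OF f]
  let ?g = "\<lambda>x. f x - v x"
  have g: "?g \<in> L2_space lborel" by (intro L2.diff_mem fL v)
  obtain \<phi> where \<phi>: "\<And>n. \<phi> n \<in> C0_infinity"
    and lim: "(\<lambda>n. L2_norm lborel (\<lambda>x. \<phi> n x - test_laplacian (\<phi> n) x - ?g x)) \<longlonglongrightarrow> 0"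
  proof (rule dense_one_minus_laplacian[OF g])
    fix s :: "nat \<Rightarrow> 'a \<Rightarrow> complex"
    assume s: "\<And>n. s n \<in> C0_infinity" "(\<lambda>n. L2_norm lborel (\<lambda>x. s n x - test_laplacian (s n) x - ?g x)) \<longlonglongrightarrow> 0"
    show thesis by (rule that[of s, OF s])
  qed
  let ?R = "\<lambda>n x. \<phi> n x - test_laplacian (\<phi> n) x"
  have RL: "?R n \<in> L2_space lborel" for n by (intro C0_L2_lborel C0_one_minus_laplacian \<phi>)
  have cR: "L2.cauchy lborel ?R"
    by (rule L2.cauchy_convergent[OF RL g lim])
  \<comment> \<open>\<open>D\<close> stands for the identity, then for first and for second
    derivatives; the argument rests on additivity and the a priori bound alone.\<close>
  have transfer: "L2.cauchy lborel (\<lambda>n. D (\<phi> n))"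
    if D: "\<And>\<psi> \<theta>. \<psi> \<in> C0_infinity \<Longrightarrow> \<theta> \<in> C0_infinity \<Longrightarrow> D (\<lambda>x. \<psi> x - \<theta> x) = (\<lambda>x. D \<psi> x - D \<theta> x)"
      and bnd: "\<And>\<psi>. \<psi> \<in> C0_infinity \<Longrightarrow> L2_norm lborel (D \<psi>) \<le> L2_norm lborel (\<lambda>x. \<psi> x - test_laplacian \<psi> x)"
    for D :: "('a \<Rightarrow> complex) \<Rightarrow> 'a \<Rightarrow> complex"
  proof (rule L2.cauchy_mono[OF semi_ip_L2 cR, of 1], unfold L2_norm_eq)
    fix m n
    have "(\<lambda>x. (\<phi> m x - \<phi> n x) - test_laplacian (\<lambda>x. \<phi> m x - \<phi> n x) x) = (\<lambda>x. ?R m x - ?R n x)"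
      by (simp add: test_laplacian_diff \<phi> fun_eq_iff)
    then show "L2_norm lborel (\<lambda>x. D (\<phi> m) x - D (\<phi> n) x) \<le> 1 * L2_norm lborel (\<lambda>x. ?R m x - ?R n x)"
      using bnd[OF C0_diff[OF \<phi> \<phi>], of m n] by (simp add: D \<phi>)
  qed simp
  \<comment> \<open>The a priori bound is stated for given basis vectors, also in its part about
    \<phi> itself.\<close>
  obtain b0 :: 'a where b0: "b0 \<in> Basis" using nonempty_Basis by blast
  have "L2.cauchy lborel \<phi>"
    using transfer[of "\<lambda>f. f"] one_minus_laplacian_bound(1)[OF _ b0 b0] by simp
  then obtain p where p: "p \<in> L2_space lborel" "(\<lambda>n. L2_norm lborel (\<lambda>x. \<phi> n x - p x)) \<longlonglongrightarrow> 0"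
    using L2.complete[of \<phi> lborel, OF C0_L2_lborel[OF \<phi>]] by blast
  have c1: "L2.cauchy lborel (\<lambda>n. partial_deriv b (\<phi> n))" if "b \<in> Basis" for b
    by (rule transfer) (auto simp: partial_deriv_diff intro: one_minus_laplacian_bound(2) that)
  have "\<exists>q\<in>L2_space lborel. (\<lambda>n. L2_norm lborel (\<lambda>x. partial_deriv b (\<phi> n) x - q x)) \<longlonglongrightarrow> 0"
    if "b \<in> Basis" for b
    by (rule L2.complete[OF C0_L2_lborel[OF C0_partial[OF \<phi> that]] c1[OF that]])
  then obtain q where q: "\<And>b. b \<in> Basis \<Longrightarrow> q b \<in> L2_space lborel"
    "\<And>b. b \<in> Basis \<Longrightarrow> (\<lambda>n. L2_norm lborel (\<lambda>x. partial_deriv b (\<phi> n) x - q b x)) \<longlonglongrightarrow> 0" by metis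
  have c2: "L2.cauchy lborel (\<lambda>n. partial_deriv c (partial_deriv b (\<phi> n)))" if "b \<in> Basis" "c \<in> Basis" for b c
    by (rule transfer) (auto simp: partial_deriv_diff C0_partial that intro: one_minus_laplacian_bound(3) that)
  define r where "r b c = (SOME r. r \<in> L2_space lborel \<and>
    (\<lambda>n. L2_norm lborel (\<lambda>x. partial_deriv c (partial_deriv b (\<phi> n)) x - r x)) \<longlonglongrightarrow> 0)" for b c
  have r': "r b c \<in> L2_space lborel \<and> (\<lambda>n. L2_norm lborel (\<lambda>x. partial_deriv c (partial_deriv b (\<phi> n)) x - r b c x)) \<longlonglongrightarrow> 0"
    if b: "b \<in> Basis" and c: "c \<in> Basis" for b c
    using someI_ex[OF L2.complete[OF C0_L2_lborel[OF C0_partial[OF C0_partial[OF \<phi> b] c]] c2[OF b c], unfolded Bex_def]]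
    unfolding r_def .
  note r = conjunct1[OF r'] conjunct2[OF r']
  have wq: "has_weak_partial b p (q b)" if b: "b \<in> Basis" for b
    by (rule has_weak_partial_limit[OF C0_L2_lborel[OF \<phi>] C0_L2_lborel[OF C0_partial[OF \<phi> b]] p(1) q(1)[OF b]
          C0_has_weak_partial[OF \<phi> b] b p(2) q(2)[OF b]])
  have wr: "has_weak_partial c (q b) (r b c)" if b: "b \<in> Basis" and c: "c \<in> Basis" for b c
    by (rule has_weak_partial_limit[OF C0_L2_lborel[OF C0_partial[OF \<phi> b]] C0_L2_lborel[OF C0_partial[OF C0_partial[OF \<phi> b] c]]
          q(1)[OF b] r(1)[OF b c] C0_has_weak_partial[OF C0_partial[OF \<phi> b] c] c q(2)[OF b] r(2)[OF b c]])
  \<comment> \<open>Both \<open>f\<close> and \<open>p\<close> solve y - \<Delta> y = f - v weakly: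
    \<open>f\<close> by hypothesis, \<open>p\<close> as the limit of the \<phi> n.\<close>
  have "AE x in lborel. f x - p x = 0"
  proof (rule one_minus_laplacian_injective)
    show "(\<lambda>x. f x - p x) \<in> L2_space lborel" by (intro L2.diff_mem fL p)
    fix \<psi> :: "'a \<Rightarrow> complex" assume \<psi>: "\<psi> \<in> C0_infinity"
    note R\<psi> = C0_one_minus_laplacian[OF \<psi>]
    have "(\<integral>x. f x * (\<psi> x - test_laplacian \<psi> x) \<partial>lborel) = (\<integral>x. ?g x * \<psi> x \<partial>lborel)"
      unfolding H1_pair_test[OF f \<psi>] weak[OF \<psi>] using fL v \<psi>
      by (simp add: left_diff_distrib Bochner_Integration.integral_diff L2_C0_integrable)
    moreover have "(\<integral>x. p x * (\<psi> x - test_laplacian \<psi> x) \<partial>lborel) = (\<integral>x. ?g x * \<psi> x \<partial>lborel)"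
    proof (rule LIMSEQ_unique)
      show "(\<lambda>n. \<integral>x. \<phi> n x * (\<psi> x - test_laplacian \<psi> x) \<partial>lborel) \<longlonglongrightarrow> (\<integral>x. p x * (\<psi> x - test_laplacian \<psi> x) \<partial>lborel)"
        unfolding test_pair[OF C0_L2_lborel[OF \<phi>] R\<psi>] test_pair[OF p(1) R\<psi>]
        by (intro L2.ip_tendsto C0_L2_lborel \<phi> p L2_cnj R\<psi>)
      have "(\<integral>x. \<phi> n x * (\<psi> x - test_laplacian \<psi> x) \<partial>lborel) = (\<integral>x. ?R n x * \<psi> x \<partial>lborel)" for n
      proof -
        have ibp: "(\<integral>x. a x * test_laplacian \<psi> x \<partial>lborel) = - (\<Sum>b\<in>Basis. \<integral>x. partial_deriv b a x * partial_deriv b \<psi> x \<partial>lborel)"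
          if a: "a \<in> C0_infinity" for a :: "'a \<Rightarrow> complex"
        proof -
          have "(\<integral>x. a x * test_laplacian \<psi> x \<partial>lborel) = (\<Sum>b\<in>Basis. \<integral>x. a x * partial_deriv b (partial_deriv b \<psi>) x \<partial>lborel)"
            unfolding test_laplacian_def sum_distrib_left
            by (intro Bochner_Integration.integral_sum C0_integrable C0_mult_C0 C0_partial a \<psi>)
          then show ?thesis using integration_by_parts[OF a C0_partial[OF \<psi>]] by (simp add: sum_negf)
        qed
        have ibp': "(\<integral>x. test_laplacian a x * \<psi> x \<partial>lborel) = - (\<Sum>b\<in>Basis. \<integral>x. partial_deriv b a x * partial_deriv b \<psi> x \<partial>lborel)"
          if a: "a \<in> C0_infinity" for a :: "'a \<Rightarrow> complex"
        proof -
          have "(\<integral>x. test_laplacian a x * \<psi> x \<partial>lborel) = (\<Sum>b\<in>Basis. \<integral>x. partial_deriv b (partial_deriv b a) x * \<psi> x \<partial>lborel)"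
            unfolding test_laplacian_def sum_distrib_right
            by (intro Bochner_Integration.integral_sum C0_integrable C0_mult_C0 C0_partial a \<psi>)
          then show ?thesis using integration_by_parts[OF C0_partial[OF a] \<psi>] by (simp add: sum_negf)
        qed
        show ?thesis
          unfolding left_diff_distrib right_diff_distrib
          by (simp add: Bochner_Integration.integral_diff C0_integrable C0_mult_C0 \<phi> \<psi> C0_laplacian ibp ibp')
      qed
      moreover have "(\<lambda>n. \<integral>x. ?R n x * \<psi> x \<partial>lborel) \<longlonglongrightarrow> (\<integral>x. ?g x * \<psi> x \<partial>lborel)"
        unfolding test_pair[OF RL \<psi>] test_pair[OF g \<psi>]
        by (rule L2.ip_tendsto[OF RL g _ lim]) (intro L2_cnj C0_L2_lborel \<psi>)
      ultimately show "(\<lambda>n. \<integral>x. \<phi> n x * (\<psi> x - test_laplacian \<psi> x) \<partial>lborel) \<longlonglongrightarrow> (\<integral>x. ?g x * \<psi> x \<partial>lborel)"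
        by simp
    qed
    ultimately show "(\<integral>x. (f x - p x) * (\<psi> x - test_laplacian \<psi> x) \<partial>lborel) = 0"
      unfolding left_diff_distrib[of "f _"]
      using Bochner_Integration.integral_diff[OF L2_C0_integrable[OF fL R\<psi>] L2_C0_integrable[OF p(1) R\<psi>]] by simp
  qed
  then have pf: "AE x in lborel. p x = f x" by eventually_elim simp
  have "weak_partial b f \<in> H1" if b: "b \<in> Basis" for b
  proof (rule H1_cong_AE(1))
    show "q b \<in> H1" by (rule H1I[OF q(1)[OF b] r(1)[OF b] wr[OF b]])
    show "weak_partial b f \<in> L2_space lborel" by (rule H1_weak_partial(1)[OF f b])
    have "has_weak_partial b f (q b)"
      by (rule has_weak_partial_cong_AE[OF wq[OF b] p(1) fL q(1)[OF b] q(1)[OF b] pf _ b]) simp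
    then show "AE x in lborel. q b x = weak_partial b f x"
      using weak_partial_someI(3)[OF q(1)[OF b]] by fastforce
  qed
  with f show *: "f \<in> H2" by (simp add: H2_def)
  show "AE x in lborel. weak_laplacian f x = v x"
    by (rule weak_laplacian_unique[OF * v weak])
qed

section \<open>Linear structure of H^2 and linearity of the weak Laplacian\<close>

lemma fun_subspace_H2: "fun_subspace H2"
  unfolding fun_subspace_def
proof (intro conjI ballI allI)
  have add: "(\<lambda>x. f x + g x) \<in> H2" if f: "f \<in> H2" and g: "g \<in> H2" for f g :: "'a \<Rightarrow> complex"
  proof -
    have fg: "(\<lambda>x. f x + g x) \<in> H1" using f g by (intro fun_subspaceD(2)[OF fun_subspace_H1] H2_H1)
    have "weak_partial b (\<lambda>x. f x + g x) \<in> H1" if b: "b \<in> Basis" for b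
    proof (rule H1_cong_AE(1)[OF fun_subspaceD(2)[OF fun_subspace_H1 H2_weak_partial[OF f b] H2_weak_partial[OF g b]] H1_weak_partial(1)[OF fg b]])
      show "AE x in lborel. weak_partial b f x + weak_partial b g x = weak_partial b (\<lambda>x. f x + g x) x"
        using ae_linearD(2)[OF ae_linear_weak_partial[OF b] H2_H1[OF f] H2_H1[OF g]] by eventually_elim simp
    qed
    with fg show ?thesis by (simp add: H2_def)
  qed
  have scale: "(\<lambda>x. c * f x) \<in> H2" if f: "f \<in> H2" for f :: "'a \<Rightarrow> complex" and c
  proof -
    have fg: "(\<lambda>x. c * f x) \<in> H1" using f by (intro fun_subspaceD(3)[OF fun_subspace_H1] H2_H1)
    have "weak_partial b (\<lambda>x. c * f x) \<in> H1" if b: "b \<in> Basis" for b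
    proof (rule H1_cong_AE(1)[OF fun_subspaceD(3)[OF fun_subspace_H1 H2_weak_partial[OF f b]] H1_weak_partial(1)[OF fg b]])
      show "AE x in lborel. c * weak_partial b f x = weak_partial b (\<lambda>x. c * f x) x"
        using ae_linearD(3)[OF ae_linear_weak_partial[OF b] H2_H1[OF f], of c] by eventually_elim simp
    qed
    with fg show ?thesis by (simp add: H2_def)
  qed
  have z: "(\<lambda>x. 0) \<in> (H1 :: ('a \<Rightarrow> complex) set)" by (rule fun_subspaceD(1)[OF fun_subspace_H1])
  have "weak_partial b (\<lambda>x. 0) \<in> (H1 :: ('a \<Rightarrow> complex) set)" if b: "b \<in> Basis" for b
  proof (rule H1_cong_AE(1)[OF z H1_weak_partial(1)[OF z b]])
    have "AE x in lborel. weak_partial b (\<lambda>x. 0) x = 0"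
      using ae_linearD(3)[OF ae_linear_weak_partial[OF b] z, of 0] by simp
    then show "AE x in lborel. 0 = weak_partial b (\<lambda>x. 0) x" by eventually_elim simp
  qed
  with z show "(\<lambda>x. 0) \<in> (H2 :: ('a \<Rightarrow> complex) set)" by (simp add: H2_def)
  fix f g :: "'a \<Rightarrow> complex" and c assume "f \<in> H2"
  then show "(\<lambda>x. c * f x) \<in> H2" by (rule scale)
  assume "g \<in> H2" with \<open>f \<in> H2\<close> show "(\<lambda>x. f x + g x) \<in> H2" by (rule add)
qed

text \<open>Derivatives are nested: the inner choice changes the argument of the outer
  \<open>weak_partial\<close> on a null set, which \<open>H1_cong_AE\<close> absorbs; only then does
  linearity of the outer derivative apply.\<close>

lemma ae_linear_laplacian: "ae_linear lborel H2 weak_laplacian"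
  unfolding ae_linear_def
proof (intro conjI ballI allI)
  fix f :: "'a \<Rightarrow> complex" and c assume f: "f \<in> H2"
  show "weak_laplacian f \<in> L2_space lborel" by (rule weak_laplacian_L2[OF f])
  have "AE x in lborel. \<forall>b\<in>Basis. weak_partial b (weak_partial b (\<lambda>x. c * f x)) x = c * weak_partial b (weak_partial b f) x"
  proof (rule AE_finite_allI[OF finite_Basis])
    fix b :: 'a assume b: "b \<in> Basis"
    note H = fun_subspaceD(3)[OF fun_subspace_H2 f] H2_weak_partial[OF f b] H2_weak_partial[OF fun_subspaceD(3)[OF fun_subspace_H2 f] b]
    have "AE x in lborel. c * weak_partial b f x = weak_partial b (\<lambda>x. c * f x) x"
      using ae_linearD(3)[OF ae_linear_weak_partial[OF b] H2_H1[OF f], of c] by eventually_elim simp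
    from H1_cong_AE(2)[OF fun_subspaceD(3)[OF fun_subspace_H1 H(2)] H1_L2[OF H(3)] this b]
      ae_linearD(3)[OF ae_linear_weak_partial[OF b] H(2), of c]
    show "AE x in lborel. weak_partial b (weak_partial b (\<lambda>x. c * f x)) x = c * weak_partial b (weak_partial b f) x"
      by eventually_elim simp
  qed
  then show "AE x in lborel. weak_laplacian (\<lambda>x. c * f x) x = c * weak_laplacian f x"
    by eventually_elim (simp add: weak_laplacian_def sum_distrib_left)
  fix g :: "'a \<Rightarrow> complex" assume g: "g \<in> H2"
  have "AE x in lborel. \<forall>b\<in>Basis. weak_partial b (weak_partial b (\<lambda>x. f x + g x)) x
      = weak_partial b (weak_partial b f) x + weak_partial b (weak_partial b g) x"
  proof (rule AE_finite_allI[OF finite_Basis])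
    fix b :: 'a assume b: "b \<in> Basis"
    note H = H2_weak_partial[OF f b] H2_weak_partial[OF g b] H2_weak_partial[OF fun_subspaceD(2)[OF fun_subspace_H2 f g] b]
    have "AE x in lborel. weak_partial b f x + weak_partial b g x = weak_partial b (\<lambda>x. f x + g x) x"
      using ae_linearD(2)[OF ae_linear_weak_partial[OF b] H2_H1[OF f] H2_H1[OF g]] by eventually_elim simp
    from H1_cong_AE(2)[OF fun_subspaceD(2)[OF fun_subspace_H1 H(1,2)] H1_L2[OF H(3)] this b]
      ae_linearD(2)[OF ae_linear_weak_partial[OF b] H(1,2)]
    show "AE x in lborel. weak_partial b (weak_partial b (\<lambda>x. f x + g x)) x
      = weak_partial b (weak_partial b f) x + weak_partial b (weak_partial b g) x"
      by eventually_elim simp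
  qed
  then show "AE x in lborel. weak_laplacian (\<lambda>x. f x + g x) x = weak_laplacian f x + weak_laplacian g x"
    by eventually_elim (simp add: weak_laplacian_def sum.distrib)
qed

section \<open>The form spaces\<close>

definition bilaplacian_form :: "real \<Rightarrow> ('a::euclidean_space \<Rightarrow> complex) \<Rightarrow> ('a \<Rightarrow> complex) \<Rightarrow> complex" where
  "bilaplacian_form \<epsilon> f g =
    (if \<epsilon> = 0 then 0 else complex_of_real (\<epsilon>\<^sup>2) * L2_inner lborel (weak_laplacian f) (weak_laplacian g))"

text \<open>The energy without the measure, enlarged by the L^2 product so that it is the scalar
  product of the form domain: that of H^1 for \<epsilon> = 0, and otherwise the same plus an
  \<epsilon>-weighted product of Laplacians. The extra L^2 product is taken away again in
  \<open>shifted\<close> and \<open>form_op\<close>.\<close>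

definition form_ip :: "real \<Rightarrow> ('a::euclidean_space \<Rightarrow> complex) \<Rightarrow> ('a \<Rightarrow> complex) \<Rightarrow> complex" where
  "form_ip \<epsilon> f g = bilaplacian_form \<epsilon> f g + H1_ip f g"

lemma form_domain_H1: "f \<in> form_domain \<epsilon> \<Longrightarrow> f \<in> H1"
  by (auto simp: form_domain_def H2_H1 split: if_splits)

lemma fun_subspace_form_domain: "fun_subspace (form_domain \<epsilon>)"
  by (simp add: form_domain_def fun_subspace_H1 fun_subspace_H2)

lemma sesquilinear_bilaplacian: "sesquilinear (form_domain \<epsilon>) (bilaplacian_form \<epsilon>)"
proof (cases "\<epsilon> = 0")
  case True
  then show ?thesis by (simp add: sesquilinear_def bilaplacian_form_def)
next
  case False
  then have "bilaplacian_form \<epsilon> = (\<lambda>f g :: 'a \<Rightarrow> complex. complex_of_real (\<epsilon>\<^sup>2) * L2_inner lborel (weak_laplacian f) (weak_laplacian g))"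
    by (simp add: bilaplacian_form_def fun_eq_iff)
  with False show ?thesis
    by (simp only: form_domain_def if_False)
      (intro sesquilinear_cmult sesquilinear_pullback ae_linear_laplacian fun_subspace_H2)
qed

lemma bilaplacian_cnj:
  assumes "f \<in> form_domain \<epsilon>" "g \<in> form_domain \<epsilon>"
  shows "bilaplacian_form \<epsilon> g f = cnj (bilaplacian_form \<epsilon> f g)"
proof (cases "\<epsilon> = 0")
  case False
  with assms have "L2_inner lborel (weak_laplacian g) (weak_laplacian f) = cnj (L2_inner lborel (weak_laplacian f) (weak_laplacian g))"
    by (intro L2.ip_cnj weak_laplacian_L2) (auto simp: form_domain_def)
  with False show ?thesis by (simp add: bilaplacian_form_def)
qed (simp add: bilaplacian_form_def)

lemma bilaplacian_self:
  assumes "f \<in> form_domain \<epsilon>"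
  shows "bilaplacian_form \<epsilon> f f = of_real (if \<epsilon> = 0 then 0 else \<epsilon>\<^sup>2 * (L2_norm lborel (weak_laplacian f))\<^sup>2)"
proof (cases "\<epsilon> = 0")
  case False
  with assms have "weak_laplacian f \<in> L2_space lborel" by (auto simp: form_domain_def intro: weak_laplacian_L2)
  from L2.ip_self[OF this] False show ?thesis by (simp add: bilaplacian_form_def)
qed (simp add: bilaplacian_form_def)

lemma semi_ip_form: "semi_ip (form_domain \<epsilon>) (form_ip \<epsilon>)"
proof (rule semi_ipI[OF fun_subspace_form_domain])
  show "sesquilinear (form_domain \<epsilon>) (form_ip \<epsilon> :: ('a \<Rightarrow> complex) \<Rightarrow> _)"
    unfolding form_ip_def[abs_def]
    by (intro sesquilinear_plus sesquilinear_bilaplacian sesquilinear_mono[OF sesquilinear_H1_ip])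
      (auto simp: form_domain_H1)
  fix f g :: "'a \<Rightarrow> complex" assume fg: "f \<in> form_domain \<epsilon>" "g \<in> form_domain \<epsilon>"
  show "form_ip \<epsilon> g f = cnj (form_ip \<epsilon> f g)"
    unfolding form_ip_def using bilaplacian_cnj[OF fg] H1.ip_cnj[OF form_domain_H1[OF fg(1)] form_domain_H1[OF fg(2)]] by simp
next
  fix f :: "'a \<Rightarrow> complex" assume f: "f \<in> form_domain \<epsilon>"
  show "0 \<le> Re (form_ip \<epsilon> f f)"
    unfolding form_ip_def using bilaplacian_self[OF f] H1.ip_nonneg[OF form_domain_H1[OF f]] by simp
qed

interpretation form: semi_ip "form_domain \<epsilon>" "form_ip \<epsilon>" for \<epsilon> by (rule semi_ip_form)

lemma form_N_sq:
  assumes f: "f \<in> form_domain \<epsilon>"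
  shows "(form.N \<epsilon> f)\<^sup>2 = (if \<epsilon> = 0 then 0 else \<epsilon>\<^sup>2 * (L2_norm lborel (weak_laplacian f))\<^sup>2) + (H1.N f)\<^sup>2"
  using form.N_sq[OF f] bilaplacian_self[OF f] H1.N_sq[OF form_domain_H1[OF f]] by (simp add: form_ip_def)

lemma form_N_0: "form.N 0 f = H1.N f"
  by (simp add: form.N_def H1.N_def form_ip_def bilaplacian_form_def)

lemma H1_N_le_form:
  assumes "f \<in> form_domain \<epsilon>"
  shows "H1.N f \<le> form.N \<epsilon> f"
proof (rule power2_le_imp_le)
  show "(H1.N f)\<^sup>2 \<le> (form.N \<epsilon> f)\<^sup>2" unfolding form_N_sq[OF assms] by simp
qed (rule form.N_nonneg[OF assms])

lemma laplacian_norm_le_form: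
  assumes "f \<in> form_domain \<epsilon>" "\<epsilon> \<noteq> 0"
  shows "\<bar>\<epsilon>\<bar> * L2_norm lborel (weak_laplacian f) \<le> form.N \<epsilon> f"
proof (rule power2_le_imp_le)
  show "(\<bar>\<epsilon>\<bar> * L2_norm lborel (weak_laplacian f))\<^sup>2 \<le> (form.N \<epsilon> f)\<^sup>2"
    unfolding form_N_sq[OF assms(1)] using assms(2) by (simp add: power_mult_distrib)
qed (rule form.N_nonneg[OF assms(1)])

lemma L2_norm_le_form: "f \<in> form_domain \<epsilon> \<Longrightarrow> L2_norm lborel f \<le> form.N \<epsilon> f"
  using L2_norm_le_H1[OF form_domain_H1] H1_N_le_form order_trans by blast

text \<open>For \<epsilon> \<noteq> 0 the norm sees the Laplacian but not the individual second
  derivatives. The H^1 limit \<open>f\<close> satisfies \<Delta> f = v weakly, with \<open>v\<close>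
  the L^2 limit of the Laplacians, and elliptic regularity puts it in H^2.\<close>

lemma form_complete:
  assumes s: "\<And>n. s n \<in> form_domain \<epsilon>" and c: "form.cauchy \<epsilon> s"
  shows "\<exists>p\<in>form_domain \<epsilon>. (\<lambda>n. form.N \<epsilon> (\<lambda>x. s n x - p x)) \<longlonglongrightarrow> 0"
proof -
  note sH = form_domain_H1[OF s]
  have "H1.cauchy s"
  proof (rule form.cauchy_mono[OF semi_ip_H1 c, of 1])
    show "H1.N (\<lambda>x. s m x - s n x) \<le> 1 * form.N \<epsilon> (\<lambda>x. s m x - s n x)" for m n
      using H1_N_le_form[OF form.diff_mem[OF s s], of m n] by simp
  qed simp
  then obtain f where f: "f \<in> H1" "(\<lambda>n. H1.N (\<lambda>x. s n x - f x)) \<longlonglongrightarrow> 0"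
    using H1.complete[of s] sH by blast
  show ?thesis
  proof (cases "\<epsilon> = 0")
    case True
    have "form.N 0 (\<lambda>x. s n x - f x) = H1.N (\<lambda>x. s n x - f x)" for n
      by (simp add: form.N_def H1.N_def form_ip_def bilaplacian_form_def)
    with f True show ?thesis by (auto simp: form_domain_def intro!: bexI[of _ f])
  next
    case False
    have sH2: "s n \<in> H2" for n using s[of n] False by (simp add: form_domain_def)
    have lap_diff: "AE x in lborel. weak_laplacian (\<lambda>x. f x - g x) x = weak_laplacian f x - weak_laplacian g x"
      if "f \<in> H2" "g \<in> H2" for f g :: "'a \<Rightarrow> complex"
      by (rule ae_linear_diff[OF ae_linear_laplacian fun_subspace_H2 that])
    note lapL = weak_laplacian_L2[OF sH2]
    have "L2.cauchy lborel (\<lambda>n. weak_laplacian (s n))"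
    proof (rule form.cauchy_mono[OF semi_ip_L2 c, of "1 / \<bar>\<epsilon>\<bar>"], unfold L2_norm_eq)
      fix m n
      have d: "(\<lambda>x. s m x - s n x) \<in> form_domain \<epsilon>" by (rule form.diff_mem[OF s s])
      then have d2: "(\<lambda>x. s m x - s n x) \<in> H2" using False by (simp add: form_domain_def)
      have "L2_norm lborel (\<lambda>x. weak_laplacian (s m) x - weak_laplacian (s n) x) = L2_norm lborel (weak_laplacian (\<lambda>x. s m x - s n x))"
      proof (rule L2_norm_cong[OF L2.diff_mem[OF lapL lapL] weak_laplacian_L2[OF d2]])
        show "AE x in lborel. weak_laplacian (s m) x - weak_laplacian (s n) x = weak_laplacian (\<lambda>x. s m x - s n x) x"
          using lap_diff[OF sH2[of m] sH2[of n]] by eventually_elim simp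
      qed
      then show "L2_norm lborel (\<lambda>x. weak_laplacian (s m) x - weak_laplacian (s n) x) \<le> 1 / \<bar>\<epsilon>\<bar> * form.N \<epsilon> (\<lambda>x. s m x - s n x)"
        using laplacian_norm_le_form[OF d False] False by (simp add: field_simps)
    qed simp
    then obtain v where v: "v \<in> L2_space lborel" "(\<lambda>n. L2_norm lborel (\<lambda>x. weak_laplacian (s n) x - v x)) \<longlonglongrightarrow> 0"
      using L2.complete[of "\<lambda>n. weak_laplacian (s n)"] lapL by blast
    have weak: "(\<Sum>b\<in>Basis. \<integral>x. weak_partial b f x * partial_deriv b \<phi> x \<partial>lborel) = - (\<integral>x. v x * \<phi> x \<partial>lborel)"
      if \<phi>: "\<phi> \<in> C0_infinity" for \<phi>
    proof (rule LIMSEQ_unique)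
      show "(\<lambda>n. - (\<integral>x. weak_laplacian (s n) x * \<phi> x \<partial>lborel)) \<longlonglongrightarrow> - (\<integral>x. v x * \<phi> x \<partial>lborel)"
        unfolding test_pair[OF lapL \<phi>] test_pair[OF v(1) \<phi>]
        by (intro tendsto_minus L2.ip_tendsto lapL v L2_cnj C0_L2_lborel \<phi>)
      have "(\<lambda>n. \<integral>x. weak_partial b (s n) x * partial_deriv b \<phi> x \<partial>lborel) \<longlonglongrightarrow> (\<integral>x. weak_partial b f x * partial_deriv b \<phi> x \<partial>lborel)"
        if b: "b \<in> Basis" for b
        unfolding test_pair[OF H1_weak_partial(1)[OF sH b] C0_partial[OF \<phi> b]] test_pair[OF H1_weak_partial(1)[OF f(1) b] C0_partial[OF \<phi> b]]
      proof (rule L2.ip_tendsto[OF H1_weak_partial(1)[OF sH b] H1_weak_partial(1)[OF f(1) b]])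
        show "(\<lambda>x. cnj (partial_deriv b \<phi> x)) \<in> L2_space lborel" by (intro L2_cnj C0_L2_lborel C0_partial \<phi> b)
        show "(\<lambda>n. L2_norm lborel (\<lambda>x. weak_partial b (s n) x - weak_partial b f x)) \<longlonglongrightarrow> 0"
          unfolding L2_norm_partial_diff[OF sH f(1) b]
        proof (rule Lim_null_comparison[OF _ f(2)], intro always_eventually allI)
          fix n
          note d = H1.diff_mem[OF sH[of n] f(1)]
          show "norm (L2_norm lborel (weak_partial b (\<lambda>x. s n x - f x))) \<le> H1.N (\<lambda>x. s n x - f x)"
            using L2_norm_partial_le_H1[OF d b] L2.N_nonneg[OF H1_weak_partial(1)[OF d b]] by simp
        qed
      qed
      then have "(\<lambda>n. \<Sum>b\<in>Basis. \<integral>x. weak_partial b (s n) x * partial_deriv b \<phi> x \<partial>lborel) \<longlonglongrightarrow> (\<Sum>b\<in>Basis. \<integral>x. weak_partial b f x * partial_deriv b \<phi> x \<partial>lborel)"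
        by (intro tendsto_sum)
      then show "(\<lambda>n. - (\<integral>x. weak_laplacian (s n) x * \<phi> x \<partial>lborel)) \<longlonglongrightarrow> (\<Sum>b\<in>Basis. \<integral>x. weak_partial b f x * partial_deriv b \<phi> x \<partial>lborel)"
        unfolding weak_laplacian_test[OF sH2 \<phi>] .
    qed
    have reg: "f \<in> H2" "AE x in lborel. weak_laplacian f x = v x"
      by (rule elliptic_regularity[OF f(1) v(1)], rule weak, assumption)+
    have fD: "f \<in> form_domain \<epsilon>" using reg(1) False by (simp add: form_domain_def)
    have lapf: "L2_norm lborel (weak_laplacian (\<lambda>x. s n x - f x)) = L2_norm lborel (\<lambda>x. weak_laplacian (s n) x - v x)" for n
    proof (rule L2_norm_cong[OF weak_laplacian_L2[OF fun_subspace_diff[OF fun_subspace_H2 sH2 reg(1)]] L2.diff_mem[OF lapL v(1)]])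
      show "AE x in lborel. weak_laplacian (\<lambda>x. s n x - f x) x = weak_laplacian (s n) x - v x"
        using lap_diff[OF sH2[of n] reg(1)] reg(2) by eventually_elim simp
    qed
    have "(\<lambda>n. sqrt (\<epsilon>\<^sup>2 * (L2_norm lborel (\<lambda>x. weak_laplacian (s n) x - v x))\<^sup>2 + (H1.N (\<lambda>x. s n x - f x))\<^sup>2)) \<longlonglongrightarrow> sqrt (\<epsilon>\<^sup>2 * 0\<^sup>2 + 0\<^sup>2)"
      by (intro tendsto_intros v f)
    moreover have "form.N \<epsilon> (\<lambda>x. s n x - f x) = sqrt (\<epsilon>\<^sup>2 * (L2_norm lborel (\<lambda>x. weak_laplacian (s n) x - v x))\<^sup>2 + (H1.N (\<lambda>x. s n x - f x))\<^sup>2)" for n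
      using form_N_sq[OF form.diff_mem[OF s fD], of n] form.N_nonneg[OF form.diff_mem[OF s fD], of n] False
      by (simp add: lapf real_sqrt_unique)
    ultimately show ?thesis using fD by (auto intro!: bexI[of _ f])
  qed
qed

interpretation form: semi_hilbert "form_domain \<epsilon>" "form_ip \<epsilon>" for \<epsilon>
  by unfold_locales (rule form_complete)

section \<open>The trace map\<close>

locale trace_bound =
  fixes \<mu> :: "'a::euclidean_space measure" and C :: real
  assumes radon: "radon_measure \<mu>"
    and C_nonneg: "0 \<le> C"
    and bound: "\<phi> \<in> C0_infinity \<Longrightarrow> L2_norm \<mu> \<phi> \<le> C * H1.N \<phi>"
begin

text \<open>The closure of the graph of the identity on test functions, in H^1 times L^2(\<mu>). The
  bound of the locale makes it the graph of a map, up to null sets.\<close>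

definition trace_rel :: "('a \<Rightarrow> complex) \<Rightarrow> ('a \<Rightarrow> complex) \<Rightarrow> bool" where
  "trace_rel f h \<longleftrightarrow> h \<in> L2_space \<mu> \<and> (\<exists>s. (\<forall>n. s n \<in> C0_infinity) \<and>
     (\<lambda>n. H1.N (\<lambda>x. s n x - f x)) \<longlonglongrightarrow> 0 \<and> (\<lambda>n. L2_norm \<mu> (\<lambda>x. s n x - h x)) \<longlonglongrightarrow> 0)"

lemma trace_rel_L2: "trace_rel f h \<Longrightarrow> h \<in> L2_space \<mu>"
  by (simp add: trace_rel_def)

lemma trace_relE:
  assumes "trace_rel f h"
  obtains s where "\<forall>n. s n \<in> C0_infinity" "(\<lambda>n. H1.N (\<lambda>x. s n x - f x)) \<longlonglongrightarrow> 0" "(\<lambda>n. L2_norm \<mu> (\<lambda>x. s n x - h x)) \<longlonglongrightarrow> 0"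
  using assms unfolding trace_rel_def by (elim conjE exE)

lemma trace_relI:
  assumes "h \<in> L2_space \<mu>" "\<forall>n. s n \<in> C0_infinity" "(\<lambda>n. H1.N (\<lambda>x. s n x - f x)) \<longlonglongrightarrow> 0" "(\<lambda>n. L2_norm \<mu> (\<lambda>x. s n x - h x)) \<longlonglongrightarrow> 0"
  shows "trace_rel f h"
  unfolding trace_rel_def by (intro conjI exI[of _ s] assms)

lemma trace_rel_exists:
  assumes f: "f \<in> H1"
  shows "\<exists>h. trace_rel f h"
proof (rule C0_dense_H1[OF f])
  fix s :: "nat \<Rightarrow> 'a \<Rightarrow> complex"
  assume s: "\<And>n. s n \<in> C0_infinity" and lim: "(\<lambda>n. H1.N (\<lambda>x. s n x - f x)) \<longlonglongrightarrow> 0"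
  have c: "H1.cauchy s" by (rule H1.cauchy_convergent[OF C0_H1[OF s] f lim])
  have "L2.cauchy \<mu> s"
    by (rule H1.cauchy_mono[OF semi_ip_L2 c C_nonneg], unfold L2_norm_eq) (intro bound C0_diff s)
  from L2.complete[OF C0_L2[OF radon s] this]
  obtain h where "h \<in> L2_space \<mu>" "(\<lambda>n. L2_norm \<mu> (\<lambda>x. s n x - h x)) \<longlonglongrightarrow> 0" by (elim bexE)
  then show ?thesis using s lim by (intro exI[of _ h] trace_relI[of h s]) auto
qed

lemma trace_rel_add:
  assumes "f \<in> H1" "g \<in> H1" "trace_rel f h" "trace_rel g k"
  shows "trace_rel (\<lambda>x. f x + g x) (\<lambda>x. h x + k x)"
proof (rule trace_relE[OF assms(3)], rule trace_relE[OF assms(4)])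
  fix s t :: "nat \<Rightarrow> 'a \<Rightarrow> complex"
  assume s: "\<forall>n. s n \<in> C0_infinity" "(\<lambda>n. H1.N (\<lambda>x. s n x - f x)) \<longlonglongrightarrow> 0" "(\<lambda>n. L2_norm \<mu> (\<lambda>x. s n x - h x)) \<longlonglongrightarrow> 0"
    and t: "\<forall>n. t n \<in> C0_infinity" "(\<lambda>n. H1.N (\<lambda>x. t n x - g x)) \<longlonglongrightarrow> 0" "(\<lambda>n. L2_norm \<mu> (\<lambda>x. t n x - k x)) \<longlonglongrightarrow> 0"
  note s1 = s(1)[rule_format] and t1 = t(1)[rule_format]
  note hk = trace_rel_L2[OF assms(3)] trace_rel_L2[OF assms(4)]
  show ?thesis
  proof (rule trace_relI[of _ "\<lambda>n x. s n x + t n x"])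
    show "(\<lambda>x. h x + k x) \<in> L2_space \<mu>" by (intro L2.add_mem hk)
    show "\<forall>n. (\<lambda>x. s n x + t n x) \<in> C0_infinity" using s1 t1 C0_add by blast
    show "(\<lambda>n. H1.N (\<lambda>x. (s n x + t n x) - (f x + g x))) \<longlonglongrightarrow> 0"
      by (rule H1.N_tendsto_add[OF C0_H1[OF s1] assms(1) C0_H1[OF t1] assms(2) s(2) t(2)])
    show "(\<lambda>n. L2_norm \<mu> (\<lambda>x. (s n x + t n x) - (h x + k x))) \<longlonglongrightarrow> 0"
      by (rule L2.N_tendsto_add[OF C0_L2[OF radon s1] hk(1) C0_L2[OF radon t1] hk(2) s(3) t(3)])
  qed
qed

lemma trace_rel_scale:
  assumes "f \<in> H1" "trace_rel f h"
  shows "trace_rel (\<lambda>x. c * f x) (\<lambda>x. c * h x)"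
proof (rule trace_relE[OF assms(2)])
  fix s :: "nat \<Rightarrow> 'a \<Rightarrow> complex"
  assume s: "\<forall>n. s n \<in> C0_infinity" "(\<lambda>n. H1.N (\<lambda>x. s n x - f x)) \<longlonglongrightarrow> 0" "(\<lambda>n. L2_norm \<mu> (\<lambda>x. s n x - h x)) \<longlonglongrightarrow> 0"
  note s1 = s(1)[rule_format]
  note h = trace_rel_L2[OF assms(2)]
  show ?thesis
  proof (rule trace_relI[of _ "\<lambda>n x. c * s n x"])
    show "(\<lambda>x. c * h x) \<in> L2_space \<mu>" by (intro L2.scale_mem h)
    show "\<forall>n. (\<lambda>x. c * s n x) \<in> C0_infinity" using s1 C0_scale by blast
    show "(\<lambda>n. H1.N (\<lambda>x. c * s n x - c * f x)) \<longlonglongrightarrow> 0"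
      by (rule H1.N_tendsto_scale[OF C0_H1[OF s1] assms(1) s(2)])
    show "(\<lambda>n. L2_norm \<mu> (\<lambda>x. c * s n x - c * h x)) \<longlonglongrightarrow> 0"
      by (rule L2.N_tendsto_scale[OF C0_L2[OF radon s1] h s(3)])
  qed
qed

lemma trace_rel_bound:
  assumes f: "f \<in> H1" and h: "trace_rel f h"
  shows "L2_norm \<mu> h \<le> C * H1.N f"
proof (rule trace_relE[OF h])
  fix s :: "nat \<Rightarrow> 'a \<Rightarrow> complex"
  assume s: "\<forall>n. s n \<in> C0_infinity" "(\<lambda>n. H1.N (\<lambda>x. s n x - f x)) \<longlonglongrightarrow> 0" "(\<lambda>n. L2_norm \<mu> (\<lambda>x. s n x - h x)) \<longlonglongrightarrow> 0"
  note s1 = s(1)[rule_format]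
  show ?thesis
  proof (rule LIMSEQ_le)
    show "(\<lambda>n. L2_norm \<mu> (s n)) \<longlonglongrightarrow> L2_norm \<mu> h"
      by (rule L2.N_tendsto[OF C0_L2[OF radon s1] trace_rel_L2[OF h] s(3)])
    show "(\<lambda>n. C * H1.N (s n)) \<longlonglongrightarrow> C * H1.N f"
      by (intro tendsto_intros H1.N_tendsto[OF C0_H1[OF s1] f s(2)])
    show "\<exists>n0. \<forall>n\<ge>n0. L2_norm \<mu> (s n) \<le> C * H1.N (s n)" using bound[OF s1] by blast
  qed
qed

lemma trace_rel_unique:
  assumes f: "f \<in> H1" and "trace_rel f h" "trace_rel f k"
  shows "AE x in \<mu>. h x = k x"
proof -
  have "trace_rel (\<lambda>x. f x + (-1) * f x) (\<lambda>x. h x + (-1) * k x)"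
    by (intro trace_rel_add trace_rel_scale fun_subspaceD(3)[OF fun_subspace_H1] assms)
  then have 0: "trace_rel (\<lambda>x. 0) (\<lambda>x. h x - k x)" by simp
  have "L2_norm \<mu> (\<lambda>x. h x - k x) = 0"
    using trace_rel_bound[OF H1.zero_mem 0] L2.N_nonneg[OF trace_rel_L2[OF 0]] by (simp add: H1.N_zero)
  then show ?thesis by (simp add: L2_norm_eq_0_iff trace_rel_L2[OF 0])
qed

text \<open>A selection from \<open>trace_rel\<close> shows that the \<open>SOME\<close> in
  \<open>trace_map\<close> has a witness. Afterwards the trace is known only through the properties
  in \<open>is_trace_map\<close>, among them a bound with an unspecified constant.\<close>

lemma trace_map_exists: "is_trace_map \<mu> (trace_map \<mu>)"
proof -
  define J where "J f = (SOME h. trace_rel f h)" for f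
  have J: "trace_rel f (J f)" if "f \<in> H1" for f
    unfolding J_def using trace_rel_exists[OF that] by (rule someI_ex)
  have "is_trace_map \<mu> J"
    unfolding is_trace_map_def
  proof (intro conjI ballI allI exI[of _ C])
    fix f :: "'a \<Rightarrow> complex" and c assume f: "f \<in> H1"
    show "J f \<in> L2_space \<mu>" by (rule trace_rel_L2[OF J[OF f]])
    show "L2_norm \<mu> (J f) \<le> C * H1_norm f"
      using trace_rel_bound[OF f J[OF f]] by (simp add: H1_N_eq f)
    show "AE x in \<mu>. J (\<lambda>y. c * f y) x = c * J f x"
      by (rule trace_rel_unique[OF H1.scale_mem[OF f] J[OF H1.scale_mem[OF f]] trace_rel_scale[OF f J[OF f]]])
    fix g :: "'a \<Rightarrow> complex" assume g: "g \<in> H1"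
    show "AE x in \<mu>. J (\<lambda>y. f y + g y) x = J f x + J g x"
      by (rule trace_rel_unique[OF H1.add_mem[OF f g] J[OF H1.add_mem[OF f g]] trace_rel_add[OF f g J[OF f] J[OF g]]])
  next
    fix f :: "'a \<Rightarrow> complex" assume f: "f \<in> C0_infinity"
    have "trace_rel f f"
      by (rule trace_relI[of _ "\<lambda>n. f"]) (auto simp: H1.N_zero L2.N_zero f intro: C0_L2[OF radon f])
    then show "AE x in \<mu>. J f x = f x"
      by (rule trace_rel_unique[OF C0_H1[OF f] J[OF C0_H1[OF f]]])
  qed
  then show ?thesis unfolding trace_map_def by (rule someI[of _ J])
qed

lemma ae_linear_trace_map: "ae_linear \<mu> H1 (trace_map \<mu>)"
  using trace_map_exists unfolding is_trace_map_def ae_linear_def by blast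

text \<open>Both sides are continuous in the H^1 norm, so the inequality passes from test functions
  to H^1 by density. Continuity of the left side comes from the bound \<open>D\<close> that belongs
  to \<open>trace_map\<close> itself.\<close>

lemma trace_map_inequality:
  assumes ineq: "\<And>\<phi>. \<phi> \<in> C0_infinity \<Longrightarrow> (L2_norm \<mu> \<phi>)\<^sup>2 \<le> \<eta> * ((H1.N \<phi>)\<^sup>2 + \<beta> * (L2_norm lborel \<phi>)\<^sup>2)"
    and f: "f \<in> H1"
  shows "(L2_norm \<mu> (trace_map \<mu> f))\<^sup>2 \<le> \<eta> * ((H1.N f)\<^sup>2 + \<beta> * (L2_norm lborel f)\<^sup>2)"
proof (rule C0_dense_H1[OF f])
  let ?J = "trace_map \<mu>"
  note J = ae_linear_trace_map
  fix s :: "nat \<Rightarrow> 'a \<Rightarrow> complex"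
  assume s: "\<And>n. s n \<in> C0_infinity" and lim: "(\<lambda>n. H1.N (\<lambda>x. s n x - f x)) \<longlonglongrightarrow> 0"
  obtain D where D: "\<And>f. f \<in> H1 \<Longrightarrow> L2_norm \<mu> (?J f) \<le> D * H1_norm f"
    using trace_map_exists unfolding is_trace_map_def by blast
  note sH = C0_H1[OF s]
  note Js = ae_linearD(1)[OF J sH] and Jf = ae_linearD(1)[OF J f]
  have limJ: "(\<lambda>n. L2_norm \<mu> (\<lambda>x. ?J (s n) x - ?J f x)) \<longlonglongrightarrow> 0"
  proof (rule Lim_null_comparison)
    show "(\<lambda>n. D * H1.N (\<lambda>x. s n x - f x)) \<longlonglongrightarrow> 0"
      using tendsto_mult[OF tendsto_const[of D] lim] by simp
    have "norm (L2_norm \<mu> (\<lambda>x. ?J (s n) x - ?J f x)) \<le> D * H1.N (\<lambda>x. s n x - f x)" for n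
    proof -
      note d = H1.diff_mem[OF sH[of n] f]
      have "L2_norm \<mu> (\<lambda>x. ?J (s n) x - ?J f x) = L2_norm \<mu> (?J (\<lambda>x. s n x - f x))"
      proof (rule L2_norm_cong[OF L2.diff_mem[OF Js Jf] ae_linearD(1)[OF J d]])
        show "AE x in \<mu>. ?J (s n) x - ?J f x = ?J (\<lambda>x. s n x - f x) x"
          using ae_linear_diff[OF J fun_subspace_H1 sH[of n] f] by eventually_elim simp
      qed
      then show ?thesis using D[OF d] L2.N_nonneg[OF L2.diff_mem[OF Js[of n] Jf]] by (simp add: H1_N_eq d)
    qed
    then show "\<forall>\<^sub>F n in sequentially. norm (L2_norm \<mu> (\<lambda>x. ?J (s n) x - ?J f x)) \<le> D * H1.N (\<lambda>x. s n x - f x)"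
      by simp
  qed
  have "L2_norm \<mu> (?J (s n)) = L2_norm \<mu> (s n)" for n
    by (rule L2_norm_cong[OF Js C0_L2[OF radon s]])
      (use trace_map_exists s in \<open>auto simp: is_trace_map_def\<close>)
  then have le: "(L2_norm \<mu> (?J (s n)))\<^sup>2 \<le> \<eta> * ((H1.N (s n))\<^sup>2 + \<beta> * (L2_norm lborel (s n))\<^sup>2)" for n
    using ineq[OF s] by simp
  have limL: "(\<lambda>n. L2_norm lborel (\<lambda>x. s n x - f x)) \<longlonglongrightarrow> 0"
  proof (rule Lim_null_comparison[OF _ lim], intro always_eventually allI)
    fix n
    show "norm (L2_norm lborel (\<lambda>x. s n x - f x)) \<le> H1.N (\<lambda>x. s n x - f x)"
      using L2_norm_le_H1[OF H1.diff_mem[OF sH[of n] f]] L2.N_nonneg[OF H1_L2[OF H1.diff_mem[OF sH[of n] f]]] by simp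
  qed
  show ?thesis
  proof (rule LIMSEQ_le)
    show "(\<lambda>n. (L2_norm \<mu> (?J (s n)))\<^sup>2) \<longlonglongrightarrow> (L2_norm \<mu> (?J f))\<^sup>2"
      by (intro tendsto_power L2.N_tendsto[OF Js Jf limJ])
    show "(\<lambda>n. \<eta> * ((H1.N (s n))\<^sup>2 + \<beta> * (L2_norm lborel (s n))\<^sup>2)) \<longlonglongrightarrow> \<eta> * ((H1.N f)\<^sup>2 + \<beta> * (L2_norm lborel f)\<^sup>2)"
      by (intro tendsto_intros H1.N_tendsto[OF sH f lim] L2.N_tendsto[OF H1_L2[OF sH] H1_L2[OF f] limL])
    show "\<exists>n0. \<forall>n\<ge>n0. (L2_norm \<mu> (?J (s n)))\<^sup>2 \<le> \<eta> * ((H1.N (s n))\<^sup>2 + \<beta> * (L2_norm lborel (s n))\<^sup>2)"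
      using le by blast
  qed
qed

end

section \<open>Resolvents of the form operators\<close>

lemma ae_linear_sign_op:
  assumes "ae_linear \<mu> V J" "B \<in> sets \<mu>"
  shows "ae_linear \<mu> V (\<lambda>f. sign_op B (J f))"
  unfolding ae_linear_def
proof (intro conjI ballI allI)
  fix f c assume f: "f \<in> V"
  note Jf = ae_linearD(1)[OF assms(1) f]
  note [measurable] = L2_spaceD(1)[OF Jf] assms(2)
  have "sign_op B (J f) \<in> borel_measurable \<mu>" unfolding sign_op_def by measurable
  moreover have "(\<lambda>x. (cmod (sign_op B (J f) x))\<^sup>2) = (\<lambda>x. (cmod (J f x))\<^sup>2)"
    by (auto simp: sign_op_def fun_eq_iff)
  ultimately show "sign_op B (J f) \<in> L2_space \<mu>" using L2_spaceD(2)[OF Jf] by (simp add: L2_space_def)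
  show "AE x in \<mu>. sign_op B (J (\<lambda>y. c * f y)) x = c * sign_op B (J f) x"
    using ae_linearD(3)[OF assms(1) f, of c] by eventually_elim (simp add: sign_op_def)
  fix g assume g: "g \<in> V"
  show "AE x in \<mu>. sign_op B (J (\<lambda>y. f y + g y)) x = sign_op B (J f) x + sign_op B (J g) x"
    using ae_linearD(2)[OF assms(1) f g] by eventually_elim (simp add: sign_op_def)
qed

lemma L2_norm_sign_op: "L2_norm \<mu> (sign_op B h) = L2_norm \<mu> h"
proof -
  have "(\<lambda>x. (cmod (sign_op B h x))\<^sup>2) = (\<lambda>x. (cmod (h x))\<^sup>2)" by (auto simp: sign_op_def fun_eq_iff)
  then show ?thesis by (simp add: L2_norm_def)
qed

text \<open>The integrand is |h|^2 up to sign. Hence \<open>shifted z \<epsilon> f f\<close> has the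
  form e - z n with e real and n the squared L^2 norm, as the coercivity estimate requires.\<close>

lemma Im_L2_inner_sign_op: "Im (L2_inner \<mu> (sign_op B h) h) = 0"
proof -
  have "sign_op B h x * cnj (h x) = of_real ((if x \<in> B then 1 else -1) * (cmod (h x))\<^sup>2)" for x
    by (simp add: sign_op_def complex_norm_square del: of_real_power)
  then show ?thesis by (simp add: L2_inner_def del: of_real_mult of_real_power)
qed

text \<open>Forgets Radon measures and the construction of the trace; what is left is almost
  everywhere linearity and relative form bound zero. The full H^1 norm stands in for the gradient
  norm, which weakens the assumption and matches the form norms.\<close>

locale small_trace_form =
  fixes \<mu> :: "'a::euclidean_space measure" and J :: "('a \<Rightarrow> complex) \<Rightarrow> 'a \<Rightarrow> complex" and B :: "'a set"
  assumes J: "ae_linear \<mu> H1 J"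
    and B: "B \<in> sets \<mu>"
    and small: "0 < \<eta> \<Longrightarrow> \<exists>\<beta>\<ge>0. \<forall>f\<in>H1. (L2_norm \<mu> (J f))\<^sup>2 \<le> \<eta> * ((H1.N f)\<^sup>2 + \<beta> * (L2_norm lborel f)\<^sup>2)"
begin

definition trace_form :: "('a \<Rightarrow> complex) \<Rightarrow> ('a \<Rightarrow> complex) \<Rightarrow> complex" where
  "trace_form f g = L2_inner \<mu> (sign_op B (J f)) (J g)"

text \<open>The energy form minus \<open>z\<close> times the L^2 product; the shift is 1 + z since
  \<open>form_ip\<close> already contains one copy of that product.\<close>

definition shifted :: "complex \<Rightarrow> real \<Rightarrow> ('a \<Rightarrow> complex) \<Rightarrow> ('a \<Rightarrow> complex) \<Rightarrow> complex" where
  "shifted z \<epsilon> f g = form_ip \<epsilon> f g + trace_form f g - (1 + z) * L2_inner lborel f g"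

lemma J_L2: "f \<in> H1 \<Longrightarrow> J f \<in> L2_space \<mu>"
  by (rule ae_linearD(1)[OF J])

lemma sesquilinear_trace_form: "sesquilinear H1 trace_form"
  unfolding trace_form_def[abs_def]
  by (rule sesquilinear_pullback[OF ae_linear_sign_op[OF J B] J fun_subspace_H1])

lemma trace_form_bound:
  assumes "f \<in> H1" "g \<in> H1"
  shows "cmod (trace_form f g) \<le> L2_norm \<mu> (J f) * L2_norm \<mu> (J g)"
  using L2.Cauchy_Schwarz[OF ae_linearD(1)[OF ae_linear_sign_op[OF J B] assms(1)] J_L2[OF assms(2)]]
  by (simp add: trace_form_def L2_norm_sign_op)

lemma J_bounded:
  obtains K where "0 \<le> K" "\<And>f. f \<in> H1 \<Longrightarrow> L2_norm \<mu> (J f) \<le> K * H1.N f"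
proof -
  obtain \<beta> where \<beta>: "\<beta> \<ge> 0" "\<And>f. f \<in> H1 \<Longrightarrow> (L2_norm \<mu> (J f))\<^sup>2 \<le> (H1.N f)\<^sup>2 + \<beta> * (L2_norm lborel f)\<^sup>2"
    using small[of 1] by auto
  have "L2_norm \<mu> (J f) \<le> sqrt (1 + \<beta>) * H1.N f" if f: "f \<in> H1" for f
  proof (rule power2_le_imp_le)
    have "(L2_norm lborel f)\<^sup>2 \<le> (H1.N f)\<^sup>2"
      by (intro power_mono L2_norm_le_H1 f L2.N_nonneg H1_L2)
    from mult_left_mono[OF this \<beta>(1)] \<beta>(2)[OF f]
    have "(L2_norm \<mu> (J f))\<^sup>2 \<le> (H1.N f)\<^sup>2 + \<beta> * (H1.N f)\<^sup>2" by linarith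
    then show "(L2_norm \<mu> (J f))\<^sup>2 \<le> (sqrt (1 + \<beta>) * H1.N f)\<^sup>2"
      using \<beta>(1) by (simp add: power_mult_distrib algebra_simps)
  qed (use \<beta>(1) H1.N_nonneg[OF f] in simp)
  then show thesis using that[of "sqrt (1 + \<beta>)"] \<beta>(1) by simp
qed

lemma sesquilinear_shifted: "sesquilinear (form_domain \<epsilon>) (shifted z \<epsilon>)"
proof -
  have sub: "form_domain \<epsilon> \<subseteq> (H1 :: ('a \<Rightarrow> complex) set)" by (auto intro: form_domain_H1)
  have "shifted z \<epsilon> = (\<lambda>f g. (bilaplacian_form \<epsilon> f g + H1_ip f g) + trace_form f g + (- (1 + z)) * L2_inner lborel f g)"
    by (intro ext) (simp add: shifted_def form_ip_def algebra_simps)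
  then show ?thesis
    by (simp only:)
      (intro sesquilinear_plus sesquilinear_cmult sesquilinear_bilaplacian
        sesquilinear_mono[OF sesquilinear_H1_ip sub] sesquilinear_mono[OF sesquilinear_trace_form sub]
        sesquilinear_mono[OF sesquilinear_pullback[OF ae_linear_id ae_linear_id fun_subspace_H1] sub])
qed

text \<open>\<open>M\<close> may depend on \<open>z\<close> but not on \<epsilon>. The comparison of
  resolvents plays the bound at \<epsilon> = 0 against coercivity at \<epsilon> > 0.\<close>

lemma shifted_bounded:
  obtains M where "0 \<le> M" "\<And>\<epsilon> f g. f \<in> form_domain \<epsilon> \<Longrightarrow> g \<in> form_domain \<epsilon> \<Longrightarrow>
    cmod (shifted z \<epsilon> f g) \<le> M * form.N \<epsilon> f * form.N \<epsilon> g"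
proof -
  obtain K where K: "0 \<le> K" "\<And>f. f \<in> H1 \<Longrightarrow> L2_norm \<mu> (J f) \<le> K * H1.N f" using J_bounded by blast
  have "cmod (shifted z \<epsilon> f g) \<le> (1 + K\<^sup>2 + cmod (1 + z)) * form.N \<epsilon> f * form.N \<epsilon> g"
    if f: "f \<in> form_domain \<epsilon>" and g: "g \<in> form_domain \<epsilon>" for \<epsilon> f g
  proof -
    note fH = form_domain_H1[OF f] and gH = form_domain_H1[OF g]
    note nn = form.N_nonneg[OF f] form.N_nonneg[OF g] H1.N_nonneg[OF fH] H1.N_nonneg[OF gH]
      L2.N_nonneg[OF H1_L2[OF fH]] L2.N_nonneg[OF H1_L2[OF gH]] L2.N_nonneg[OF J_L2[OF fH]] L2.N_nonneg[OF J_L2[OF gH]]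
    have "cmod (shifted z \<epsilon> f g) \<le> cmod (form_ip \<epsilon> f g) + cmod (trace_form f g) + cmod (1 + z) * cmod (L2_inner lborel f g)"
      unfolding shifted_def
      using norm_triangle_ineq4[of "form_ip \<epsilon> f g + trace_form f g" "(1 + z) * L2_inner lborel f g"]
        norm_triangle_ineq[of "form_ip \<epsilon> f g" "trace_form f g"]
      unfolding norm_mult by linarith
    also have "cmod (form_ip \<epsilon> f g) \<le> form.N \<epsilon> f * form.N \<epsilon> g" by (rule form.Cauchy_Schwarz[OF f g])
    also have "cmod (trace_form f g) \<le> (K * form.N \<epsilon> f) * (K * form.N \<epsilon> g)"
    proof -
      have "L2_norm \<mu> (J f) \<le> K * form.N \<epsilon> f" "L2_norm \<mu> (J g) \<le> K * form.N \<epsilon> g"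
        using K(2)[OF fH] K(2)[OF gH] mult_left_mono[OF H1_N_le_form[OF f] K(1)] mult_left_mono[OF H1_N_le_form[OF g] K(1)]
        by linarith+
      then have "L2_norm \<mu> (J f) * L2_norm \<mu> (J g) \<le> (K * form.N \<epsilon> f) * (K * form.N \<epsilon> g)"
        using nn K(1) by (intro mult_mono) auto
      then show ?thesis using trace_form_bound[OF fH gH] by linarith
    qed
    also have "cmod (1 + z) * cmod (L2_inner lborel f g) \<le> cmod (1 + z) * (form.N \<epsilon> f * form.N \<epsilon> g)"
    proof (rule mult_left_mono)
      have "L2_norm lborel f * L2_norm lborel g \<le> form.N \<epsilon> f * form.N \<epsilon> g"
        using nn by (intro mult_mono L2_norm_le_form f g) auto
      then show "cmod (L2_inner lborel f g) \<le> form.N \<epsilon> f * form.N \<epsilon> g"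
        using L2.Cauchy_Schwarz[OF H1_L2[OF fH] H1_L2[OF gH]] by linarith
    qed simp
    finally show ?thesis by (simp add: algebra_simps power2_eq_square)
  qed
  then show thesis using that[of "1 + K\<^sup>2 + cmod (1 + z)"] by simp
qed

text \<open>
  The form minus \<open>z\<close> takes its values on the diagonal in a shifted sector; rotating by \<open>1 + i b\<close> with
  \<open>b Im z = \<bar>Re z\<bar> + c\<close> moves that sector into the right half plane.
\<close>
lemma shifted_coercive:
  assumes z: "Im z \<noteq> 0"
  obtains \<alpha> where "0 < \<alpha>" "\<And>\<epsilon> f. f \<in> form_domain \<epsilon> \<Longrightarrow> \<alpha> * (form.N \<epsilon> f)\<^sup>2 \<le> cmod (shifted z \<epsilon> f f)"
proof -
  \<comment> \<open>With \<eta> = 1/2 the trace form consumes half of the squared form norm; the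
    other half is left for coercivity.\<close>
  obtain \<beta> where \<beta>: "\<beta> \<ge> 0" "\<And>f. f \<in> H1 \<Longrightarrow> (L2_norm \<mu> (J f))\<^sup>2 \<le> 1/2 * ((H1.N f)\<^sup>2 + \<beta> * (L2_norm lborel f)\<^sup>2)"
    using small[of "1/2"] by auto
  \<comment> \<open>The 1 makes up for the product subtracted in \<open>e\<close>, \<beta> for the
    L^2 part of the trace bound.\<close>
  define c where "c = 1 + \<beta>"
  define b where "b = (\<bar>Re z\<bar> + c) / Im z"
  define w where "w = Complex 1 b"
  have w: "0 < cmod w" by (simp add: w_def complex_eq_iff)
  have "1 / (2 * cmod w) * (form.N \<epsilon> f)\<^sup>2 \<le> cmod (shifted z \<epsilon> f f)" if f: "f \<in> form_domain \<epsilon>" for \<epsilon> f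
  proof -
    note fH = form_domain_H1[OF f]
    define n where "n = (L2_norm lborel f)\<^sup>2"
    define e where "e = (form.N \<epsilon> f)\<^sup>2 + Re (trace_form f f) - n"
    have n: "0 \<le> n" by (simp add: n_def)
    have qr: "trace_form f f = of_real (Re (trace_form f f))"
      using Im_L2_inner_sign_op[of \<mu> B "J f"] by (simp add: trace_form_def complex_eq_iff)
    have sh: "shifted z \<epsilon> f f = of_real e - z * of_real n"
      unfolding shifted_def form.ip_self[OF f] L2.ip_self[OF H1_L2[OF fH]] e_def n_def
      by (subst qr) (simp add: algebra_simps)
    have "\<bar>Re (trace_form f f)\<bar> \<le> (L2_norm \<mu> (J f))\<^sup>2"
      using trace_form_bound[OF fH fH] abs_Re_le_cmod[of "trace_form f f"] by (simp add: power2_eq_square)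
    also have "\<dots> \<le> 1/2 * ((H1.N f)\<^sup>2 + \<beta> * n)" unfolding n_def by (rule \<beta>(2)[OF fH])
    also have "\<dots> \<le> 1/2 * ((form.N \<epsilon> f)\<^sup>2 + 2 * (\<beta> * n))"
    proof -
      have "(H1.N f)\<^sup>2 \<le> (form.N \<epsilon> f)\<^sup>2" by (intro power_mono H1_N_le_form f H1.N_nonneg fH)
      moreover have "0 \<le> \<beta> * n" using \<beta>(1) n by simp
      ultimately show ?thesis by simp
    qed
    finally have e: "(form.N \<epsilon> f)\<^sup>2 / 2 \<le> e + c * n"
      by (simp add: e_def c_def algebra_simps abs_le_iff)
    have "Re (w * shifted z \<epsilon> f f) = e - Re z * n + b * Im z * n"
      by (simp add: sh w_def algebra_simps)
    also have "b * Im z = \<bar>Re z\<bar> + c" using z by (simp add: b_def)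
    also have "e - Re z * n + (\<bar>Re z\<bar> + c) * n = e + c * n + (\<bar>Re z\<bar> - Re z) * n" by (simp add: algebra_simps)
    finally have "e + c * n \<le> Re (w * shifted z \<epsilon> f f)" using n by (simp add: mult_nonneg_nonneg)
    also have "\<dots> \<le> cmod w * cmod (shifted z \<epsilon> f f)"
      using complex_Re_le_cmod[of "w * shifted z \<epsilon> f f"] by (simp add: norm_mult)
    finally have "(form.N \<epsilon> f)\<^sup>2 / 2 \<le> cmod w * cmod (shifted z \<epsilon> f f)" using e by linarith
    then show ?thesis using w by (simp add: field_simps)
  qed
  then show thesis using that[of "1 / (2 * cmod w)"] w by simp
qed

definition form_op :: "real \<Rightarrow> (('a \<Rightarrow> complex) \<times> ('a \<Rightarrow> complex)) set" where
  "form_op \<epsilon> = form_operator (form_domain \<epsilon>) (\<lambda>f g. form_ip \<epsilon> f g + trace_form f g - L2_inner lborel f g)"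

text \<open>Turns the graph formulation into the weak equation. It holds for every resolvent, so
  later estimates do not depend on the one selected by \<open>resolvent\<close>.\<close>

lemma resolvent_equation:
  assumes "is_resolvent (form_op \<epsilon>) z R" "g \<in> L2_space lborel"
  shows "R g \<in> form_domain \<epsilon>" "h \<in> form_domain \<epsilon> \<Longrightarrow> shifted z \<epsilon> (R g) h = L2_inner lborel g h"
proof -
  have R: "R g \<in> L2_space lborel" "(R g, \<lambda>x. g x + z * R g x) \<in> form_op \<epsilon>"
    using assms unfolding is_resolvent_def by blast+
  then show "R g \<in> form_domain \<epsilon>" by (simp add: form_op_def form_operator_def)
  assume h: "h \<in> form_domain \<epsilon>"
  have "form_ip \<epsilon> (R g) h + trace_form (R g) h - L2_inner lborel (R g) h = L2_inner lborel (\<lambda>x. g x + z * R g x) h"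
    using R(2) h by (simp add: form_op_def form_operator_def)
  also have "\<dots> = L2_inner lborel g h + z * L2_inner lborel (R g) h"
    by (simp add: L2.ip_add L2.ip_scale L2.scale_mem assms(2) R(1) H1_L2[OF form_domain_H1[OF h]])
  finally show "shifted z \<epsilon> (R g) h = L2_inner lborel g h"
    by (simp add: shifted_def algebra_simps)
qed

text \<open>Lax-Milgram for the functional h -> (g, h) gives a right inverse with bound 1/\<alpha>.
  It is also a left inverse: the difference of two solutions of the same equation has
  \<open>shifted\<close> value 0 on itself, and coercivity annihilates it.\<close>

lemma resolvent_exists:
  assumes z: "Im z \<noteq> 0"
  shows "\<exists>R. is_resolvent (form_op \<epsilon>) z R"
proof (rule shifted_coercive[OF z], rule shifted_bounded[of z])
  fix \<alpha> M :: real
  assume \<alpha>: "0 < \<alpha>" "\<And>\<epsilon> f. f \<in> form_domain \<epsilon> \<Longrightarrow> \<alpha> * (form.N \<epsilon> f)\<^sup>2 \<le> cmod (shifted z \<epsilon> f f)"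
    and M: "\<And>\<epsilon> f g. f \<in> form_domain \<epsilon> \<Longrightarrow> g \<in> form_domain \<epsilon> \<Longrightarrow>
      cmod (shifted z \<epsilon> f g) \<le> M * form.N \<epsilon> f * form.N \<epsilon> g"
  note S = sesquilinearD[OF sesquilinear_shifted[of \<epsilon> z]]
  have DL: "f \<in> form_domain \<epsilon> \<Longrightarrow> f \<in> L2_space lborel" for f :: "'a \<Rightarrow> complex"
    by (intro H1_L2 form_domain_H1)
  have solve: "\<exists>u. u \<in> form_domain \<epsilon> \<and> (\<forall>h\<in>form_domain \<epsilon>. shifted z \<epsilon> u h = L2_inner lborel g h)"
    if g: "g \<in> L2_space lborel" for g
  proof -
    have "\<exists>u\<in>form_domain \<epsilon>. \<forall>h\<in>form_domain \<epsilon>. shifted z \<epsilon> u h = L2_inner lborel g h"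
    proof (rule form.lax_milgram[where M = M and \<alpha> = \<alpha> and C = "L2_norm lborel g"])
      fix f h k :: "'a \<Rightarrow> complex" and c
      assume f: "f \<in> form_domain \<epsilon>"
      show "\<alpha> * (form.N \<epsilon> f)\<^sup>2 \<le> cmod (shifted z \<epsilon> f f)" by (rule \<alpha>(2)[OF f])
      show "L2_inner lborel g (\<lambda>x. c * f x) = cnj c * L2_inner lborel g f"
        by (rule L2.ip_scale_right[OF DL[OF f] g])
      have "cmod (L2_inner lborel g f) \<le> L2_norm lborel g * L2_norm lborel f"
        by (rule L2.Cauchy_Schwarz[OF g DL[OF f]])
      also have "\<dots> \<le> L2_norm lborel g * form.N \<epsilon> f"
        by (intro mult_left_mono L2_norm_le_form f L2.N_nonneg g)
      finally show "cmod (L2_inner lborel g f) \<le> L2_norm lborel g * form.N \<epsilon> f" .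
      assume h: "h \<in> form_domain \<epsilon>"
      show "L2_inner lborel g (\<lambda>x. f x + h x) = L2_inner lborel g f + L2_inner lborel g h"
        by (rule L2.ip_add_right[OF DL[OF f] DL[OF h] g])
      show "shifted z \<epsilon> (\<lambda>x. c * f x) h = c * shifted z \<epsilon> f h" by (rule S(3)[OF f h])
      show "shifted z \<epsilon> h (\<lambda>x. c * f x) = cnj c * shifted z \<epsilon> h f" by (rule S(4)[OF f h])
      show "cmod (shifted z \<epsilon> f h) \<le> M * form.N \<epsilon> f * form.N \<epsilon> h" by (rule M[OF f h])
      assume k: "k \<in> form_domain \<epsilon>"
      show "shifted z \<epsilon> (\<lambda>x. f x + h x) k = shifted z \<epsilon> f k + shifted z \<epsilon> h k" by (rule S(1)[OF f k h])
      show "shifted z \<epsilon> k (\<lambda>x. f x + h x) = shifted z \<epsilon> k f + shifted z \<epsilon> k h" by (rule S(2)[OF f k h])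
    qed (rule \<alpha>(1))
    then show ?thesis by (simp add: Bex_def)
  qed
  define R where "R g = (SOME u. u \<in> form_domain \<epsilon> \<and> (\<forall>h\<in>form_domain \<epsilon>. shifted z \<epsilon> u h = L2_inner lborel g h))" for g
  have R: "R g \<in> form_domain \<epsilon>" "\<And>h. h \<in> form_domain \<epsilon> \<Longrightarrow> shifted z \<epsilon> (R g) h = L2_inner lborel g h"
    if "g \<in> L2_space lborel" for g
    using someI_ex[OF solve[OF that]] unfolding R_def by auto
  have "is_resolvent (form_op \<epsilon>) z R"
    unfolding is_resolvent_def
  proof (intro conjI ballI exI[of _ "1 / \<alpha>"])
    fix g :: "'a \<Rightarrow> complex" assume g: "g \<in> L2_space lborel"
    note Rg = R(1)[OF g]
    show "R g \<in> L2_space lborel" by (rule DL[OF Rg])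
    have "form_ip \<epsilon> (R g) h + trace_form (R g) h - L2_inner lborel (R g) h = L2_inner lborel (\<lambda>x. g x + z * R g x) h"
      if h: "h \<in> form_domain \<epsilon>" for h
      using R(2)[OF g h]
      by (simp add: shifted_def L2.ip_add L2.ip_scale L2.scale_mem g DL[OF Rg] DL[OF h] algebra_simps)
    moreover have "(\<lambda>x. g x + z * R g x) \<in> L2_space lborel" by (intro L2.add_mem L2.scale_mem g DL[OF Rg])
    ultimately show "(R g, \<lambda>x. g x + z * R g x) \<in> form_op \<epsilon>"
      using Rg by (simp add: form_op_def form_operator_def)
    have "\<alpha> * (form.N \<epsilon> (R g))\<^sup>2 \<le> cmod (L2_inner lborel g (R g))"
      using \<alpha>(2)[OF Rg] R(2)[OF g Rg] by simp
    also have "\<dots> \<le> L2_norm lborel g * L2_norm lborel (R g)" by (rule L2.Cauchy_Schwarz[OF g DL[OF Rg]])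
    also have "\<dots> \<le> L2_norm lborel g * form.N \<epsilon> (R g)"
      by (intro mult_left_mono L2_norm_le_form Rg L2.N_nonneg g)
    finally have "\<alpha> * form.N \<epsilon> (R g) * form.N \<epsilon> (R g) \<le> L2_norm lborel g * form.N \<epsilon> (R g)"
      by (simp add: power2_eq_square)
    then have "\<alpha> * form.N \<epsilon> (R g) \<le> L2_norm lborel g"
      using form.N_nonneg[OF Rg] L2.N_nonneg[OF g] by (cases "form.N \<epsilon> (R g) = 0") auto
    then have "form.N \<epsilon> (R g) \<le> 1 / \<alpha> * L2_norm lborel g" using \<alpha>(1) by (simp add: field_simps)
    then show "L2_norm lborel (R g) \<le> 1 / \<alpha> * L2_norm lborel g"
      using L2_norm_le_form[OF Rg] by linarith
  next
    fix p assume p: "p \<in> form_op \<epsilon>"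
    obtain f g where fg: "p = (f, g)" by (cases p)
    then have f: "f \<in> form_domain \<epsilon>" and g: "g \<in> L2_space lborel"
      and eq: "\<And>h. h \<in> form_domain \<epsilon> \<Longrightarrow> form_ip \<epsilon> f h + trace_form f h - L2_inner lborel f h = L2_inner lborel g h"
      using p by (auto simp: form_op_def form_operator_def)
    let ?G = "\<lambda>y. g y - z * f y"
    have G: "?G \<in> L2_space lborel" by (intro L2.diff_mem L2.scale_mem g DL[OF f])
    let ?d = "\<lambda>x. R ?G x - f x"
    have d: "?d \<in> form_domain \<epsilon>" by (rule form.diff_mem[OF R(1)[OF G] f])
    have "shifted z \<epsilon> ?d ?d = shifted z \<epsilon> (R ?G) ?d - shifted z \<epsilon> f ?d"
      by (rule sesquilinear_diff(1)[OF sesquilinear_shifted fun_subspace_form_domain R(1)[OF G] f d])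
    also have "\<dots> = 0"
      unfolding R(2)[OF G d] using eq[OF d]
      by (simp add: shifted_def L2.ip_diff L2.ip_scale L2.scale_mem g DL[OF f] DL[OF d] algebra_simps)
    finally have "\<alpha> * (form.N \<epsilon> ?d)\<^sup>2 \<le> 0" using \<alpha>(2)[OF d] by simp
    then have "form.N \<epsilon> ?d = 0" using \<alpha>(1) by (simp add: mult_le_0_iff)
    then have "L2_norm lborel ?d = 0" using L2_norm_le_form[OF d] L2.N_nonneg[OF DL[OF d]] by simp
    then show "case p of (f, g) \<Rightarrow> AE x in lborel. R (\<lambda>y. g y - z * f y) x = f x"
      by (simp add: fg L2_norm_eq_0_iff DL[OF d])
  qed
  then show ?thesis by (rule exI[of _ R])
qed

end

section \<open>Norm resolvent convergence\<close>

lemma le_if_square_le_mult: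
  fixes a b :: real
  assumes "a * a \<le> b * a" "0 \<le> a" "0 \<le> b"
  shows "a \<le> b"
  using assms by (cases "a = 0") auto

text \<open>Duality argument: by elliptic regularity, \<open>(1 - \<Delta>)\<inverse> r\<close> is an admissible test function in \<open>H\<^sup>2\<close>.\<close>
lemma H1_dual_bound:
  assumes r: "r \<in> H1" and w: "w \<in> H2" and \<epsilon>: "0 < \<epsilon>"
    and eq: "\<And>h. h \<in> H2 \<Longrightarrow> H1_ip r h = bilaplacian_form \<epsilon> w h"
  shows "L2_norm lborel r \<le> 2 * \<epsilon>\<^sup>2 * L2_norm lborel (weak_laplacian w)"
proof -
  note rL = H1_L2[OF r]
  have "\<exists>p\<in>H1. \<forall>h\<in>H1. H1_ip p h = L2_inner lborel r h"
  proof (rule H1.riesz)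
    fix f g :: "'a \<Rightarrow> complex" and c assume f: "f \<in> H1"
    show "L2_inner lborel r (\<lambda>x. c * f x) = cnj c * L2_inner lborel r f"
      by (rule L2.ip_scale_right[OF H1_L2[OF f] rL])
    show "cmod (L2_inner lborel r f) \<le> L2_norm lborel r * H1.N f"
      using L2.Cauchy_Schwarz[OF rL H1_L2[OF f]] mult_left_mono[OF L2_norm_le_H1[OF f] L2.N_nonneg[OF rL]] by linarith
    assume g: "g \<in> H1"
    show "L2_inner lborel r (\<lambda>x. f x + g x) = L2_inner lborel r f + L2_inner lborel r g"
      by (rule L2.ip_add_right[OF H1_L2[OF f] H1_L2[OF g] rL])
  qed
  then obtain p where p: "p \<in> H1" "\<And>h. h \<in> H1 \<Longrightarrow> H1_ip p h = L2_inner lborel r h" by auto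
  note pL = H1_L2[OF p(1)]
  have weak: "(\<Sum>b\<in>Basis. \<integral>x. weak_partial b p x * partial_deriv b \<phi> x \<partial>lborel) = - (\<integral>x. (p x - r x) * \<phi> x \<partial>lborel)"
    if \<phi>: "\<phi> \<in> C0_infinity" for \<phi>
  proof -
    have *: "a + S = b \<Longrightarrow> D = a - b \<Longrightarrow> S = - D" for a b S D :: complex by auto
    have "H1_ip p (\<lambda>x. cnj (\<phi> x)) = (\<integral>x. r x * \<phi> x \<partial>lborel)"
      using p(2)[OF C0_H1[OF C0_cnj[OF \<phi>]]] by (simp add: L2_inner_def)
    then have 1: "(\<integral>x. p x * \<phi> x \<partial>lborel) + (\<Sum>b\<in>Basis. \<integral>x. weak_partial b p x * partial_deriv b \<phi> x \<partial>lborel) = (\<integral>x. r x * \<phi> x \<partial>lborel)"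
      unfolding H1_ip_C0[OF p(1) \<phi>] H1_pair_test[OF p(1) \<phi>] .
    have 2: "(\<integral>x. (p x - r x) * \<phi> x \<partial>lborel) = (\<integral>x. p x * \<phi> x \<partial>lborel) - (\<integral>x. r x * \<phi> x \<partial>lborel)"
      by (simp add: left_diff_distrib Bochner_Integration.integral_diff L2_C0_integrable pL rL \<phi>)
    show ?thesis by (rule *[OF 1 2])
  qed
  have reg: "p \<in> H2" "AE x in lborel. weak_laplacian p x = p x - r x"
    by (rule elliptic_regularity[OF p(1) L2.diff_mem[OF pL rL]], rule weak, assumption)+
  have "H1.N p * H1.N p = Re (L2_inner lborel r p)"
    using H1.N_sq[OF p(1)] p(2)[OF p(1)] by (simp add: power2_eq_square)
  also have "\<dots> \<le> L2_norm lborel r * L2_norm lborel p"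
    using L2.Cauchy_Schwarz[OF rL pL] complex_Re_le_cmod order_trans by blast
  also have "\<dots> \<le> L2_norm lborel r * H1.N p"
    by (intro mult_left_mono L2_norm_le_H1 p L2.N_nonneg rL)
  finally have "H1.N p \<le> L2_norm lborel r"
    using H1.N_nonneg[OF p(1)] L2.N_nonneg[OF rL] by (rule le_if_square_le_mult)
  then have pr: "L2_norm lborel p \<le> L2_norm lborel r" using L2_norm_le_H1[OF p(1)] by linarith
  \<comment> \<open>Since \<Delta> p = p - r and |p| \<le> |r| in L^2; this is the origin of the
    factor 2.\<close>
  have "L2_norm lborel (weak_laplacian p) = L2_norm lborel (\<lambda>x. p x - r x)"
    by (rule L2_norm_cong[OF weak_laplacian_L2[OF reg(1)] L2.diff_mem[OF pL rL] reg(2)])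
  also have "\<dots> \<le> L2_norm lborel p + L2_norm lborel r"
    using L2.N_triangle[OF pL L2.scale_mem[OF rL, of "-1"]] L2.N_scale[OF rL, of "-1"] by simp
  finally have lap: "L2_norm lborel (weak_laplacian p) \<le> 2 * L2_norm lborel r" using pr by linarith
  \<comment> \<open>By the choice of \<open>p\<close>, |r|^2 is the H^1 product of \<open>p\<close>
    and \<open>r\<close>. As \<open>p\<close> is now known to be in H^2, the hypothesis turns its
    real part into that of \<epsilon>^2 (\<Delta> w, \<Delta> p).\<close>
  have "L2_norm lborel r * L2_norm lborel r = Re (L2_inner lborel r r)"
    using Re_L2_inner_self[OF rL] by (simp add: power2_eq_square)
  also have "\<dots> = Re (bilaplacian_form \<epsilon> w p)"
    using p(2)[OF r] Re_H1_ip_commute[OF p(1) r] eq[OF reg(1)] by simp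
  also have "\<dots> = \<epsilon>\<^sup>2 * Re (L2_inner lborel (weak_laplacian w) (weak_laplacian p))"
    using \<epsilon> by (simp add: bilaplacian_form_def del: of_real_power)
  also have "\<dots> \<le> \<epsilon>\<^sup>2 * (L2_norm lborel (weak_laplacian w) * (2 * L2_norm lborel r))"
  proof (rule mult_left_mono)
    have "Re (L2_inner lborel (weak_laplacian w) (weak_laplacian p))
        \<le> L2_norm lborel (weak_laplacian w) * L2_norm lborel (weak_laplacian p)"
      using L2.Cauchy_Schwarz[OF weak_laplacian_L2[OF w] weak_laplacian_L2[OF reg(1)]] complex_Re_le_cmod order_trans by blast
    also have "\<dots> \<le> L2_norm lborel (weak_laplacian w) * (2 * L2_norm lborel r)"
      by (intro mult_left_mono lap L2.N_nonneg weak_laplacian_L2 w)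
    finally show "Re (L2_inner lborel (weak_laplacian w) (weak_laplacian p)) \<le> \<dots>" .
  qed simp
  finally have "L2_norm lborel r * L2_norm lborel r \<le> (2 * \<epsilon>\<^sup>2 * L2_norm lborel (weak_laplacian w)) * L2_norm lborel r"
    by (simp add: mult_ac)
  moreover have "0 \<le> 2 * \<epsilon>\<^sup>2 * L2_norm lborel (weak_laplacian w)"
    by (intro mult_nonneg_nonneg L2.N_nonneg weak_laplacian_L2 w) auto
  ultimately show ?thesis by (rule le_if_square_le_mult[OF _ L2.N_nonneg[OF rL]])
qed

text \<open>Riesz on the form domain solves the Euler-Lagrange equation of the minimisation, (w,
  h)_1 + \<epsilon>^2 (\<Delta> w, \<Delta> h) = (v, h)_1 for h in H^2. In terms of the residual r =
  v - w this reads (r, h)_1 = \<epsilon>^2 (\<Delta> w, \<Delta> h), the hypothesis of the duality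
  bound.\<close>

lemma smooth_approximation:
  assumes v: "v \<in> H1" and \<epsilon>: "0 < \<epsilon>"
  obtains w where "w \<in> H2" "H1.N (\<lambda>x. v x - w x) \<le> H1.N v"
    "L2_norm lborel (\<lambda>x. v x - w x) \<le> 2 * \<epsilon> * H1.N v"
    "(H1.N (\<lambda>x. v x - w x))\<^sup>2 + (\<epsilon> * L2_norm lborel (weak_laplacian w))\<^sup>2 \<le> Re (H1_ip v (\<lambda>x. v x - w x))"
proof -
  have "\<exists>w\<in>form_domain \<epsilon>. \<forall>h\<in>form_domain \<epsilon>. form_ip \<epsilon> w h = H1_ip v h"
  proof (rule form.riesz)
    fix f g :: "'a \<Rightarrow> complex" and c assume f: "f \<in> form_domain \<epsilon>"
    note fH = form_domain_H1[OF f]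
    show "H1_ip v (\<lambda>x. c * f x) = cnj c * H1_ip v f" by (rule H1.ip_scale_right[OF fH v])
    show "cmod (H1_ip v f) \<le> H1.N v * form.N \<epsilon> f"
      using H1.Cauchy_Schwarz[OF v fH] mult_left_mono[OF H1_N_le_form[OF f] H1.N_nonneg[OF v]] by linarith
    assume g: "g \<in> form_domain \<epsilon>"
    show "H1_ip v (\<lambda>x. f x + g x) = H1_ip v f + H1_ip v g" by (rule H1.ip_add_right[OF fH form_domain_H1[OF g] v])
  qed
  then obtain w where w: "w \<in> form_domain \<epsilon>" "\<And>h. h \<in> form_domain \<epsilon> \<Longrightarrow> form_ip \<epsilon> w h = H1_ip v h" by auto
  have D: "form_domain \<epsilon> = (H2 :: ('a \<Rightarrow> complex) set)" using \<epsilon> by (simp add: form_domain_def)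
  have w2: "w \<in> H2" using w(1) by (simp add: D)
  note wH = H2_H1[OF w2]
  let ?r = "\<lambda>x. v x - w x"
  have r: "?r \<in> H1" by (rule H1.diff_mem[OF v wH])
  have eq: "H1_ip ?r h = bilaplacian_form \<epsilon> w h" if h: "h \<in> H2" for h
    using w(2)[of h] h H1.ip_diff[OF v wH H2_H1[OF h]] by (simp add: D form_ip_def diff_eq_eq)
  let ?l = "L2_norm lborel (weak_laplacian w)"
  \<comment> \<open>Split (r, r)_1 into (r, v)_1 - (r, w)_1 and test the residual equation with
    \<open>w\<close>.\<close>
  have "(H1.N ?r)\<^sup>2 = Re (H1_ip ?r v) - Re (H1_ip ?r w)"
    unfolding H1.N_sq[OF r] H1.ip_diff_right[OF v wH r] by simp
  also have "Re (H1_ip ?r w) = (\<epsilon> * ?l)\<^sup>2"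
    unfolding eq[OF w2] bilaplacian_self[OF w(1)] using \<epsilon> by (simp add: power_mult_distrib)
  finally have c: "(H1.N ?r)\<^sup>2 + (\<epsilon> * ?l)\<^sup>2 = Re (H1_ip v ?r)"
    using Re_H1_ip_commute[OF r v] by simp
  have cs: "Re (H1_ip v ?r) \<le> H1.N v * H1.N ?r"
    using H1.Cauchy_Schwarz[OF v r] complex_Re_le_cmod order_trans by blast
  have "H1.N ?r * H1.N ?r \<le> H1.N v * H1.N ?r"
    using c cs zero_le_power2[of "\<epsilon> * ?l"] unfolding power2_eq_square[of "H1.N ?r"] by linarith
  then have a: "H1.N ?r \<le> H1.N v"
    using H1.N_nonneg[OF r] H1.N_nonneg[OF v] by (rule le_if_square_le_mult)
  have "(\<epsilon> * ?l)\<^sup>2 \<le> (H1.N v)\<^sup>2"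
    using c cs zero_le_power2[of "H1.N ?r"] mult_left_mono[OF a H1.N_nonneg[OF v]] unfolding power2_eq_square[of "H1.N v"] by linarith
  then have "\<epsilon> * ?l \<le> H1.N v" using H1.N_nonneg[OF v] by (rule power2_le_imp_le)
  \<comment> \<open>One of the two factors \<epsilon> of the duality bound is spent on \<epsilon>
    |\<Delta> w| \<le> |v|_1; the other is the rate in L^2.\<close>
  then have "2 * \<epsilon> * (\<epsilon> * ?l) \<le> 2 * \<epsilon> * H1.N v" using \<epsilon> by (intro mult_left_mono) auto
  moreover have "L2_norm lborel ?r \<le> 2 * \<epsilon>\<^sup>2 * ?l" by (rule H1_dual_bound[OF r w2 \<epsilon> eq])
  ultimately have b: "L2_norm lborel ?r \<le> 2 * \<epsilon> * H1.N v" by (simp add: power2_eq_square mult_ac)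
  show thesis by (rule that[OF w2 a b]) (simp add: c)
qed

context small_trace_form
begin

text \<open>As in Strang's lemma, both equations are tested with \<open>u - w\<close>.\<close>
lemma resolvent_difference_bound:
  assumes \<alpha>: "0 < \<alpha>" "\<And>\<epsilon> f. f \<in> form_domain \<epsilon> \<Longrightarrow> \<alpha> * (form.N \<epsilon> f)\<^sup>2 \<le> cmod (shifted z \<epsilon> f f)"
    and M: "0 \<le> M" "\<And>\<epsilon> f g. f \<in> form_domain \<epsilon> \<Longrightarrow> g \<in> form_domain \<epsilon> \<Longrightarrow> cmod (shifted z \<epsilon> f g) \<le> M * form.N \<epsilon> f * form.N \<epsilon> g"
    and \<epsilon>: "0 < \<epsilon>"
    and u: "u \<in> form_domain \<epsilon>" "\<And>h. h \<in> form_domain \<epsilon> \<Longrightarrow> shifted z \<epsilon> u h = L2_inner lborel g h"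
    and v: "v \<in> H1" "\<And>h. h \<in> H1 \<Longrightarrow> shifted z 0 v h = L2_inner lborel g h"
    and w: "w \<in> H2"
  shows "L2_norm lborel (\<lambda>x. u x - v x)
    \<le> ((M + 1) / \<alpha> + 1) * (H1.N (\<lambda>x. v x - w x) + \<epsilon> * L2_norm lborel (weak_laplacian w))"
proof -
  have D: "form_domain \<epsilon> = (H2 :: ('a \<Rightarrow> complex) set)" "form_domain 0 = (H1 :: ('a \<Rightarrow> complex) set)"
    using \<epsilon> by (simp_all add: form_domain_def)
  have wD: "w \<in> form_domain \<epsilon>" using w by (simp add: D)
  note wH = H2_H1[OF w]
  let ?r = "\<lambda>x. v x - w x" and ?y = "\<lambda>x. u x - w x" and ?l = "L2_norm lborel (weak_laplacian w)"
  have r: "?r \<in> H1" by (rule H1.diff_mem[OF v(1) wH])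
  have y: "?y \<in> form_domain \<epsilon>" by (rule form.diff_mem[OF u(1) wD])
  have yH: "?y \<in> H1" by (rule form_domain_H1[OF y])
  have y2: "?y \<in> H2" using y by (simp add: D)
  have lw: "0 \<le> ?l" by (intro L2.N_nonneg weak_laplacian_L2 w)
  note nn = H1.N_nonneg[OF r] form.N_nonneg[OF y]
  have w0: "shifted z \<epsilon> w h = shifted z 0 w h + bilaplacian_form \<epsilon> w h" for h
    by (simp add: shifted_def form_ip_def bilaplacian_form_def)
  \<comment> \<open>The data \<open>g\<close> cancel and leave the consistency error: the limit form
    on \<open>?r\<close> minus the bilaplacian form on \<open>w\<close>, both paired with
    \<open>?y\<close>.\<close>
  have "shifted z \<epsilon> ?y ?y = shifted z \<epsilon> u ?y - shifted z \<epsilon> w ?y"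
    by (rule sesquilinear_diff(1)[OF sesquilinear_shifted fun_subspace_form_domain u(1) wD y])
  also have "\<dots> = shifted z 0 v ?y - shifted z 0 w ?y - bilaplacian_form \<epsilon> w ?y"
    unfolding u(2)[OF y] v(2)[OF yH] w0 by simp
  also have "shifted z 0 v ?y - shifted z 0 w ?y = shifted z 0 ?r ?y"
    by (rule sesquilinear_diff(1)[OF sesquilinear_shifted fun_subspace_form_domain, symmetric]) (simp_all add: D v wH yH)
  finally have "cmod (shifted z \<epsilon> ?y ?y) \<le> cmod (shifted z 0 ?r ?y) + cmod (bilaplacian_form \<epsilon> w ?y)"
    using norm_triangle_ineq4 by metis
  also have "cmod (shifted z 0 ?r ?y) \<le> (M * H1.N ?r) * form.N \<epsilon> ?y"
  proof -
    have "cmod (shifted z 0 ?r ?y) \<le> M * form.N 0 ?r * form.N 0 ?y" by (rule M(2)) (simp_all add: D r yH)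
    also have "\<dots> \<le> (M * H1.N ?r) * form.N \<epsilon> ?y"
      unfolding form_N_0 by (intro mult_left_mono H1_N_le_form y mult_nonneg_nonneg M(1) nn)
    finally show ?thesis .
  qed
  also have "cmod (bilaplacian_form \<epsilon> w ?y) \<le> (\<epsilon> * ?l) * form.N \<epsilon> ?y"
  proof -
    have "cmod (bilaplacian_form \<epsilon> w ?y) = \<epsilon>\<^sup>2 * cmod (L2_inner lborel (weak_laplacian w) (weak_laplacian ?y))"
      using \<epsilon> by (simp add: bilaplacian_form_def norm_mult norm_power)
    also have "\<dots> \<le> \<epsilon>\<^sup>2 * (?l * L2_norm lborel (weak_laplacian ?y))"
      by (intro mult_left_mono L2.Cauchy_Schwarz weak_laplacian_L2 w y2) simp
    \<comment> \<open>One \<epsilon> stays with \<open>w\<close>, the other joins the Laplacian of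
      \<open>?y\<close> and is absorbed in its form norm.\<close>
    also have "\<dots> = (\<epsilon> * ?l) * (\<bar>\<epsilon>\<bar> * L2_norm lborel (weak_laplacian ?y))"
      using \<epsilon> by (simp add: power2_eq_square mult_ac)
    also have "\<dots> \<le> (\<epsilon> * ?l) * form.N \<epsilon> ?y"
      using \<epsilon> lw by (intro mult_left_mono laplacian_norm_le_form y) auto
    finally show ?thesis .
  qed
  finally have "cmod (shifted z \<epsilon> ?y ?y) \<le> (M * H1.N ?r + \<epsilon> * ?l) * form.N \<epsilon> ?y"
    by (simp add: algebra_simps)
  \<comment> \<open>\<open>M + 1\<close> dominates both coefficients \<open>M\<close> and 1. The
    last 1 in the final constant comes from passing from u - w to u - v.\<close>
  also have "\<dots> \<le> ((M + 1) * (H1.N ?r + \<epsilon> * ?l)) * form.N \<epsilon> ?y"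
  proof (rule mult_right_mono[OF _ nn(2)])
    have "0 \<le> M * (\<epsilon> * ?l)" using M(1) \<epsilon> lw by simp
    then show "M * H1.N ?r + \<epsilon> * ?l \<le> (M + 1) * (H1.N ?r + \<epsilon> * ?l)" using nn(1) by (simp add: algebra_simps)
  qed
  finally have "(form.N \<epsilon> ?y) * (form.N \<epsilon> ?y) \<le> ((M + 1) / \<alpha> * (H1.N ?r + \<epsilon> * ?l)) * form.N \<epsilon> ?y"
    using \<alpha>(2)[OF y] \<alpha>(1) by (simp add: power2_eq_square field_simps)
  moreover have "0 \<le> (M + 1) / \<alpha> * (H1.N ?r + \<epsilon> * ?l)"
    using nn(1) M(1) \<alpha>(1) \<epsilon> lw by simp
  ultimately have "form.N \<epsilon> ?y \<le> (M + 1) / \<alpha> * (H1.N ?r + \<epsilon> * ?l)"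
    by (rule le_if_square_le_mult[OF _ nn(2)])
  then have "L2_norm lborel ?y \<le> (M + 1) / \<alpha> * (H1.N ?r + \<epsilon> * ?l)"
    using L2_norm_le_form[OF y] by linarith
  moreover have "L2_norm lborel (\<lambda>x. w x - v x) \<le> H1.N ?r + \<epsilon> * ?l"
  proof -
    have "0 \<le> \<epsilon> * ?l" using \<epsilon> lw by simp
    then show ?thesis
      using L2_norm_le_H1[OF r] L2.N_minus_commute[OF H1_L2[OF wH] H1_L2[OF v(1)]] by linarith
  qed
  moreover have "L2_norm lborel (\<lambda>x. u x - v x) \<le> L2_norm lborel ?y + L2_norm lborel (\<lambda>x. w x - v x)"
    by (rule L2.N_triangle_diff[OF H1_L2[OF form_domain_H1[OF u(1)]] H1_L2[OF wH] H1_L2[OF v(1)]])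
  ultimately show ?thesis by (simp add: algebra_simps)
qed

text \<open>The threshold precedes \<open>g\<close>: all that enters about v = \<open>R0 g\<close>
  is its equation and the bound \<open>V\<close> on its H^1 norm, which is the same for the whole
  unit ball.\<close>

lemma resolvents_uniformly_close:
  assumes z: "Im z \<noteq> 0" and \<kappa>: "0 < \<kappa>"
  shows "\<exists>\<epsilon>0>0. \<forall>\<epsilon>. 0 < \<epsilon> \<longrightarrow> \<epsilon> < \<epsilon>0 \<longrightarrow> (\<forall>R R0 g. is_resolvent (form_op \<epsilon>) z R \<longrightarrow> is_resolvent (form_op 0) z R0 \<longrightarrow>
    g \<in> L2_space lborel \<longrightarrow> L2_norm lborel g \<le> 1 \<longrightarrow> L2_norm lborel (\<lambda>x. R g x - R0 g x) \<le> \<kappa>)"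
proof (rule shifted_coercive[OF z], rule shifted_bounded[of z], rule J_bounded)
  fix \<alpha> M K :: real
  assume \<alpha>: "0 < \<alpha>" "\<And>\<epsilon> f. f \<in> form_domain \<epsilon> \<Longrightarrow> \<alpha> * (form.N \<epsilon> f)\<^sup>2 \<le> cmod (shifted z \<epsilon> f f)"
    and M: "0 \<le> M" "\<And>\<epsilon> f g. f \<in> form_domain \<epsilon> \<Longrightarrow> g \<in> form_domain \<epsilon> \<Longrightarrow> cmod (shifted z \<epsilon> f g) \<le> M * form.N \<epsilon> f * form.N \<epsilon> g"
    and K: "0 \<le> K" "\<And>f. f \<in> H1 \<Longrightarrow> L2_norm \<mu> (J f) \<le> K * H1.N f"
  \<comment> \<open>\<open>P\<close> is the factor of \<open>resolvent_difference_bound\<close>, and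
    \<open>V\<close> bounds the H^1 norm of \<open>R0 g\<close>. The rest is fixed backwards from
    the goal: 2 \<tau> = (\<kappa> / P)^2, then K V \<sigma> \<le> \<tau> / 2 for the trace term,
    then 2 \<eta> V^2 = \<sigma>^2 for the trace of the residual.\<close>
  define P where "P = (M + 1) / \<alpha> + 1"
  define V where "V = 1 / \<alpha>"
  define \<tau> where "\<tau> = \<kappa>\<^sup>2 / (2 * P\<^sup>2)"
  define \<sigma> where "\<sigma> = \<tau> / (2 * (K * V + 1))"
  define \<eta> where "\<eta> = \<sigma>\<^sup>2 / (2 * V\<^sup>2)"
  have P: "0 < P" using \<alpha>(1) M(1) by (simp add: P_def add_nonneg_pos)
  have V: "0 < V" using \<alpha>(1) by (simp add: V_def)
  have \<tau>: "0 < \<tau>" using \<kappa> P by (simp add: \<tau>_def)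
  have KV: "0 \<le> K * V" using K(1) V by simp
  have \<sigma>: "0 < \<sigma>" using \<tau> KV by (simp add: \<sigma>_def)
  have \<eta>: "0 < \<eta>" using \<sigma> V by (simp add: \<eta>_def)
  obtain \<beta> where \<beta>: "0 \<le> \<beta>" "\<And>f. f \<in> H1 \<Longrightarrow> (L2_norm \<mu> (J f))\<^sup>2 \<le> \<eta> * ((H1.N f)\<^sup>2 + \<beta> * (L2_norm lborel f)\<^sup>2)"
    using small[OF \<eta>] by auto
  \<comment> \<open>Collects the two L^2 pairings with the residual; each is bounded by a multiple
    of 2 \<epsilon> V, and together they are at most \<epsilon> Q.\<close>
  define Q where "Q = 2 * V * (1 + cmod (1 + z) * V)"
  have Q: "0 < Q" using V by (simp add: Q_def add_pos_nonneg)
  \<comment> \<open>The first two entries give 4 \<beta> \<epsilon>^2 \<le> 1, hence \<beta> |r|^2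
    \<le> V^2 in L^2; the third gives \<epsilon> Q \<le> \<tau> / 2.\<close>
  define \<epsilon>0 where "\<epsilon>0 = min 1 (min (1 / (4 * (\<beta> + 1))) (\<tau> / (2 * Q)))"
  have \<epsilon>0: "0 < \<epsilon>0" using \<beta>(1) \<tau> Q by (simp add: \<epsilon>0_def)
  have "L2_norm lborel (\<lambda>x. R g x - R0 g x) \<le> \<kappa>"
    if \<epsilon>: "0 < \<epsilon>" "\<epsilon> < \<epsilon>0" and R: "is_resolvent (form_op \<epsilon>) z R" and R0: "is_resolvent (form_op 0) z R0"
      and g: "g \<in> L2_space lborel" "L2_norm lborel g \<le> 1" for \<epsilon> R R0 g
  proof -
    have D0: "form_domain 0 = (H1 :: ('a \<Rightarrow> complex) set)" by (simp add: form_domain_def)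
    note u = resolvent_equation[OF R g(1)]
    have v: "R0 g \<in> H1" "\<And>h. h \<in> H1 \<Longrightarrow> shifted z 0 (R0 g) h = L2_inner lborel g h"
      using resolvent_equation[OF R0 g(1)] by (simp_all add: D0)
    note vL = H1_L2[OF v(1)]
    \<comment> \<open>Coercivity at \<epsilon> = 0, with the equation tested by its own
      solution.\<close>
    have "\<alpha> * (H1.N (R0 g) * H1.N (R0 g)) \<le> cmod (L2_inner lborel g (R0 g))"
      using \<alpha>(2)[of "R0 g" 0] v by (simp add: D0 form_N_0 power2_eq_square)
    also have "\<dots> \<le> L2_norm lborel g * L2_norm lborel (R0 g)" by (rule L2.Cauchy_Schwarz[OF g(1) vL])
    also have "\<dots> \<le> 1 * H1.N (R0 g)"
      using g by (intro mult_mono L2_norm_le_H1 v L2.N_nonneg vL) auto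
    finally have "H1.N (R0 g) * H1.N (R0 g) \<le> V * H1.N (R0 g)" using \<alpha>(1) by (simp add: V_def field_simps)
    then have NV: "H1.N (R0 g) \<le> V"
      using H1.N_nonneg[OF v(1)] less_imp_le[OF V] by (rule le_if_square_le_mult)
    show ?thesis
    proof (rule smooth_approximation[OF v(1) \<epsilon>(1)])
      fix w assume w: "w \<in> H2" "H1.N (\<lambda>x. R0 g x - w x) \<le> H1.N (R0 g)"
        "L2_norm lborel (\<lambda>x. R0 g x - w x) \<le> 2 * \<epsilon> * H1.N (R0 g)"
        "(H1.N (\<lambda>x. R0 g x - w x))\<^sup>2 + (\<epsilon> * L2_norm lborel (weak_laplacian w))\<^sup>2 \<le> Re (H1_ip (R0 g) (\<lambda>x. R0 g x - w x))"
      let ?r = "\<lambda>x. R0 g x - w x" and ?l = "\<epsilon> * L2_norm lborel (weak_laplacian w)"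
      have r: "?r \<in> H1" by (rule H1.diff_mem[OF v(1) H2_H1[OF w(1)]])
      note rL = H1_L2[OF r]
      have r1: "H1.N ?r \<le> V" using w(2) NV by linarith
      have r2: "L2_norm lborel ?r \<le> 2 * \<epsilon> * V"
      proof -
        have "2 * \<epsilon> * H1.N (R0 g) \<le> 2 * \<epsilon> * V" using \<epsilon>(1) by (intro mult_left_mono NV) auto
        with w(3) show ?thesis by linarith
      qed
      \<comment> \<open>The H^1 norm of the residual is only known to be at most \<open>V\<close>;
        smallness comes from \<eta>, at the price of a large \<beta>, for which the L^2 rate
        pays.\<close>
      have Jr: "L2_norm \<mu> (J ?r) \<le> \<sigma>"
      proof (rule power2_le_imp_le)
        have "(H1.N ?r)\<^sup>2 \<le> V\<^sup>2" by (intro power_mono r1 H1.N_nonneg r)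
        moreover have "\<beta> * (L2_norm lborel ?r)\<^sup>2 \<le> V\<^sup>2"
        proof -
          have "\<epsilon> \<le> 1" "\<epsilon> \<le> 1 / (4 * (\<beta> + 1))" using \<epsilon>(2) by (auto simp: \<epsilon>0_def)
          then have "4 * (\<beta> + 1) * \<epsilon> \<le> 1" using \<beta>(1) by (simp add: field_simps)
          then have "(4 * (\<beta> + 1) * \<epsilon>) * \<epsilon> \<le> 1 * 1" using \<epsilon>(1) \<open>\<epsilon> \<le> 1\<close> \<beta>(1) by (intro mult_mono) auto
          moreover have "(4 * (\<beta> + 1) * \<epsilon>) * \<epsilon> = 4 * \<beta> * \<epsilon>\<^sup>2 + 4 * \<epsilon>\<^sup>2"
            by (simp add: algebra_simps power2_eq_square)
          ultimately have "4 * \<beta> * \<epsilon>\<^sup>2 \<le> 1" using zero_le_power2[of \<epsilon>] by linarith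
          then have "(4 * \<beta> * \<epsilon>\<^sup>2) * V\<^sup>2 \<le> 1 * V\<^sup>2" by (intro mult_right_mono) auto
          moreover have "\<beta> * (L2_norm lborel ?r)\<^sup>2 \<le> \<beta> * (2 * \<epsilon> * V)\<^sup>2"
            by (intro mult_left_mono power_mono r2 L2.N_nonneg rL \<beta>(1))
          ultimately show ?thesis by (simp add: power_mult_distrib mult_ac)
        qed
        ultimately have "\<eta> * ((H1.N ?r)\<^sup>2 + \<beta> * (L2_norm lborel ?r)\<^sup>2) \<le> \<eta> * (V\<^sup>2 + V\<^sup>2)"
          using \<eta> by (intro mult_left_mono add_mono) auto
        also have "\<dots> = \<sigma>\<^sup>2" using V by (simp add: \<eta>_def)
        finally show "(L2_norm \<mu> (J ?r))\<^sup>2 \<le> \<sigma>\<^sup>2" using \<beta>(2)[OF r] by linarith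
      qed (use \<sigma> in simp)
      have "Re (H1_ip (R0 g) ?r) \<le> \<tau>"
      proof -
        \<comment> \<open>The limit equation tested with the residual and solved for the H^1
          product.\<close>
        have "H1_ip (R0 g) ?r = L2_inner lborel g ?r - trace_form (R0 g) ?r + (1 + z) * L2_inner lborel (R0 g) ?r"
          using v(2)[OF r] by (simp add: shifted_def form_ip_def bilaplacian_form_def algebra_simps)
        then have "cmod (H1_ip (R0 g) ?r) \<le> cmod (L2_inner lborel g ?r) + cmod (trace_form (R0 g) ?r) + cmod (1 + z) * cmod (L2_inner lborel (R0 g) ?r)"
          using norm_triangle_ineq[of "L2_inner lborel g ?r - trace_form (R0 g) ?r" "(1 + z) * L2_inner lborel (R0 g) ?r"]
            norm_triangle_ineq4[of "L2_inner lborel g ?r" "trace_form (R0 g) ?r"]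
          unfolding norm_mult by simp
        also have "cmod (L2_inner lborel g ?r) \<le> 1 * (2 * \<epsilon> * V)"
        proof -
          have "L2_norm lborel g * L2_norm lborel ?r \<le> 1 * (2 * \<epsilon> * V)"
            using g(2) r2 by (intro mult_mono L2.N_nonneg rL) auto
          then show ?thesis using L2.Cauchy_Schwarz[OF g(1) rL] by linarith
        qed
        also have "cmod (trace_form (R0 g) ?r) \<le> K * V * \<sigma>"
        proof -
          have "L2_norm \<mu> (J (R0 g)) \<le> K * V" using K(2)[OF v(1)] mult_left_mono[OF NV K(1)] by linarith
          then have "L2_norm \<mu> (J (R0 g)) * L2_norm \<mu> (J ?r) \<le> K * V * \<sigma>"
            using Jr KV by (intro mult_mono L2.N_nonneg J_L2 r) auto
          then show ?thesis using trace_form_bound[OF v(1) r] by linarith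
        qed
        also have "cmod (1 + z) * cmod (L2_inner lborel (R0 g) ?r) \<le> cmod (1 + z) * (V * (2 * \<epsilon> * V))"
        proof (rule mult_left_mono)
          have "L2_norm lborel (R0 g) \<le> V" using L2_norm_le_H1[OF v(1)] NV by linarith
          then have "L2_norm lborel (R0 g) * L2_norm lborel ?r \<le> V * (2 * \<epsilon> * V)"
            using r2 V by (intro mult_mono L2.N_nonneg rL) auto
          then show "cmod (L2_inner lborel (R0 g) ?r) \<le> V * (2 * \<epsilon> * V)"
            using L2.Cauchy_Schwarz[OF vL rL] by linarith
        qed simp
        finally have "cmod (H1_ip (R0 g) ?r) \<le> \<epsilon> * Q + K * V * \<sigma>"
          by (simp add: Q_def algebra_simps)
        also have "\<epsilon> * Q \<le> \<tau> / 2"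
        proof -
          have "\<epsilon> \<le> \<tau> / (2 * Q)" using \<epsilon>(2) by (simp add: \<epsilon>0_def)
          then show ?thesis using Q by (simp add: field_simps)
        qed
        also have "K * V * \<sigma> \<le> \<tau> / 2"
        proof -
          have "K * V * \<sigma> \<le> (K * V + 1) * \<sigma>" using \<sigma> by (intro mult_right_mono) auto
          also have "\<dots> = \<tau> / 2" using KV by (simp add: \<sigma>_def field_simps)
          finally show ?thesis .
        qed
        finally show ?thesis using complex_Re_le_cmod[of "H1_ip (R0 g) ?r"] by simp
      qed
      then have sq: "(H1.N ?r)\<^sup>2 + ?l\<^sup>2 \<le> \<tau>" using w(4) by linarith
      have "(H1.N ?r + ?l)\<^sup>2 \<le> 2 * ((H1.N ?r)\<^sup>2 + ?l\<^sup>2)"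
        using zero_le_power2[of "H1.N ?r - ?l"] by (simp add: power2_sum power2_diff)
      also have "\<dots> \<le> 2 * \<tau>" using sq by simp
      also have "\<dots> = (\<kappa> / P)\<^sup>2" by (simp add: \<tau>_def power_divide)
      finally have "H1.N ?r + ?l \<le> \<kappa> / P" by (rule power2_le_imp_le) (use \<kappa> P in simp)
      then have "P * (H1.N ?r + ?l) \<le> \<kappa>" using P by (simp add: field_simps)
      moreover have "L2_norm lborel (\<lambda>x. R g x - R0 g x) \<le> P * (H1.N ?r + ?l)"
        unfolding P_def
        by (rule resolvent_difference_bound[OF \<alpha> M \<epsilon>(1) u(1) u(2) v(1) v(2) w(1)])
      ultimately show ?thesis by linarith
    qed
  qed
  then show ?thesis using \<epsilon>0 by blast
qed

lemma norm_resolvent_convergence_form_op: "norm_resolvent_convergence form_op (form_op 0) (at_right 0)"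
  unfolding norm_resolvent_convergence_def
proof (intro allI impI conjI)
  fix z :: complex assume z: "Im z \<noteq> 0"
  show "z \<in> resolvent_set (form_op 0)" using resolvent_exists[OF z] by (simp add: resolvent_set_def)
  show "\<forall>\<^sub>F \<epsilon> in at_right 0. z \<in> resolvent_set (form_op \<epsilon>)" using resolvent_exists[OF z] by (simp add: resolvent_set_def)
  have res: "is_resolvent (form_op \<epsilon>) z (resolvent (form_op \<epsilon>) z)" for \<epsilon>
    unfolding resolvent_def using resolvent_exists[OF z] by (rule someI_ex)
  show "((\<lambda>\<epsilon>. L2_opnorm (\<lambda>g x. resolvent (form_op \<epsilon>) z g x - resolvent (form_op 0) z g x)) \<longlongrightarrow> 0) (at_right 0)"
  proof (rule tendstoI)
    fix e :: real assume e: "0 < e"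
    \<comment> \<open>Half of \<open>e\<close>, because a supremum inherits only the non-strict
      bound.\<close>
    then obtain \<epsilon>0 where \<epsilon>0: "\<epsilon>0 > 0" "\<And>\<epsilon> g. 0 < \<epsilon> \<Longrightarrow> \<epsilon> < \<epsilon>0 \<Longrightarrow> g \<in> L2_space lborel \<Longrightarrow> L2_norm lborel g \<le> 1 \<Longrightarrow>
        L2_norm lborel (\<lambda>x. resolvent (form_op \<epsilon>) z g x - resolvent (form_op 0) z g x) \<le> e / 2"
      using resolvents_uniformly_close[OF z, of "e / 2"] res by (meson half_gt_zero)
    have "dist (L2_opnorm (\<lambda>g x. resolvent (form_op \<epsilon>) z g x - resolvent (form_op 0) z g x)) 0 < e" if \<epsilon>: "0 < \<epsilon>" "\<epsilon> < \<epsilon>0" for \<epsilon>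
    proof -
      let ?S = "{g \<in> L2_space (lborel :: 'a measure). L2_norm lborel g \<le> 1}"
      let ?n = "\<lambda>g. L2_norm lborel (\<lambda>x. resolvent (form_op \<epsilon>) z g x - resolvent (form_op 0) z g x)"
      \<comment> \<open>The supremum is taken over reals: the zero function makes the set nonempty
        and supplies the lower bound 0.\<close>
      have 0: "(\<lambda>x. 0) \<in> ?S" by (simp add: L2.zero_mem L2.N_zero)
      have le: "?n g \<le> e / 2" if "g \<in> ?S" for g using \<epsilon>0(2)[OF \<epsilon>, of g] that by blast
      have "0 \<le> ?n (\<lambda>x. 0)" by (simp add: L2_norm_def)
      also have "\<dots> \<le> (SUP g\<in>?S. ?n g)" using 0 le by (intro cSUP_upper bdd_aboveI2[of _ _ "e / 2"])
      finally have "0 \<le> (SUP g\<in>?S. ?n g)" .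
      moreover have "(SUP g\<in>?S. ?n g) \<le> e / 2" using 0 le by (intro cSUP_least) auto
      ultimately show ?thesis using e by (simp add: L2_opnorm_def)
    qed
    moreover have "\<forall>\<^sub>F \<epsilon> in at_right 0. 0 < \<epsilon> \<and> \<epsilon> < \<epsilon>0"
      using eventually_at_right_real[OF \<epsilon>0(1)] by simp
    ultimately show "\<forall>\<^sub>F \<epsilon> in at_right 0. dist (L2_opnorm (\<lambda>g x. resolvent (form_op \<epsilon>) z g x - resolvent (form_op 0) z g x)) 0 < e"
      by (auto elim!: eventually_mono)
  qed
qed

end

section \<open>From the hypothesis on |m| to the abstract setting\<close>

lemma C0_H1_N_sq:
  assumes "\<phi> \<in> C0_infinity"
  shows "(H1.N \<phi>)\<^sup>2 = (\<integral>x. (\<Sum>b\<in>Basis. (cmod (partial_deriv b \<phi> x))\<^sup>2) \<partial>lborel) + (L2_norm lborel \<phi>)\<^sup>2"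
proof -
  have "L2_norm lborel (weak_partial b \<phi>) = L2_norm lborel (partial_deriv b \<phi>)" if b: "b \<in> Basis" for b
    by (rule L2_norm_cong[OF H1_weak_partial(1)[OF C0_H1[OF assms] b] C0_L2_lborel[OF C0_partial[OF assms b]] C0_weak_partial[OF assms b]])
  moreover have "(\<integral>x. (\<Sum>b\<in>Basis. (cmod (partial_deriv b \<phi> x))\<^sup>2) \<partial>lborel) = (\<Sum>b\<in>Basis. (L2_norm lborel (partial_deriv b \<phi>))\<^sup>2)"
    unfolding L2_norm_sq
    by (intro Bochner_Integration.integral_sum L2_spaceD(2) C0_L2_lborel C0_partial assms)
  ultimately show ?thesis by (simp add: H1_N_sq C0_H1[OF assms])
qed

theorem theorem6:
  fixes mp mm :: "'a::euclidean_space measure" and B :: "'a set"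
  assumes "real_radon_measure mp mm B"
    and "\<forall>\<eta>>0. \<exists>\<beta>::real. \<forall>f\<in>C0_infinity.
           (\<integral>x. (norm (f x))\<^sup>2 \<partial>abs_measure mp mm)
             \<le> \<eta> * ((\<integral>x. (\<Sum>b\<in>Basis. (norm (partial_deriv b f x))\<^sup>2) \<partial>lborel)
                    + \<beta> * (\<integral>x. (norm (f x))\<^sup>2 \<partial>lborel))"
  shows "norm_resolvent_convergence
           (\<lambda>\<epsilon>. schroedinger_op mp mm B \<epsilon>) (schroedinger_op mp mm B 0) (at_right 0)"
proof -
  let ?\<mu> = "abs_measure mp mm"
  have radon: "radon_measure ?\<mu>" using assms(1) by (intro radon_abs_measure) (auto simp: real_radon_measure_def)
  \<comment> \<open>The hypothesis involves the gradient only and allows a negative \<beta>; passing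
    to the full H^1 norm and to \<open>max 0 \<beta>\<close> can only enlarge the right-hand
    side.\<close>
  have ineq: "\<exists>\<beta>\<ge>0. \<forall>\<phi>\<in>C0_infinity. (L2_norm ?\<mu> \<phi>)\<^sup>2 \<le> \<eta> * ((H1.N \<phi>)\<^sup>2 + \<beta> * (L2_norm lborel \<phi>)\<^sup>2)" if \<eta>: "0 < \<eta>" for \<eta>
  proof -
    obtain \<beta> where \<beta>: "\<And>\<phi>. \<phi> \<in> C0_infinity \<Longrightarrow> (L2_norm ?\<mu> \<phi>)\<^sup>2
        \<le> \<eta> * ((\<integral>x. (\<Sum>b\<in>Basis. (cmod (partial_deriv b \<phi> x))\<^sup>2) \<partial>lborel) + \<beta> * (L2_norm lborel \<phi>)\<^sup>2)"
      using assms(2) \<eta> unfolding L2_norm_sq by blast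
    have "(L2_norm ?\<mu> \<phi>)\<^sup>2 \<le> \<eta> * ((H1.N \<phi>)\<^sup>2 + max 0 \<beta> * (L2_norm lborel \<phi>)\<^sup>2)" if \<phi>: "\<phi> \<in> C0_infinity" for \<phi>
    proof -
      have "\<beta> * (L2_norm lborel \<phi>)\<^sup>2 \<le> max 0 \<beta> * (L2_norm lborel \<phi>)\<^sup>2" by (intro mult_right_mono) auto
      then have "\<eta> * ((\<integral>x. (\<Sum>b\<in>Basis. (cmod (partial_deriv b \<phi> x))\<^sup>2) \<partial>lborel) + \<beta> * (L2_norm lborel \<phi>)\<^sup>2)
          \<le> \<eta> * ((H1.N \<phi>)\<^sup>2 + max 0 \<beta> * (L2_norm lborel \<phi>)\<^sup>2)"
        using \<eta> zero_le_power2[of "L2_norm lborel \<phi>"] unfolding C0_H1_N_sq[OF \<phi>]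
        by (intro mult_left_mono) linarith+
      then show ?thesis using \<beta>[OF \<phi>] by linarith
    qed
    then show ?thesis by (intro exI[of _ "max 0 \<beta>"]) auto
  qed
  \<comment> \<open>\<eta> = 1 already makes the embedding of test functions into L^2(|m|) bounded
    in the H^1 norm, with constant sqrt(1 + \<beta>1), so the trace map exists.\<close>
  obtain \<beta>1 where \<beta>1: "0 \<le> \<beta>1" "\<And>\<phi>. \<phi> \<in> C0_infinity \<Longrightarrow> (L2_norm ?\<mu> \<phi>)\<^sup>2 \<le> (H1.N \<phi>)\<^sup>2 + \<beta>1 * (L2_norm lborel \<phi>)\<^sup>2"
    using ineq[of 1] by auto
  interpret trace_bound ?\<mu> "sqrt (1 + \<beta>1)"
  proof
    fix \<phi> :: "'a \<Rightarrow> complex" assume \<phi>: "\<phi> \<in> C0_infinity"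
    note \<phi>H = C0_H1[OF \<phi>]
    show "L2_norm ?\<mu> \<phi> \<le> sqrt (1 + \<beta>1) * H1.N \<phi>"
    proof (rule power2_le_imp_le)
      have "(L2_norm lborel \<phi>)\<^sup>2 \<le> (H1.N \<phi>)\<^sup>2" by (intro power_mono L2_norm_le_H1 L2.N_nonneg H1_L2 \<phi>H)
      from mult_left_mono[OF this \<beta>1(1)] \<beta>1(2)[OF \<phi>]
      have "(L2_norm ?\<mu> \<phi>)\<^sup>2 \<le> (H1.N \<phi>)\<^sup>2 + \<beta>1 * (H1.N \<phi>)\<^sup>2" by linarith
      then show "(L2_norm ?\<mu> \<phi>)\<^sup>2 \<le> (sqrt (1 + \<beta>1) * H1.N \<phi>)\<^sup>2"
        using \<beta>1(1) by (simp add: power_mult_distrib algebra_simps)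
    qed (use \<beta>1(1) H1.N_nonneg[OF \<phi>H] in simp)
  qed (use radon \<beta>1(1) in auto)
  interpret small_trace_form ?\<mu> "trace_map ?\<mu>" B
  proof
    show "ae_linear ?\<mu> H1 (trace_map ?\<mu>)" by (rule ae_linear_trace_map)
    show "B \<in> sets ?\<mu>" using assms(1) by (simp add: real_radon_measure_def)
    fix \<eta> :: real assume "0 < \<eta>"
    then obtain \<beta> where \<beta>: "0 \<le> \<beta>" "\<And>\<phi>. \<phi> \<in> C0_infinity \<Longrightarrow> (L2_norm ?\<mu> \<phi>)\<^sup>2 \<le> \<eta> * ((H1.N \<phi>)\<^sup>2 + \<beta> * (L2_norm lborel \<phi>)\<^sup>2)"
      using ineq by blast
    show "\<exists>\<beta>\<ge>0. \<forall>f\<in>H1. (L2_norm ?\<mu> (trace_map ?\<mu> f))\<^sup>2 \<le> \<eta> * ((H1.N f)\<^sup>2 + \<beta> * (L2_norm lborel f)\<^sup>2)"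
      using trace_map_inequality[OF \<beta>(2)] \<beta>(1) by (intro exI[of _ \<beta>]) auto
  qed
  \<comment> \<open>\<open>form_ip\<close> has one L^2 product too many and \<open>form_op\<close>
    subtracts it, so the two forms are equal as functions, for \<epsilon> = 0 as well.\<close>
  have "schroedinger_op mp mm B \<epsilon> = form_op \<epsilon>" for \<epsilon>
    unfolding schroedinger_op_def form_op_def
    by (rule arg_cong[where f = "form_operator (form_domain \<epsilon>)"], intro ext)
      (simp add: energy_form_def form_ip_def bilaplacian_form_def H1_ip_def trace_form_def Let_def)
  then show ?thesis using norm_resolvent_convergence_form_op by simp
qed

end
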